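(* Let $R_0>0$, let $D\subset\mathbf{R}^2$ be the open disc of radius $R_0$ centered at the origin and let $S:=\partial D$ denote the boundary circle. Then there exists a kernel function $K:[0,2R_0]^2\to\mathbf{R}$ such that for any $f\in C^\infty(\mathbf{R}^2)$ with support in $\overline{D}$ and any $x\in D$, $$f(x) = \frac{1}{R_0\pi^2}\, \Delta_x \int_S \int_0^{2R_0} (\mathcal{W} f)(p,t)\, K(t,|x-p|)\, dt\, ds(p).$$ An analytic expression for $K$ is (for $0\le t\le 2R_0$, $0\le \bar r<2R_0$, $t\neq\bar r$) $$K(t,\bar r) = \sqrt{4R_0^2-t^2}\,\left(-2+\log|4R_0^2-\bar r^2|\right) + \Gamma(t,\bar r),$$ where $$\Gamma(t,\bar r) = \sqrt{\bar r^2-t^2}\,\log\frac{\sqrt{4R_0^2-t^2}+\sqrt{\bar r^2-t^2}}{\sqrt{4R_0^2-t^2}-\sqrt{\bar r^2-t^2}} \quad\text{if } t<\bar r, \qquad \Gamma(t,\bar r) = 2\sqrt{t^2-\bar r^2}\,\arctan\sqrt{\frac{4R_0^2-t^2}{t^2-\bar r^2}} \quad\text{if } t>\bar r.$$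
   Context: For $f\in C^\infty(\mathbf{R}^2)$ with support in $\overline{D}$, $\mathcal{W} f$ denotes the restriction to $S\times[0,\infty)$ of the solution $u$ of the initial value problem $u_{tt}-\Delta u=0$ in $\mathbf{R}^2\times[0,\infty)$, $u(\cdot,0)=f$, $u_t(\cdot,0)=0$. $ds$ is arc length measure on $S$ and $\Delta_x$ is the Laplacian in $x$. *)

theory Defs
  imports "HOL-Analysis.Analysis"
begin

(* Intended for sets S that are open, or convex with nonempty interior: there the derivative
   within S is unique.  For a closed half-space S this is C^k regularity up to the boundary. *)
fun Ck_on :: "nat \<Rightarrow> 'a::real_normed_vector set \<Rightarrow> ('a \<Rightarrow> real) \<Rightarrow> bool" where
  "Ck_on 0 S g \<longleftrightarrow> continuous_on S g"
| "Ck_on (Suc k) S g \<longleftrightarrow> g differentiable_on S \<and>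
     (\<forall>v. Ck_on k S (\<lambda>x. frechet_derivative g (at x within S) v))"

definition smooth :: "('a::real_normed_vector \<Rightarrow> real) \<Rightarrow> bool" where
  "smooth g \<longleftrightarrow> (\<forall>k. Ck_on k UNIV g)"

(* The pure second partial derivatives of g exist at x and sum to L.  A relation is used because
   deriv has an unspecified value where the derivative does not exist. *)
definition has_laplacian :: "('a::euclidean_space \<Rightarrow> real) \<Rightarrow> real \<Rightarrow> 'a \<Rightarrow> bool" where
  "has_laplacian g L x \<longleftrightarrow>
     (\<exists>g' g''.
        (\<forall>b\<in>Basis.
           (\<forall>\<^sub>F s in nhds 0. ((\<lambda>r. g (x + r *\<^sub>R b)) has_real_derivative g' b s) (at s)) \<and>
           (g' b has_real_derivative g'' b) (at 0)) \<and>
        L = (\<Sum>b\<in>Basis. g'' b))"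

(* Classical (C^2 up to t = 0) solution of u_tt - Laplace u = 0, u(.,0) = f, u_t(.,0) = 0 on
   the whole space times [0, oo).  Only the values u x t with t >= 0 matter. *)
definition wave_solution ::
    "('a::euclidean_space \<Rightarrow> real) \<Rightarrow> ('a \<Rightarrow> real \<Rightarrow> real) \<Rightarrow> bool" where
  "wave_solution f u \<longleftrightarrow>
     Ck_on 2 (UNIV \<times> {0..}) (\<lambda>(x, t). u x t) \<and>
     (\<exists>ut utt.
        (\<forall>x. \<forall>t\<ge>0.
           (u x has_real_derivative ut x t) (at t within {0..}) \<and>
           (ut x has_real_derivative utt x t) (at t within {0..}) \<and>
           (\<exists>L. has_laplacian (\<lambda>y. u y t) L x \<and> utt x t - L = 0)) \<and>
        (\<forall>x. u x 0 = f x \<and> ut x 0 = 0))"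

(* Image of Lebesgue measure under the unit-speed parametrisation of the circle of radius R > 0
   centred at the origin; as a measure on the plane it is concentrated on that circle. *)
definition circle_arclength :: "real \<Rightarrow> (real^2) measure" where
  "circle_arclength R =
     distr (restrict_space lborel {0..<2 * pi * R}) borel
       (\<lambda>s. vector [R * cos (s / R), R * sin (s / R)])"

(* The value at t = r is irrelevant. *)
definition Gamma_kernel :: "real \<Rightarrow> real \<Rightarrow> real \<Rightarrow> real" where
  "Gamma_kernel R t r =
     (if t < r then
        sqrt (r\<^sup>2 - t\<^sup>2) *
          ln ((sqrt (4 * R\<^sup>2 - t\<^sup>2) + sqrt (r\<^sup>2 - t\<^sup>2)) /
              (sqrt (4 * R\<^sup>2 - t\<^sup>2) - sqrt (r\<^sup>2 - t\<^sup>2)))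
      else
        2 * sqrt (t\<^sup>2 - r\<^sup>2) * arctan (sqrt ((4 * R\<^sup>2 - t\<^sup>2) / (t\<^sup>2 - r\<^sup>2))))"

end

theory Submission
  imports Defs "HOL-Real_Asymp.Real_Asymp"
begin

text \<open>
  The kernel is a logarithm integrated over a chord:
  \<open>K(t, r) = \<integral> ln \<bar>v\<^sup>2 + t\<^sup>2 - r\<^sup>2\<bar> dv\<close> over \<open>0 \<le> v \<le> sqrt (4 R\<^sup>2 - t\<^sup>2)\<close>
  (\<open>inversion_kernel_has_integral\<close>). For a fixed point \<open>p\<close> of the circle,
  \<open>\<integral> u(p, t) K(t, r) dt\<close> is therefore the integral of
  \<open>u(p, t) ln \<bar>t\<^sup>2 + v\<^sup>2 - r\<^sup>2\<bar>\<close> over the quarter disc of radius \<open>2R\<close> in the \<open>(t, v)\<close> plane. In polar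
  coordinates the logarithm depends on the radius only, so what counts is the mean of
  \<open>u(p, t)\<close> over a quarter circle of radius \<open>\<rho>\<close> in that plane. By Asgeirsson's theorem it equals the
  mean of \<open>f\<close> over the circle of radius \<open>\<rho>\<close> about \<open>p\<close> (\<open>wave_asgeirsson\<close>). Hence
  \<open>\<integral> u(p, t) K(t, r) dt = (1/4) \<integral> f(y) ln \<bar>\<bar>y - p\<bar>\<^sup>2 - r\<^sup>2\<bar> dy\<close>, an integral over the plane
  (\<open>inversion_kernel_integral_eq_plane_integral\<close>).

  Put \<open>r = \<bar>z - p\<bar>\<close> and integrate over \<open>p\<close>. Since \<open>\<bar>y - p\<bar>\<^sup>2 - \<bar>z - p\<bar>\<^sup>2\<close> is affine in \<open>p\<close>, on
  the circle it is a constant times \<open>cos \<phi> + c\<close>, and \<open>\<bar>c\<bar> < 1\<close> because \<open>z\<close> lies in the open disc.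
  The integral of \<open>ln \<bar>cos \<phi> + c\<bar>\<close> over a period is \<open>- 2 \<pi> ln 2\<close> for every such \<open>c\<close>, so integration
  over the circle turns the logarithm into \<open>2 \<pi> R ln (R \<bar>y - z\<bar>)\<close> (\<open>circle_log_integral\<close>). What
  remains is the logarithmic potential of \<open>f\<close>, whose Laplacian is \<open>2 \<pi> f\<close>
  (\<open>polar_potential_laplacian\<close>); the constants combine to \<open>R \<pi>\<^sup>2 f\<close>.

  Asgeirsson's theorem is reached by way of three dimensions. The function \<open>u\<close>, read as a solution
  in space that does not depend on the third coordinate, satisfies Kirchhoff's formula
  \<open>2 \<pi> \<integral> u(p, s) ds = t \<integral> sin \<phi> h(t sin \<phi>) d\<phi>\<close>, where \<open>s\<close> runs through \<open>[0, t]\<close> and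
  \<open>h(\<rho>)\<close> is the integral of \<open>f\<close> over the circle of radius \<open>\<rho>\<close> about \<open>p\<close> (\<open>kirchhoff\<close>). It is obtained
  by differentiating a spherical integral of \<open>u\<close> along the characteristics through \<open>(p, t)\<close>
  (\<open>kirchhoff_derivative_form\<close>). It is an Abel equation for \<open>h\<close>, and the
  identity \<open>abel_mean_eq\<close>, which expresses that the first coordinate is uniformly distributed on a
  sphere, serves both to write down a solution and to show that there is only one.

  On the real numbers, \<open>ln x = ln \<bar>x\<bar>\<close> and \<open>ln 0 = 0\<close>; absolute values inside logarithms are
  omitted accordingly.
\<close>

section \<open>Logarithmic integrals\<close>

lemma ln_abs: "ln \<bar>x\<bar> = ln (x::real)"
  by (simp add: abs_if ln_minus)

lemma DERIV_ln_nonzero: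
  assumes "(x::real) \<noteq> 0"
  shows "(ln has_real_derivative 1 / x) (at x)"
proof (cases "x > 0")
  case False
  with assms have "((\<lambda>x. ln (- x)) has_real_derivative 1 / x) (at x)"
    by (auto intro!: derivative_eq_intros)
  then show ?thesis by (simp add: ln_minus)
qed (rule DERIV_ln_divide)

text \<open>
  Continuity at 0 is the point: it makes the antiderivatives of logarithms and the polar
  integrand \<open>\<rho> ln \<rho>\<close> continuous up to the singularity.
\<close>

lemma continuous_mult_ln: "continuous_on UNIV (\<lambda>x::real. x * ln x)"
proof -
  have "isCont (\<lambda>x::real. x * ln x) x" for x
  proof (cases "x = 0")
    case True
    have "((\<lambda>x::real. x * ln \<bar>x\<bar>) \<longlongrightarrow> 0) (at_right 0)" by real_asymp
    moreover have "((\<lambda>x::real. x * ln \<bar>x\<bar>) \<longlongrightarrow> 0) (at_left 0)" by real_asymp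
    ultimately show ?thesis unfolding isCont_def True by (simp add: filterlim_split_at ln_abs)
  next
    case False
    then show ?thesis by (intro continuous_intros) auto
  qed
  then show ?thesis by (simp add: continuous_on_eq_continuous_at)
qed

lemma continuous_on_mult_ln [continuous_intros]:
  assumes "continuous_on S f"
  shows "continuous_on S (\<lambda>x. f x * ln (f x :: real))"
  by (rule continuous_on_compose2[OF continuous_mult_ln assms]) auto

text \<open>
  The antiderivative \<open>(x - a) ln (x - a) - x\<close> is continuous across the singularity
  at \<open>a\<close>, so the fundamental theorem applies with the exceptional point
  \<open>a\<close>.
\<close>

lemma has_integral_ln_diff:
  fixes a c d :: real
  assumes "c \<le> d"
  shows "((\<lambda>x. ln (x - a)) has_integral
     (((d - a) * ln (d - a) - d) - ((c - a) * ln (c - a) - c))) {c..d}"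
proof (rule fundamental_theorem_of_calculus_interior_strong[of "{a}"])
  show "continuous_on {c..d} (\<lambda>x. (x - a) * ln (x - a) - x)"
    by (intro continuous_intros)
next
  fix x assume "x \<in> {c<..<d} - {a}"
  then have "((\<lambda>x. (x - a) * ln (x - a) - x) has_real_derivative ln (x - a)) (at x)"
    using DERIV_diff[OF DERIV_mult[OF DERIV_diff[OF DERIV_ident DERIV_const[of a]]
      DERIV_chain2[OF DERIV_ln_nonzero DERIV_diff[OF DERIV_ident DERIV_const[of a]]]] DERIV_ident, of x]
    by auto
  then show "((\<lambda>x. (x - a) * ln (x - a) - x) has_vector_derivative ln (x - a)) (at x)"
    by (simp add: has_real_derivative_iff_has_vector_derivative)
qed (use assms in auto)

lemma ln_le_abs: "ln x \<le> \<bar>x::real\<bar>"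
proof (cases "x = 0")
  case False
  then show ?thesis using ln_bound[of "\<bar>x\<bar>"] by (simp add: ln_abs)
qed auto

text \<open>
  An integrable function that is bounded above by an absolutely integrable one is absolutely
  integrable, and \<open>ln x \<le> \<bar>x\<bar>\<close> is such a bound.
\<close>

lemma abs_integrable_ln_diff:
  fixes a c d :: real
  shows "(\<lambda>x. ln (x - a)) absolutely_integrable_on {c..d}"
proof (cases "c \<le> d")
  case True
  show ?thesis
  proof (rule absolutely_integrable_absolutely_integrable_ubound)
    show "(\<lambda>x. ln (x - a)) integrable_on {c..d}"
      using has_integral_ln_diff[OF True] by blast
    show "(\<lambda>x. \<bar>x - a\<bar>) absolutely_integrable_on {c..d}"
      by (intro absolutely_integrable_continuous_real continuous_intros)
  qed (rule ln_le_abs)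
qed auto
lemma has_integral_ln_square_add:
  fixes c A :: real
  assumes "c > 0" "A \<ge> 0"
  shows "((\<lambda>v. ln (v\<^sup>2 + c\<^sup>2)) has_integral
     (A * ln (A\<^sup>2 + c\<^sup>2) - 2 * A + 2 * c * arctan (A / c))) {0..A}"
proof -
  have "((\<lambda>v. ln (v\<^sup>2 + c\<^sup>2)) has_integral
     ((\<lambda>v. v * ln (v\<^sup>2 + c\<^sup>2) - 2 * v + 2 * c * arctan (v / c)) A -
      (\<lambda>v. v * ln (v\<^sup>2 + c\<^sup>2) - 2 * v + 2 * c * arctan (v / c)) 0)) {0..A}"
  proof (rule fundamental_theorem_of_calculus[OF assms(2)])
    fix x :: real
    have p: "x\<^sup>2 + c\<^sup>2 > 0" using assms by (simp add: sum_power2_gt_zero_iff)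
    have "((\<lambda>v. v * ln (v\<^sup>2 + c\<^sup>2) - 2 * v + 2 * c * arctan (v / c)) has_real_derivative
       1 * ln (x\<^sup>2 + c\<^sup>2) + (2 * x * (1 / (x\<^sup>2 + c\<^sup>2))) * x - 2 + 2 * c * (inverse (1 + (x / c)\<^sup>2) * (1 / c))) (at x)"
      using p assms
      by (auto intro!: derivative_eq_intros)
    also have "1 * ln (x\<^sup>2 + c\<^sup>2) + (2 * x * (1 / (x\<^sup>2 + c\<^sup>2))) * x - 2 + 2 * c * (inverse (1 + (x / c)\<^sup>2) * (1 / c)) = ln (x\<^sup>2 + c\<^sup>2)"
    proof -
      have "inverse (1 + (x / c)\<^sup>2) = c\<^sup>2 / (x\<^sup>2 + c\<^sup>2)"
        using assms by (simp add: field_simps)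
      then have "(2 * x * (1 / (x\<^sup>2 + c\<^sup>2))) * x + 2 * c * (inverse (1 + (x / c)\<^sup>2) * (1 / c))
          = 2 * (x\<^sup>2 + c\<^sup>2) / (x\<^sup>2 + c\<^sup>2)"
        using assms by (simp add: power2_eq_square add_divide_distrib distrib_left)
      also have "\<dots> = 2" by (rule nonzero_mult_div_cancel_right) (use p in linarith)
      finally show ?thesis by simp
    qed
    finally show "((\<lambda>v. v * ln (v\<^sup>2 + c\<^sup>2) - 2 * v + 2 * c * arctan (v / c)) has_vector_derivative ln (x\<^sup>2 + c\<^sup>2)) (at x within {0..A})"
      by (simp add: has_real_derivative_iff_has_vector_derivative has_vector_derivative_at_within)
  qed
  then show ?thesis by simp
qed

text \<open>
  Away from \<open>v = b\<close> and \<open>v = - b\<close> the logarithm splits along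
  \<open>v\<^sup>2 - b\<^sup>2 = (v + b) (v - b)\<close>.
\<close>

lemma has_integral_ln_square_diff:
  fixes b A :: real
  assumes "0 \<le> b" "b < A"
  shows "((\<lambda>v. ln (v\<^sup>2 - b\<^sup>2)) has_integral
     (A * ln (A\<^sup>2 - b\<^sup>2) - 2 * A + b * ln ((A + b) / (A - b)))) {0..A}"
proof -
  have 1: "((\<lambda>v. ln (v - - b) + ln (v - b)) has_integral
      ((((A - - b) * ln (A - - b) - A) - ((0 - - b) * ln (0 - - b) - 0)) +
      (((A - b) * ln (A - b) - A) - ((0 - b) * ln (0 - b) - 0)))) {0..A}"
    by (intro has_integral_add has_integral_ln_diff) (use assms in auto)
  have 2: "ln (v\<^sup>2 - b\<^sup>2) = ln (v - - b) + ln (v - b)" if "v \<in> {0..A} - {b, - b}" for v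
  proof -
    have "v\<^sup>2 - b\<^sup>2 = (v - - b) * (v - b)" by (simp add: power2_eq_square algebra_simps)
    then show ?thesis using that by (simp add: ln_mult)
  qed
  have 3: "(((A - - b) * ln (A - - b) - A) - ((0 - - b) * ln (0 - - b) - 0)) +
      (((A - b) * ln (A - b) - A) - ((0 - b) * ln (0 - b) - 0)) =
      A * ln (A\<^sup>2 - b\<^sup>2) - 2 * A + b * ln ((A + b) / (A - b))"
    using 2[of A] assms by (simp add: ln_div ln_minus algebra_simps)
  show ?thesis
    using has_integral_spike_finite[of "{b, - b}", OF _ 2 1] unfolding 3 by simp
qed

lemma has_integral_affine_real:
  fixes f :: "real \<Rightarrow> real"
  assumes "(f has_integral I) {m * a + c..m * b + c}" "m > 0"
  shows "((\<lambda>x. f (m * x + c)) has_integral (I / m)) {a..b}"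
  using has_integral_affinity'[of f I "m * a + c" "m * b + c" m c] assms
  by (simp add: field_simps)

lemma has_integral_reflect_affine_real:
  fixes f :: "real \<Rightarrow> real"
  assumes "(f has_integral I) {c - b..c - a}"
  shows "((\<lambda>x. f (c - x)) has_integral I) {a..b}"
  using has_integral_affine_real[of "\<lambda>x. f (- x)" I 1 a "-c" b] assms
    has_integral_reflect_real[of f I "c - a" "c - b"] by simp

text \<open>
  A crude form of Jordan's inequality. It follows from \<open>x cos x \<le> sin x\<close> at
  \<open>x / 2\<close> and the duplication formula, and suffices to dominate \<open>ln (sin
  x)\<close> near 0.
\<close>

lemma sin_ge_half:
  assumes "0 \<le> x" "x \<le> pi / 2"
  shows "x / 2 \<le> sin x"
proof -
  have "0 * cos 0 - sin 0 \<ge> (x/2) * cos (x/2) - sin (x/2)"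
  proof (rule DERIV_nonpos_imp_nonincreasing[of 0 "x / 2" "\<lambda>x. x * cos x - sin x"])
    fix t assume t: "0 \<le> t" "t \<le> x / 2"
    show "\<exists>y. ((\<lambda>x. x * cos x - sin x) has_real_derivative y) (at t) \<and> y \<le> 0"
    proof (intro exI conjI)
      show "((\<lambda>x. x * cos x - sin x) has_real_derivative - (t * sin t)) (at t)"
        by (auto intro!: derivative_eq_intros)
      show "- (t * sin t) \<le> 0" using t assms by (simp add: sin_ge_zero)
    qed
  qed (use assms in auto)
  then have a: "x / 2 * cos (x / 2) \<le> sin (x / 2)" by simp
  have "cos (pi / 4) \<le> cos (x / 2)" using assms by (intro cos_monotone_0_pi_le) auto
  then have b: "cos (x / 2) \<ge> sqrt 2 / 2" by (simp add: cos_45)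
  then have b0: "cos (x/2) \<ge> 0" by (meson divide_nonneg_pos le_numeral_extra(3) order_trans real_sqrt_ge_zero zero_le_numeral zero_less_numeral)
  have "(sqrt 2 / 2)\<^sup>2 \<le> (cos (x / 2))\<^sup>2" by (rule power_mono[OF b]) simp
  then have "x * (1 / 2) \<le> x * (cos (x/2))\<^sup>2"
    using assms by (intro mult_left_mono) (auto simp: power_divide)
  then have "x / 2 \<le> x * (cos (x/2))\<^sup>2" by simp
  also have "\<dots> \<le> 2 * (sin (x/2) * cos (x/2))"
    using mult_right_mono[OF a b0] by (simp add: power2_eq_square)
  also have "\<dots> = sin x" using sin_double[of "x/2"] by simp
  finally show ?thesis .
qed

lemma integrable_ln_sin: "(\<lambda>x. ln (sin x)) integrable_on {0..pi / 2}"
proof -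
  have "(\<lambda>x. ln (sin x)) absolutely_integrable_on {0..pi/2}"
  proof (rule measurable_bounded_by_integrable_imp_absolutely_integrable)
    show "(\<lambda>x. ln (sin x)) \<in> borel_measurable (lebesgue_on {0..pi / 2})"
      by (intro measurable_restrict_space1 measurable_completion) measurable
    show "(\<lambda>x. \<bar>ln (x - 0)\<bar> + ln 2) integrable_on {0..pi/2}"
      using absolutely_integrable_abs[OF abs_integrable_ln_diff[where a=0 and c=0 and d="pi/2"]]
      by (intro integrable_add) (auto simp: set_lebesgue_integral_eq_integral)
    show "{0..pi / 2} \<in> sets lebesgue" by simp
    fix x assume x: "x \<in> {0..pi / 2}"
    show "norm (ln (sin x)) \<le> \<bar>ln (x - 0)\<bar> + ln 2"
    proof (cases "x = 0")
      case False
      then have "0 < x / 2" "x / 2 \<le> sin x" using sin_ge_half[of x] x by auto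
      then have "ln (x / 2) \<le> ln (sin x)" "ln (sin x) \<le> ln 1" by (auto intro!: ln_mono)
      then show ?thesis using False by (auto simp: ln_div)
    qed auto
  qed
  then show ?thesis by (rule absolutely_integrable_on_def[THEN iffD1, THEN conjunct1])
qed

text \<open>
  Euler's argument: with \<open>J\<close> the integral over \<open>[0, \<pi>/2]\<close>, the
  duplication formula gives \<open>J = (\<pi>/2) ln 2 + 2 J\<close>.
\<close>

lemma has_integral_ln_sin: "((\<lambda>x. ln (sin x)) has_integral (- pi * ln 2)) {0..pi}"
proof -
  define J where "J = integral {0..pi/2} (\<lambda>x. ln (sin x))"
  have h1: "((\<lambda>x. ln (sin x)) has_integral J) {0..pi/2}"
    unfolding J_def using integrable_ln_sin by blast
  have h2: "((\<lambda>x. ln (cos x)) has_integral J) {0..pi/2}"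
    using has_integral_reflect_affine_real[of "\<lambda>x. ln (sin x)" J "pi/2" "pi/2" 0] h1
    by (simp add: cos_sin_eq)
  have h3: "((\<lambda>x. ln (sin x)) has_integral J) {pi/2..pi}"
    using has_integral_reflect_affine_real[of "\<lambda>x. ln (sin x)" J "pi" "pi" "pi/2"] h1
    by simp
  have h4: "((\<lambda>x. ln (sin x)) has_integral (J + J)) {0..pi}"
    by (rule has_integral_combine[OF _ _ h1 h3]) auto
  have h5: "((\<lambda>x. ln (sin (2 * x + 0))) has_integral ((J + J) / 2)) {0..pi/2}"
    by (rule has_integral_affine_real) (use h4 in auto)
  have h6: "((\<lambda>x. ln 2 + ln (sin x) + ln (cos x)) has_integral (pi/2 * ln 2 + J + J)) {0..pi/2}"
    using has_integral_add[OF has_integral_add[OF has_integral_const_real[of "ln 2" 0 "pi/2"] h1] h2] by simp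
  have "((\<lambda>x. ln (sin (2 * x + 0))) has_integral (pi/2 * ln 2 + J + J)) {0..pi/2}"
  proof (rule has_integral_spike_finite[OF _ _ h6, of "{0, pi/2}"])
    fix x assume "x \<in> {0..pi/2} - {0, pi/2}"
    then have "sin x > 0" "cos x > 0" by (auto intro!: sin_gt_zero cos_gt_zero)
    then show "ln (sin (2 * x + 0)) = ln 2 + ln (sin x) + ln (cos x)"
      by (simp add: sin_double ln_mult)
  qed auto
  with h5 have "(J + J) / 2 = pi/2 * ln 2 + J + J" by (rule has_integral_unique)
  then have "J + J = - pi * ln 2" by (simp add: field_simps)
  with h4 show ?thesis by simp
qed

text \<open>
  The integrand has period \<open>\<pi>\<close>, because \<open>sin\<close> changes only its
  sign, so an interval of length \<open>\<pi>\<close> can be cut at a multiple of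
  \<open>\<pi>\<close> and reassembled.
\<close>

lemma has_integral_ln_sin_period:
  "((\<lambda>x. ln (sin x)) has_integral (- pi * ln 2)) {a..a + pi}"
proof -
  let ?q = "\<lambda>x. ln (sin x)"
  define k where "k = \<lfloor>a / pi\<rfloor>"
  define b where "b = a - of_int k * pi"
  have b: "0 \<le> b" "b \<le> pi"
    using floor_divide_lower[of pi a] floor_divide_upper[of pi a]
    by (auto simp: b_def k_def field_simps)
  have per: "?q (x + of_int k * pi) = ?q x" for x
  proof -
    have "sin (of_int k * pi) = 0" "\<bar>cos (of_int k * pi)\<bar> = 1"
      using sin_zero_iff_int2[of "of_int k * pi"] cos_eq_1[of "of_int k * pi"]
        sin_squared_eq[of "of_int k * pi"] by (auto simp: abs_square_eq_1)
    then have "\<bar>sin (x + of_int k * pi)\<bar> = \<bar>sin x\<bar>" by (simp add: sin_add abs_mult)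
    then show ?thesis by (metis ln_abs)
  qed
  have int: "?q integrable_on {0..pi}" using has_integral_ln_sin by blast
  have i1: "(?q has_integral integral {0..b} ?q) {0..b}" and i2: "(?q has_integral integral {b..pi} ?q) {b..pi}"
    by (intro integrable_integral integrable_subinterval_real[OF int]; use b in auto)+
  have "(?q has_integral (integral {0..b} ?q + integral {b..pi} ?q)) {0..pi}"
    by (rule has_integral_combine[OF _ _ i1 i2]) (use b in auto)
  with has_integral_ln_sin have sum: "integral {0..b} ?q + integral {b..pi} ?q = - pi * ln 2"
    by (metis has_integral_unique)
  have "((\<lambda>x. ?q (1 * x + - pi)) has_integral (integral {0..b} ?q / 1)) {pi..b + pi}"
    by (rule has_integral_affine_real) (use i1 in auto)
  then have i3: "(?q has_integral integral {0..b} ?q) {pi..b + pi}"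
    by (simp add: sin_diff ln_minus)
  have "(?q has_integral (integral {b..pi} ?q + integral {0..b} ?q)) {b..b + pi}"
    by (rule has_integral_combine[OF _ _ i2 i3]) (use b in auto)
  then have i4: "(?q has_integral (- pi * ln 2)) {b..b + pi}" using sum by (simp add: add.commute)
  have "((\<lambda>x. ?q (1 * x + - (of_int k * pi))) has_integral (- pi * ln 2 / 1)) {a..a + pi}"
    by (rule has_integral_affine_real) (use i4 in \<open>auto simp: b_def algebra_simps\<close>)
  then show ?thesis using per[of "_ - of_int k * pi"] by simp
qed

lemma has_integral_ln_cos_half:
  "((\<lambda>x. ln (cos ((x - a) / 2))) has_integral (- 2 * pi * ln 2)) {0..2 * pi}"
proof -
  have "((\<lambda>x. ln (sin (1/2 * x + (pi - a) / 2))) has_integral (- pi * ln 2 / (1/2))) {0..2 * pi}"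
    by (rule has_integral_affine_real)
      (use has_integral_ln_sin_period[of "(pi - a) / 2"] in \<open>auto simp: field_simps\<close>)
  moreover have "sin (1/2 * x + (pi - a) / 2) = cos ((x - a) / 2)" for x
    using sin_add[of "(x - a) / 2" "pi / 2"] by (simp add: diff_divide_distrib add_divide_distrib algebra_simps)
  ultimately show ?thesis by (simp add: mult_ac)
qed

lemma finite_zeros_cos_half: "finite {x \<in> {0..2 * pi}. cos ((x - d) / 2) = 0}"
proof (rule finite_subset)
  show "{x \<in> {0..2 * pi}. cos ((x - d) / 2) = 0} \<subseteq> (\<lambda>i. d + of_int i * pi) ` {\<lceil>- d / pi\<rceil>..\<lfloor>(2 * pi - d) / pi\<rfloor>}"
  proof
    fix x assume x: "x \<in> {x \<in> {0..2 * pi}. cos ((x - d) / 2) = 0}"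
    then obtain i :: int where "(x - d) / 2 = of_int i * (pi / 2)"
      by (auto simp: cos_zero_iff_int)
    then have xi: "x = d + of_int i * pi" by (simp add: field_simps)
    then have "i \<in> {\<lceil>- d / pi\<rceil>..\<lfloor>(2 * pi - d) / pi\<rfloor>}"
      using x by (auto simp: ceiling_le_iff le_floor_iff field_simps)
    with xi show "x \<in> (\<lambda>i. d + of_int i * pi) ` {\<lceil>- d / pi\<rceil>..\<lfloor>(2 * pi - d) / pi\<rfloor>}" by blast
  qed
qed simp

text \<open>
  With \<open>c = cos a\<close> the sum \<open>cos (x - b) + c\<close> is twice a product of two
  cosines of half angles, and each factor contributes \<open>- 2 \<pi> ln 2\<close>. This is why
  the value does not depend on \<open>c\<close>.
\<close>

lemma has_integral_ln_cos_add:
  assumes "\<bar>c\<bar> < 1" "m \<noteq> 0"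
  shows "((\<lambda>x. ln (m * (cos (x - b) + c))) has_integral (2 * pi * ln (m / 2))) {0..2 * pi}"
    and "(\<lambda>x. ln (m * (cos (x - b) + c))) absolutely_integrable_on {0..2 * pi}"
proof -
  define a where "a = arccos c"
  have c: "c = cos a" using assms by (simp add: a_def)
  let ?g = "\<lambda>x. ln (m * 2) + ln (cos ((x - (b - a)) / 2)) + ln (cos ((x - (b + a)) / 2))"
  define N where "N = {x \<in> {0..2*pi}. cos (x - b) + c = 0}"
  have "((\<lambda>x. ln (m * 2) + ln (cos ((x - (b - a)) / 2)) + ln (cos ((x - (b + a)) / 2))) has_integral
     (ln (m * 2) * (2 * pi) + (- 2 * pi * ln 2) + (- 2 * pi * ln 2))) {0..2 * pi}"
    using has_integral_const_real[of "ln (m * 2) :: real" 0 "2 * pi"]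
    by (intro has_integral_add has_integral_ln_cos_half) (simp add: mult.commute)
  then have 1: "(?g has_integral (2 * pi * ln (m / 2))) {0..2 * pi}"
    using assms(2) by (simp add: ln_mult ln_div algebra_simps)
  have eq: "cos (x - b) + c = 2 * cos ((x - (b - a)) / 2) * cos ((x - (b + a)) / 2)" for x
    unfolding c cos_plus_cos by (simp add: algebra_simps)
  have ln_eq: "ln (m * (cos (x - b) + c)) = ?g x" if "x \<in> {0..2 * pi} - N" for x
    using that unfolding N_def using assms(2) by (auto simp: eq ln_mult)
  have "finite N"
    by (rule finite_subset[OF _ finite_UnI[OF finite_zeros_cos_half[of "b - a"] finite_zeros_cos_half[of "b + a"]]])
      (auto simp: N_def eq)
  show "((\<lambda>x. ln (m * (cos (x - b) + c))) has_integral (2 * pi * ln (m / 2))) {0..2 * pi}"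
    by (rule has_integral_spike_finite[OF \<open>finite N\<close> ln_eq 1])
  have half: "(\<lambda>x. ln (cos ((x - d) / 2))) absolutely_integrable_on {0..2 * pi}" for d
  proof -
    have "(\<lambda>x. - ln (cos ((x - d) / 2))) absolutely_integrable_on {0..2 * pi}"
    proof (rule nonnegative_absolutely_integrable_1)
      show "(\<lambda>x. - ln (cos ((x - d) / 2))) integrable_on {0..2 * pi}"
        using has_integral_neg[OF has_integral_ln_cos_half[of d]] by blast
      show "0 \<le> - ln (cos ((x - d) / 2))" for x
      proof -
        have "\<bar>cos ((x - d) / 2)\<bar> \<le> 1" by simp
        then have "ln \<bar>cos ((x - d) / 2)\<bar> \<le> 0" by (cases "cos ((x - d) / 2) = 0") auto
        then show ?thesis by (simp add: ln_abs)
      qed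
    qed
    then show ?thesis by (simp add: absolutely_integrable_on_def integrable_neg_iff)
  qed
  have "?g absolutely_integrable_on {0..2 * pi}"
    by (intro set_integral_add half absolutely_integrable_on_const) auto
  then show "(\<lambda>x. ln (m * (cos (x - b) + c))) absolutely_integrable_on {0..2 * pi}"
    by (rule absolutely_integrable_spike[OF _ negligible_finite[OF \<open>finite N\<close>] ln_eq[symmetric, THEN sym]])
qed

section \<open>Polar coordinates in the plane\<close>

text \<open>
  A two-argument form of the vector notation. It serves as the map that carries the product
  measure on pairs to Lebesgue measure on the plane.
\<close>

definition vec2 :: "real \<Rightarrow> real \<Rightarrow> real^2" where
  "vec2 a b = vector [a, b]"

lemma vec2_nth [simp]: "vec2 a b $ 1 = a" "vec2 a b $ 2 = b"
  by (simp_all add: vec2_def)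

lemma vec2_eqI: "x $ 1 = y $ 1 \<Longrightarrow> x $ 2 = y $ 2 \<Longrightarrow> x = (y :: real^2)"
  by (simp add: vec_eq_iff forall_2)

lemma vec2_linear: "vec2 a b = a *\<^sub>R vec2 1 0 + b *\<^sub>R vec2 0 1"
  by (rule vec2_eqI) auto

lemma continuous_on_vec2 [continuous_intros]:
  assumes "continuous_on S f" "continuous_on S g"
  shows "continuous_on S (\<lambda>x. vec2 (f x) (g x))"
  by (subst vec2_linear) (intro continuous_intros assms)

lemma Basis_real2: "(Basis :: (real^2) set) = {vec2 1 0, vec2 0 1}"
proof -
  have "axis 1 1 = vec2 1 0" "axis 2 1 = vec2 0 1"
    by (auto intro!: vec2_eqI simp: axis_def)
  then show ?thesis by (auto simp: Basis_vec_def UNIV_2)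
qed

lemma inner_real2: "x \<bullet> y = x $ 1 * y $ 1 + x $ 2 * (y :: real^2) $ 2"
  by (simp add: inner_vec_def UNIV_2)

lemma norm_real2: "norm (x :: real^2) = sqrt ((x $ 1)\<^sup>2 + (x $ 2)\<^sup>2)"
  by (simp add: norm_eq_sqrt_inner inner_real2 power2_eq_square)

lemma vec2_basis_neq: "vec2 1 0 \<noteq> vec2 0 1"
  by (metis vec2_nth(1) zero_neq_one)

lemma measurable_vec2 [measurable]: "(\<lambda>x. vec2 (fst x) (snd x)) \<in> borel_measurable borel"
  by (intro borel_measurable_continuous_onI continuous_intros)

lemma lborel_real2:
  "(lborel :: (real^2) measure) = distr (lborel \<Otimes>\<^sub>M lborel) borel (\<lambda>x. vec2 (fst x) (snd x))"
proof (rule lborel_eqI)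
  fix l u :: "real^2"
  assume le: "\<And>b. b \<in> Basis \<Longrightarrow> l \<bullet> b \<le> u \<bullet> b"
  then have le': "l $ 1 \<le> u $ 1" "l $ 2 \<le> u $ 2"
    using le[of "vec2 1 0"] le[of "vec2 0 1"] by (auto simp: Basis_real2 inner_real2)
  have "(\<lambda>x. vec2 (fst x) (snd x)) -` box l u = {l $ 1<..<u $ 1} \<times> {l $ 2<..<u $ 2}"
    by (auto simp: box_def Basis_real2 inner_real2)
  then have "emeasure (distr (lborel \<Otimes>\<^sub>M lborel) borel (\<lambda>x. vec2 (fst x) (snd x))) (box l u)
      = emeasure (lborel \<Otimes>\<^sub>M lborel) ({l $ 1<..<u $ 1} \<times> {l $ 2<..<u $ 2})"
    by (subst emeasure_distr) (auto simp: space_pair_measure lborel_prod)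
  also have "\<dots> = ennreal ((u $ 1 - l $ 1) * (u $ 2 - l $ 2))"
    using le' by (subst lborel.emeasure_pair_measure_Times) (auto simp: ennreal_mult)
  also have "(u $ 1 - l $ 1) * (u $ 2 - l $ 2) = prod ((\<bullet>) (u - l)) Basis"
    by (simp add: Basis_real2 vec2_basis_neq inner_real2)
  finally show "emeasure (distr (lborel \<Otimes>\<^sub>M lborel) borel (\<lambda>x. vec2 (fst x) (snd x))) (box l u)
     = ennreal (prod ((\<bullet>) (u - l)) Basis)" .
qed simp

definition unit_dir :: "real \<Rightarrow> real^2" where
  "unit_dir \<theta> = vec2 (cos \<theta>) (sin \<theta>)"

lemma unit_dir_nth [simp]: "unit_dir \<theta> $ 1 = cos \<theta>" "unit_dir \<theta> $ 2 = sin \<theta>"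
  by (simp_all add: unit_dir_def)

lemma norm_unit_dir [simp]: "norm (unit_dir \<theta>) = 1"
  by (simp add: norm_real2)

lemma continuous_on_unit_dir [continuous_intros]:
  fixes f :: "'a::t2_space \<Rightarrow> real"
  assumes "continuous_on S f"
  shows "continuous_on S (\<lambda>x. unit_dir (f x))"
  unfolding unit_dir_def by (intro continuous_intros assms)

lemma ex_unit_dir:
  assumes "x \<noteq> 0"
  obtains \<theta> where "0 \<le> \<theta>" "\<theta> < 2 * pi" "x = norm x *\<^sub>R unit_dir \<theta>"
proof -
  have n: "norm x > 0" using assms by simp
  have "(x $ 1)\<^sup>2 + (x $ 2)\<^sup>2 = (norm x)\<^sup>2" by (simp add: norm_real2)
  then have "(x $ 1 / norm x)\<^sup>2 + (x $ 2 / norm x)\<^sup>2 = 1"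
    using n by (simp add: power_divide add_divide_distrib[symmetric])
  then obtain t where "0 \<le> t" "t < 2 * pi" "x $ 1 / norm x = cos t" "x $ 2 / norm x = sin t"
    using sincos_total_2pi by blast
  then show ?thesis using n by (intro that[of t]) (auto intro!: vec2_eqI simp: field_simps)
qed

definition polar :: "real \<times> real \<Rightarrow> real^2" where
  "polar = (\<lambda>(r, \<theta>). r *\<^sub>R unit_dir \<theta>)"

lemma continuous_on_polar: "continuous_on S polar"
  unfolding polar_def split_beta by (intro continuous_intros)

lemma measurable_polar [measurable]: "polar \<in> borel_measurable borel"
  by (intro borel_measurable_continuous_onI continuous_on_polar)

text \<open>
  The Jacobian \<open>\<rho>\<close> on the strip where polar coordinates are injective.
\<close>

definition polar_weight :: "real \<times> real \<Rightarrow> real" where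
  "polar_weight x = fst x * indicator ({0<..} \<times> {0<..<2 * pi}) x"

lemma polar_weight_nonneg [simp]: "0 \<le> polar_weight x"
  by (auto simp: polar_weight_def indicator_def)

lemma measurable_polar_weight [measurable]: "polar_weight \<in> borel_measurable borel"
proof -
  have "({0<..} \<times> {0<..<2 * pi} :: (real \<times> real) set) \<in> sets borel"
    by (intro borel_open open_Times) auto
  then have "indicat_real ({0<..} \<times> {0<..<2 * pi}) \<in> borel_measurable (borel :: (real \<times> real) measure)"
    by simp
  moreover have "(fst :: real \<times> real \<Rightarrow> real) \<in> borel_measurable borel"
    by (intro borel_measurable_continuous_onI continuous_intros)
  ultimately show ?thesis unfolding polar_weight_def[abs_def] by measurable
qed

text \<open>
  The change of variables theorem yields the measure of the image of the part of the strip that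
  polar coordinates send into a box. The image misses only points of a line, which is a null
  set.
\<close>

lemma lborel_polar:
  "(lborel :: (real^2) measure) =
     distr (density (lborel \<Otimes>\<^sub>M lborel)
       (\<lambda>x. ennreal (polar_weight x))) borel polar"
proof (rule lborel_eqI)
  fix l u :: "real^2"
  assume le: "\<And>b. b \<in> Basis \<Longrightarrow> l \<bullet> b \<le> u \<bullet> b"
  define g :: "real^2 \<Rightarrow> real^2" where "g = (\<lambda>w. w $ 1 *\<^sub>R unit_dir (w $ 2))"
  define g' :: "real^2 \<Rightarrow> real^2 \<Rightarrow> real^2" where
    "g' w = (\<lambda>h. vec2 (h $ 1 * cos (w $ 2) - w $ 1 * sin (w $ 2) * h $ 2)
                      (h $ 1 * sin (w $ 2) + w $ 1 * cos (w $ 2) * h $ 2))" for w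
  define S where "S = {w. 0 < w $ 1 \<and> 0 < w $ 2 \<and> w $ 2 < 2 * pi \<and> g w \<in> box l u}"
  have contg: "continuous_on UNIV g" unfolding g_def by (intro continuous_intros)
  have "open S"
    unfolding S_def
    by (intro open_Collect_conj open_Collect_less continuous_intros)
       (use open_vimage[OF open_box contg] in \<open>simp add: vimage_def\<close>)
  then have S: "S \<in> sets borel" by simp
  have der: "(g has_derivative g' w) (at w within S)" for w
  proof -
    have "((\<lambda>w. (w $ 1 * cos (w $ 2)) *\<^sub>R vec2 1 0 + (w $ 1 * sin (w $ 2)) *\<^sub>R vec2 0 1) has_derivative
        (\<lambda>h. (h $ 1 * cos (w $ 2) - w $ 1 * sin (w $ 2) * h $ 2) *\<^sub>R vec2 1 0
           + (h $ 1 * sin (w $ 2) + w $ 1 * cos (w $ 2) * h $ 2) *\<^sub>R vec2 0 1)) (at w within S)"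
      by (auto intro!: derivative_eq_intros bounded_linear_imp_has_derivative bounded_linear_vec_nth simp: algebra_simps)
    moreover have "g = (\<lambda>w. (w $ 1 * cos (w $ 2)) *\<^sub>R vec2 1 0 + (w $ 1 * sin (w $ 2)) *\<^sub>R vec2 0 1)"
      by (auto simp: g_def fun_eq_iff intro!: vec2_eqI)
    moreover have "g' w = (\<lambda>h. (h $ 1 * cos (w $ 2) - w $ 1 * sin (w $ 2) * h $ 2) *\<^sub>R vec2 1 0
           + (h $ 1 * sin (w $ 2) + w $ 1 * cos (w $ 2) * h $ 2) *\<^sub>R vec2 0 1)"
      by (auto simp: g'_def fun_eq_iff intro!: vec2_eqI)
    ultimately show ?thesis by simp
  qed
  have det: "\<bar>det (matrix (g' w))\<bar> = w $ 1" if "w \<in> S" for w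
  proof -
    have "det (matrix (g' w)) = w $ 1 * ((cos (w $ 2))\<^sup>2 + (sin (w $ 2))\<^sup>2)"
      by (simp add: det_2 matrix_def g'_def axis_def power2_eq_square algebra_simps del: sin_cos_squared_add sin_cos_squared_add2 sin_cos_squared_add3)
    then show ?thesis using that by (simp add: S_def)
  qed
  have inj: "inj_on g S"
  proof (rule inj_onI)
    fix v w assume vw: "v \<in> S" "w \<in> S" "g v = g w"
    have "norm (g v) = v $ 1" "norm (g w) = w $ 1" using vw(1,2) by (auto simp: g_def S_def)
    then have 1: "v $ 1 = w $ 1" using vw(3) by metis
    then have "unit_dir (v $ 2) = unit_dir (w $ 2)"
      using vw by (auto simp: g_def S_def)
    then have "cos (v $ 2) = cos (w $ 2)" "sin (v $ 2) = sin (w $ 2)" by (metis unit_dir_nth)+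
    then have "cos (v $ 2 - w $ 2) = 1" by (simp add: cos_diff)
    then obtain n :: int where n: "v $ 2 - w $ 2 = of_int n * 2 * pi" by (auto simp: cos_one_2pi_int)
    have "\<bar>v $ 2 - w $ 2\<bar> < 2 * pi" using vw by (auto simp: S_def)
    then have "\<bar>real_of_int n\<bar> * (2 * pi) < 1 * (2 * pi)" by (simp add: n abs_mult)
    then have "\<bar>real_of_int n\<bar> < 1" by simp
    then have "n = 0" by linarith
    then have "v $ 2 = w $ 2" using n by simp
    with 1 show "v = w" by (rule vec2_eqI)
  qed
  \<comment> \<open>The line that contains the ray of angle 0, which the open strip of angles omits.\<close>
  define N :: "(real^2) set" where "N = {y. vec2 0 1 \<bullet> y = 0}"
  have "negligible N" unfolding N_def
    by (rule negligible_hyperplane) (metis vec2_nth(2) zero_index zero_neq_one)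
  have img: "box l u - N \<subseteq> g ` S" "g ` S \<subseteq> box l u"
  proof -
    show "g ` S \<subseteq> box l u" by (auto simp: S_def)
    show "box l u - N \<subseteq> g ` S"
    proof
      fix y assume y: "y \<in> box l u - N"
      then have y2: "y $ 2 \<noteq> 0" by (simp add: N_def inner_real2)
      then have "y \<noteq> 0" by auto
      then obtain t where t: "0 \<le> t" "t < 2 * pi" "y = norm y *\<^sub>R unit_dir t"
        using ex_unit_dir by blast
      have "t \<noteq> 0" using y2 t(3) by (metis unit_dir_nth(2) sin_zero vector_scaleR_component scaleR_zero_right)
      then have "vec2 (norm y) t \<in> S" "g (vec2 (norm y) t) = y"
        using t \<open>y \<noteq> 0\<close> y by (auto simp: S_def g_def)
      then show "y \<in> g ` S" by (metis imageI)
    qed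
  qed
  have sd: "negligible ((g ` S - box l u) \<union> (box l u - g ` S))"
    by (rule negligible_subset[OF \<open>negligible N\<close>]) (use img in auto)
  have lm: "g ` S \<in> lmeasurable \<and> measure lebesgue (g ` S) = measure lebesgue (box l u)"
    using measure_negligible_symdiff[of "box l u" "g ` S"] lmeasurable_negligible_symdiff[of "box l u" "g ` S"] sd
    by (simp add: Un_commute)
  have "((\<lambda>w. \<bar>det (matrix (g' w))\<bar>) has_integral measure lebesgue (box l u)) S"
    using has_measure_differentiable_image[of S g g' "measure lebesgue (box l u)"] lm S der inj by auto
  then have hi: "((\<lambda>w. w $ 1) has_integral measure lebesgue (box l u)) S"
    using det has_integral_cong by (metis (no_types, lifting))
  have pv: "polar -` box l u \<in> sets (borel \<Otimes>\<^sub>M borel)"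
    unfolding borel_prod using measurable_sets_borel[OF measurable_polar, of "box l u"] by simp
  have "emeasure lborel (box l u) = (\<integral>\<^sup>+ w. ennreal (indicator S w * w $ 1) \<partial>lborel)"
    using nn_integral_has_integral_lebesgue[OF _ hi]
    by (simp add: S_def emeasure_eq_measure2 )
  also have "\<dots> = (\<integral>\<^sup>+ x. ennreal (indicator S (vec2 (fst x) (snd x)) * fst x) \<partial>(lborel \<Otimes>\<^sub>M lborel))"
    using S by (subst lborel_real2, subst nn_integral_distr) (auto simp: lborel_prod)
  also have "\<dots> = (\<integral>\<^sup>+ x. ennreal (polar_weight x) * indicator (polar -` box l u) x \<partial>(lborel \<Otimes>\<^sub>M lborel))"
    by (intro nn_integral_cong) (auto simp: S_def g_def polar_def polar_weight_def indicator_def split: if_splits)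
  also have "\<dots> = emeasure (density (lborel \<Otimes>\<^sub>M lborel)
       (\<lambda>x. ennreal (polar_weight x))) (polar -` box l u)"
    by (subst emeasure_density) (use pv in \<open>auto simp: lborel_prod\<close>)
  also have "\<dots> = emeasure (distr (density (lborel \<Otimes>\<^sub>M lborel)
       (\<lambda>x. ennreal (polar_weight x))) borel polar) (box l u)"
    by (subst emeasure_distr) (auto simp: lborel_prod)
  finally show "emeasure (distr (density (lborel \<Otimes>\<^sub>M lborel)
       (\<lambda>x. ennreal (polar_weight x))) borel polar) (box l u) = ennreal (prod ((\<bullet>) (u - l)) Basis)"
    using emeasure_lborel_box[OF le] by simp
qed simp

text \<open>
  Translates between the gauge integral, in which antiderivatives live, and the Lebesgue
  integral, in which Fubini's theorem lives; end points may be dropped as convenient.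
\<close>

lemma lborel_integral_between:
  fixes g :: "real \<Rightarrow> real"
  assumes g: "g absolutely_integrable_on {a..b}" and [measurable]: "g \<in> borel_measurable borel"
    and J: "J \<in> sets borel" "{a<..<b} \<subseteq> J" "J \<subseteq> {a..b}"
  shows "integrable lborel (\<lambda>x. indicator J x * g x)"
    and "(\<integral>x. indicator J x * g x \<partial>lborel) = integral {a..b} g"
proof -
  have mI: "(\<lambda>x. indicator A x * g x) \<in> borel_measurable lborel" if "A \<in> sets borel" for A
    using that assms(2) by (intro borel_measurable_times borel_measurable_indicator) auto
  have 1: "integrable lborel (\<lambda>x. indicator {a..b} x * g x)"
    using g unfolding set_integrable_def real_scaleR_def
    by (rule iffD1[OF integrable_completion[OF mI], rotated]) simp
  have ae: "AE x in lborel. indicator J x * g x = indicator {a..b} x * g x"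
    using AE_lborel_singleton[of a] AE_lborel_singleton[of b]
  proof eventually_elim
    case (elim x)
    then have "x \<in> {a..b} \<Longrightarrow> x \<in> {a<..<b}" by simp
    then have "x \<in> J \<longleftrightarrow> x \<in> {a..b}"
      using subsetD[OF J(2), of x] subsetD[OF J(3), of x] by blast
    then show ?case by (simp add: indicator_def)
  qed
  show "integrable lborel (\<lambda>x. indicator J x * g x)"
    by (rule iffD2[OF integrable_cong_AE[OF mI mI ae] 1]) (use J in auto)
  have "(\<integral>x. indicator J x * g x \<partial>lborel) = (\<integral>x. indicator {a..b} x * g x \<partial>lborel)"
    by (rule integral_cong_AE[OF mI mI ae]) (use J in auto)
  also have "\<dots> = (\<integral>x. indicator {a..b} x * g x \<partial>lebesgue)"
    by (rule integral_completion[OF mI, symmetric]) simp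
  also have "\<dots> = integral {a..b} g"
    using set_lebesgue_integral_eq_integral(2)[OF g]
    unfolding set_lebesgue_integral_def real_scaleR_def .
  finally show "(\<integral>x. indicator J x * g x \<partial>lborel) = integral {a..b} g" .
qed

lemma integrable_mult_pair_lborel:
  fixes a b :: "real \<Rightarrow> real"
  assumes "integrable lborel a" "integrable lborel b"
  shows "integrable (lborel \<Otimes>\<^sub>M lborel) (\<lambda>x. a (fst x) * b (snd x))"
proof (rule lborel_pair.Fubini_integrable)
  note [measurable] = borel_measurable_integrable[OF assms(1)] borel_measurable_integrable[OF assms(2)]
  show "(\<lambda>x. a (fst x) * b (snd x)) \<in> borel_measurable (lborel \<Otimes>\<^sub>M lborel)" by measurable
  show "integrable lborel (\<lambda>x. \<integral>y. norm (a (fst (x, y)) * b (snd (x, y))) \<partial>lborel)"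
    using assms by (simp add: abs_mult)
  show "AE x in lborel. integrable lborel (\<lambda>y. a (fst (x, y)) * b (snd (x, y)))"
    using assms by simp
qed

text \<open>
  Integration in polar coordinates for functions dominated by a radial function
  \<open>G\<close>. The domination is what makes Fubini's theorem applicable to integrands with
  a logarithmic singularity.
\<close>

lemma polar_integral:
  fixes h :: "real^2 \<Rightarrow> real"
  assumes [measurable]: "h \<in> borel_measurable borel" "G \<in> borel_measurable borel"
    and G: "(\<lambda>r. r * G r) absolutely_integrable_on {0..P}"
    and bound: "\<And>y. y \<noteq> 0 \<Longrightarrow> norm y \<le> P \<Longrightarrow> \<bar>h y\<bar> \<le> G (norm y)"
    and zero: "\<And>y. norm y > P \<Longrightarrow> h y = 0"
  shows "integrable lborel h"
    and "(\<integral>y. h y \<partial>lborel) = (\<integral>r. indicator {0<..P} r * (r * (\<integral>\<theta>. indicator {0<..<2 * pi} \<theta> * h (r *\<^sub>R unit_dir \<theta>) \<partial>lborel)) \<partial>lborel)"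
proof -
  let ?w = "\<lambda>x. polar_weight x * h (polar x)"
  have pol: "polar = (\<lambda>x. fst x *\<^sub>R unit_dir (snd x))" by (auto simp: polar_def)
  have mh: "(\<lambda>x. h (polar x)) \<in> borel_measurable borel"
    by (rule measurable_compose[OF measurable_polar assms(1)])
  have m: "?w \<in> borel_measurable (lborel \<Otimes>\<^sub>M lborel)"
    using borel_measurable_times[OF measurable_polar_weight mh] by (simp add: lborel_prod)
  have int: "integrable (lborel \<Otimes>\<^sub>M lborel) ?w"
  proof (rule Bochner_Integration.integrable_bound[OF _ m])
    have "integrable lborel (\<lambda>r. indicator {0<..P} r * (r * G r))"
      by (rule lborel_integral_between[OF G]) auto
    moreover have "integrable lborel (indicator {0<..<2 * pi} :: real \<Rightarrow> real)" by simp
    ultimately show "integrable (lborel \<Otimes>\<^sub>M lborel)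
        (\<lambda>x. (indicator {0<..P} (fst x) * (fst x * G (fst x))) * indicator {0<..<2 * pi} (snd x))"
      by (rule integrable_mult_pair_lborel)
    show "AE x in lborel \<Otimes>\<^sub>M lborel. norm (?w x) \<le> norm ((indicator {0<..P} (fst x) * (fst x * G (fst x))) * indicator {0<..<2 * pi} (snd x))"
    proof (intro always_eventually allI)
      fix x :: "real \<times> real"
      obtain r \<theta> where x: "x = (r, \<theta>)" by (cases x)
      show "norm (?w x) \<le> norm ((indicator {0<..P} (fst x) * (fst x * G (fst x))) * indicator {0<..<2 * pi} (snd x))"
      proof (cases "r > 0 \<and> \<theta> \<in> {0<..<2 * pi}")
        case True
        then have n: "norm (polar x) = r" by (simp add: pol x)
        have w: "polar_weight x = r" using True by (simp add: polar_weight_def x)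
        show ?thesis
        proof (cases "r \<le> P")
          case le: True
          have "polar x \<noteq> 0" using n True by auto
          then have "\<bar>h (polar x)\<bar> \<le> G r" using bound[of "polar x"] n le by simp
          then have "r * \<bar>h (polar x)\<bar> \<le> \<bar>r * G r\<bar>"
            using True by (intro order_trans[OF mult_left_mono abs_ge_self]) auto
          then show ?thesis using True le w by (simp add: x abs_mult)
        next
          case False
          then show ?thesis using zero[of "polar x"] n by simp
        qed
      next
        case False
        then have "polar_weight x = 0" by (simp add: polar_weight_def x)
        then show ?thesis by simp
      qed
    qed
  qed
  have mw: "polar_weight \<in> borel_measurable (lborel \<Otimes>\<^sub>M lborel)"
    and mp: "polar \<in> measurable (density (lborel \<Otimes>\<^sub>M lborel) polar_weight) borel"
    and mh': "(\<lambda>x. h (polar x)) \<in> borel_measurable (lborel \<Otimes>\<^sub>M lborel)"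
    using mh by (simp_all add: lborel_prod)
  have "integrable (density (lborel \<Otimes>\<^sub>M lborel) polar_weight) (\<lambda>x. h (polar x))"
    by (subst integrable_density[OF mh' mw]) (use int in simp_all)
  then show "integrable lborel h"
    unfolding lborel_polar by (subst integrable_distr_eq[OF mp]) simp_all
  have "(\<integral>y. h y \<partial>lborel) = (\<integral>x. ?w x \<partial>(lborel \<Otimes>\<^sub>M lborel))"
  proof -
    have "(\<integral>y. h y \<partial>lborel) = (\<integral>x. h (polar x) \<partial>(density (lborel \<Otimes>\<^sub>M lborel) polar_weight))"
      unfolding lborel_polar by (rule integral_distr[OF mp]) simp
    then show ?thesis by (subst (asm) integral_density[OF mh' mw]) simp_all
  qed
  also have "\<dots> = (\<integral>r. (\<integral>\<theta>. ?w (r, \<theta>) \<partial>lborel) \<partial>lborel)"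
    by (rule lborel_pair.integral_fst'[OF int, symmetric])
  also have "\<dots> = (\<integral>r. indicator {0<..P} r * (r * (\<integral>\<theta>. indicator {0<..<2 * pi} \<theta> * h (r *\<^sub>R unit_dir \<theta>) \<partial>lborel)) \<partial>lborel)"
  proof (rule Bochner_Integration.integral_cong[OF refl])
    fix r :: real
    show "(\<integral>\<theta>. ?w (r, \<theta>) \<partial>lborel) = indicator {0<..P} r * (r * (\<integral>\<theta>. indicator {0<..<2 * pi} \<theta> * h (r *\<^sub>R unit_dir \<theta>) \<partial>lborel))"
    proof (cases "r \<in> {0<..P}")
      case True
      then have "?w (r, \<theta>) = r * (indicator {0<..<2 * pi} \<theta> * h (r *\<^sub>R unit_dir \<theta>))" for \<theta>
        by (simp add: polar_weight_def pol indicator_def)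
      then show ?thesis using True by (simp add: integral_mult_right_zero)
    next
      case False
      then have "?w (r, \<theta>) = 0" for \<theta>
        using zero[of "r *\<^sub>R unit_dir \<theta>"] by (auto simp: polar_weight_def pol indicator_def)
      then have "(\<integral>\<theta>. ?w (r, \<theta>) \<partial>lborel) = (\<integral>\<theta>. 0 \<partial>(lborel :: real measure))"
        by (intro Bochner_Integration.integral_cong) auto
      then show ?thesis using False by simp
    qed
  qed
  finally show "(\<integral>y. h y \<partial>lborel) = (\<integral>r. indicator {0<..P} r * (r * (\<integral>\<theta>. indicator {0<..<2 * pi} \<theta> * h (r *\<^sub>R unit_dir \<theta>) \<partial>lborel)) \<partial>lborel)" .
qed

section \<open>Derivatives of functions of class C2\<close>

lemma Ck_on_2_derivatives:
  fixes g :: "'a::real_normed_vector \<Rightarrow> real"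
  assumes "Ck_on 2 S g"
  obtains D DD where
    "\<And>x. x \<in> S \<Longrightarrow> (g has_derivative (\<lambda>v. D v x)) (at x within S)"
    "\<And>v x. x \<in> S \<Longrightarrow> (D v has_derivative (\<lambda>w. DD v w x)) (at x within S)"
    "\<And>v w. continuous_on S (DD v w)"
proof -
  define D where "D = (\<lambda>v x. frechet_derivative g (at x within S) v)"
  define DD where "DD = (\<lambda>v w x. frechet_derivative (D v) (at x within S) w)"
  have C: "Ck_on (Suc (Suc 0)) S g" using assms by (simp only: numeral_2_eq_2)
  show ?thesis
  proof (rule that)
    show "(g has_derivative (\<lambda>v. D v x)) (at x within S)" if "x \<in> S" for x
      using C that unfolding D_def by (auto simp: differentiable_on_def frechet_derivative_works[symmetric])
    show "(D v has_derivative (\<lambda>w. DD v w x)) (at x within S)" if "x \<in> S" for v x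
      using C that unfolding DD_def by (auto simp: D_def differentiable_on_def frechet_derivative_works[symmetric])
    show "continuous_on S (DD v w)" for v w
      using C unfolding DD_def D_def by auto
  qed
qed

lemma has_derivative_path_DERIV:
  fixes g :: "'a::real_normed_vector \<Rightarrow> real"
  assumes g: "(g has_derivative g') (at (c s) within T)"
    and c: "(c has_vector_derivative c') (at s within A)" and sub: "c ` A \<subseteq> T"
  shows "((\<lambda>s. g (c s)) has_real_derivative g' c') (at s within A)"
proof -
  interpret bounded_linear g' using g by (rule has_derivative_bounded_linear)
  have "((\<lambda>s. g (c s)) has_derivative (\<lambda>h. g' (h *\<^sub>R c'))) (at s within A)"
    using has_derivative_in_compose2[OF _ sub] 
      has_derivative_in_compose[of c "\<lambda>h. h *\<^sub>R c'" s A g g'] c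
      has_derivative_subset[OF g sub]
    by (simp add: has_vector_derivative_def)
  moreover have "(\<lambda>h. g' (h *\<^sub>R c')) = (*) (g' c')"
    by (simp add: fun_eq_iff scaleR)
  ultimately show ?thesis
    by (simp add: has_field_derivative_def)
qed

text \<open>
  Symmetry of second derivatives. Integrating \<open>DD a b\<close> along \<open>a\<close> gives
  an increment of \<open>D b\<close>, by differentiation under the integral sign;
  differentiating that increment along \<open>a\<close> gives both mixed derivatives.
\<close>

lemma mixed_partials_commute:
  fixes g :: "'a::real_normed_vector \<Rightarrow> real"
  assumes U: "open U" "z \<in> U"
    and D: "\<And>x. x \<in> U \<Longrightarrow> (g has_derivative (\<lambda>v. D v x)) (at x)"
    and DD: "\<And>v x. x \<in> U \<Longrightarrow> (D v has_derivative (\<lambda>w. DD v w x)) (at x)"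
    and cont: "continuous_on U (DD a b)"
  shows "DD a b z = DD b a z"
proof -
  obtain e where e: "e > 0" "ball z e \<subseteq> U" using U open_contains_ball by blast
  \<comment> \<open>With this \<open>d\<close> the parallelogram of the points \<open>z + s a + t b\<close>, \<open>\<bar>s\<bar>, \<bar>t\<bar> \<le> d\<close>, lies in the ball.\<close>
  define d where "d = e / (2 * (norm a + norm b + 1))"
  have n: "norm a + norm b + 1 > 0" by (smt (verit) norm_ge_zero)
  have d: "d > 0" using e n by (simp add: d_def)
  have inU: "z + s *\<^sub>R a + t *\<^sub>R b \<in> U" if "s \<in> {-d..d}" "t \<in> {-d..d}" for s t
  proof -
    have "norm (s *\<^sub>R a + t *\<^sub>R b) \<le> \<bar>s\<bar> * norm a + \<bar>t\<bar> * norm b"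
      by (metis norm_scaleR norm_triangle_ineq)
    also have "\<dots> \<le> d * norm a + d * norm b"
      using that by (intro add_mono mult_right_mono) auto
    also have "\<dots> < d * (2 * (norm a + norm b + 1))" using d
      by (smt (verit) distrib_left mult_less_cancel_left_pos norm_ge_zero)
    also have "\<dots> = e" using n by (simp add: d_def)
    finally have "z + s *\<^sub>R a + t *\<^sub>R b \<in> ball z e"
      unfolding mem_ball dist_norm add.assoc
      by (metis add_diff_cancel_left' norm_minus_commute)
    then show ?thesis using e by blast
  qed
  have ds: "((\<lambda>s. h (z + s *\<^sub>R a + t *\<^sub>R b)) has_real_derivative h' a) (at s within A)"
    if "(h has_derivative h') (at (z + s *\<^sub>R a + t *\<^sub>R b))" for h h' s t A
    by (rule has_derivative_path_DERIV[where T=UNIV]) (use that in \<open>auto intro!: derivative_eq_intros simp: has_vector_derivative_def\<close>)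
  have dt: "((\<lambda>t. h (z + s *\<^sub>R a + t *\<^sub>R b)) has_real_derivative h' b) (at t within A)"
    if "(h has_derivative h') (at (z + s *\<^sub>R a + t *\<^sub>R b))" for h h' s t A
    by (rule has_derivative_path_DERIV[where T=UNIV]) (use that in \<open>auto intro!: derivative_eq_intros simp: has_vector_derivative_def\<close>)
  have contDa: "continuous_on U (D a)"
    using DD by (meson U(1) has_derivative_continuous continuous_on_eq_continuous_at)
  have ftc: "((\<lambda>\<sigma>. D a (z + \<sigma> *\<^sub>R a + t *\<^sub>R b)) has_integral
        g (z + s *\<^sub>R a + t *\<^sub>R b) - g (z + (- d) *\<^sub>R a + t *\<^sub>R b)) {-d..s}"
    if "s \<in> {-d..d}" "t \<in> {-d..d}" for s t
  proof (rule fundamental_theorem_of_calculus)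
    fix \<sigma> assume "\<sigma> \<in> {-d..s}"
    then have "z + \<sigma> *\<^sub>R a + t *\<^sub>R b \<in> U" using that by (intro inU) auto
    from ds[OF D[OF this]]
    show "((\<lambda>\<sigma>. g (z + \<sigma> *\<^sub>R a + t *\<^sub>R b)) has_vector_derivative D a (z + \<sigma> *\<^sub>R a + t *\<^sub>R b)) (at \<sigma> within {-d..s})"
      by (simp add: has_real_derivative_iff_has_vector_derivative)
  qed (use that in auto)
  have eq: "D b (z + s *\<^sub>R a) - D b (z + (- d) *\<^sub>R a) = integral {-d..s} (\<lambda>\<sigma>. DD a b (z + \<sigma> *\<^sub>R a))"
    if s: "s \<in> {-d..d}" for s
  proof -
    have cr: "continuous_on ({-d..d} \<times> cbox (-d) s) (\<lambda>(t, \<sigma>). DD a b (z + \<sigma> *\<^sub>R a + t *\<^sub>R b))"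
      unfolding split_beta
      by (rule continuous_on_compose2[OF cont]) (use s in \<open>auto intro!: continuous_intros inU\<close>)
    have "((\<lambda>t. integral (cbox (-d) s) (\<lambda>\<sigma>. D a (z + \<sigma> *\<^sub>R a + t *\<^sub>R b)))
        has_field_derivative integral (cbox (-d) s) (\<lambda>\<sigma>. DD a b (z + \<sigma> *\<^sub>R a + 0 *\<^sub>R b))) (at 0 within {-d..d})"
    proof (rule leibniz_rule_field_derivative[OF _ _ cr])
      show "((\<lambda>t. D a (z + \<sigma> *\<^sub>R a + t *\<^sub>R b)) has_real_derivative DD a b (z + \<sigma> *\<^sub>R a + t *\<^sub>R b)) (at t within {- d..d})"
        if "t \<in> {-d..d}" "\<sigma> \<in> cbox (-d) s" for t \<sigma>
        by (rule dt[where h'="\<lambda>w. DD a w (z + \<sigma> *\<^sub>R a + t *\<^sub>R b)"], rule DD, rule inU) (use that s in auto)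
      show "(\<lambda>\<sigma>. D a (z + \<sigma> *\<^sub>R a + t *\<^sub>R b)) integrable_on cbox (- d) s" if "t \<in> {-d..d}" for t
        using ftc[OF s that] by auto
    qed (use d in auto)
    moreover have "((\<lambda>t. integral (cbox (-d) s) (\<lambda>\<sigma>. D a (z + \<sigma> *\<^sub>R a + t *\<^sub>R b)))
        has_field_derivative (D b (z + s *\<^sub>R a + 0 *\<^sub>R b) - D b (z + (- d) *\<^sub>R a + 0 *\<^sub>R b))) (at 0 within {-d..d})"
    proof (rule has_field_derivative_transform_within[OF _ zero_less_one])
      show "((\<lambda>t. g (z + s *\<^sub>R a + t *\<^sub>R b) - g (z + (- d) *\<^sub>R a + t *\<^sub>R b)) has_real_derivative
         (D b (z + s *\<^sub>R a + 0 *\<^sub>R b) - D b (z + (- d) *\<^sub>R a + 0 *\<^sub>R b))) (at 0 within {-d..d})"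
        using d s by (intro DERIV_diff dt[where h'="\<lambda>v. D v _"] D inU) auto
      show "g (z + s *\<^sub>R a + t *\<^sub>R b) - g (z + (- d) *\<^sub>R a + t *\<^sub>R b) = integral (cbox (-d) s) (\<lambda>\<sigma>. D a (z + \<sigma> *\<^sub>R a + t *\<^sub>R b))"
        if "t \<in> {-d..d}" for t
        using integral_unique[OF ftc[OF s that]] by simp
    qed (use d in auto)
    moreover have "at 0 within {-d..d} = at 0" using d by (intro at_within_interior) auto
    ultimately show ?thesis by (simp add: DERIV_unique)
  qed
  have cd: "continuous_on {-d..d} (\<lambda>\<sigma>. DD a b (z + \<sigma> *\<^sub>R a))"
    by (rule continuous_on_compose2[OF cont]) (use inU[of _ 0] d in \<open>auto intro!: continuous_intros\<close>)
  have "((\<lambda>s. integral {-d..s} (\<lambda>\<sigma>. DD a b (z + \<sigma> *\<^sub>R a))) has_real_derivative DD a b (z + 0 *\<^sub>R a)) (at 0 within {-d..d})"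
    by (rule integral_has_real_derivative[OF cd]) (use d in auto)
  moreover have "((\<lambda>s. integral {-d..s} (\<lambda>\<sigma>. DD a b (z + \<sigma> *\<^sub>R a))) has_real_derivative DD b a z) (at 0 within {-d..d})"
  proof (rule has_field_derivative_transform_within[OF _ zero_less_one])
    show "((\<lambda>s. D b (z + s *\<^sub>R a) - D b (z + (- d) *\<^sub>R a)) has_real_derivative DD b a z) (at 0 within {-d..d})"
      using ds[of "D b" "\<lambda>w. DD b w z" 0 0 "{-d..d}"] DD[OF U(2)] by (auto intro!: derivative_eq_intros)
  qed (use d eq in auto)
  moreover have "at 0 within {-d..d} = at 0" using d by (intro at_within_interior) auto
  ultimately show ?thesis by (simp add: DERIV_unique)
qed

text \<open>
  Links the relational Laplacian of the wave equation with the second derivatives of a function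
  of class C2.
\<close>

lemma has_laplacian_unique:
  fixes h :: "'a::euclidean_space \<Rightarrow> real"
  assumes D: "\<And>y b. b \<in> Basis \<Longrightarrow> ((\<lambda>r. h (y + r *\<^sub>R b)) has_real_derivative D b y) (at 0)"
    and DD: "\<And>b. b \<in> Basis \<Longrightarrow> ((\<lambda>r. D b (x + r *\<^sub>R b)) has_real_derivative DD b) (at 0)"
    and L: "has_laplacian h L x"
  shows "L = (\<Sum>b\<in>Basis. DD b)"
proof -
  obtain g' g'' where g: "\<And>b. b \<in> Basis \<Longrightarrow> \<forall>\<^sub>F s in nhds 0. ((\<lambda>r. h (x + r *\<^sub>R b)) has_real_derivative g' b s) (at s)"
     "\<And>b. b \<in> Basis \<Longrightarrow> (g' b has_real_derivative g'' b) (at 0)" "L = (\<Sum>b\<in>Basis. g'' b)"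
    using L unfolding has_laplacian_def by blast
  have "g'' b = DD b" if b: "b \<in> Basis" for b
  proof -
    have D': "((\<lambda>r. h (x + r *\<^sub>R b)) has_real_derivative D b (x + s *\<^sub>R b)) (at s)" for s
    proof -
      have "((\<lambda>r. h (x + s *\<^sub>R b + (r + - s) *\<^sub>R b)) has_real_derivative D b (x + s *\<^sub>R b)) (at s)"
        using DERIV_shift[of "\<lambda>r. h (x + s *\<^sub>R b + r *\<^sub>R b)" _ s "- s"] D[OF b, of "x + s *\<^sub>R b"] by simp
      then show ?thesis by (simp add: algebra_simps)
    qed
    have "\<forall>\<^sub>F s in nhds 0. g' b s = D b (x + s *\<^sub>R b)"
      using g(1)[OF b] by eventually_elim (use D' DERIV_unique in blast)
    then have "((\<lambda>s. D b (x + s *\<^sub>R b)) has_real_derivative g'' b) (at 0)"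
      using g(2)[OF b] by (subst (asm) DERIV_cong_ev[OF refl _ refl]) 
    then show ?thesis using DD[OF b] DERIV_unique by blast
  qed
  then show ?thesis using g(3) by simp
qed

section \<open>Second derivatives on circles and hemispheres\<close>

text \<open>
  The first and second partial derivatives of a function of class C2 in the plane. The mixed
  terms enter only through their sum \<open>v12 + v21\<close>, and cancel in the trace.
\<close>

locale plane_gradient =
  fixes v1 v2 v11 v12 v21 v22 :: "real^2 \<Rightarrow> real"
  assumes deriv1: "\<And>x. (v1 has_derivative (\<lambda>h. h $ 1 * v11 x + h $ 2 * v12 x)) (at x)"
    and deriv2: "\<And>x. (v2 has_derivative (\<lambda>h. h $ 1 * v21 x + h $ 2 * v22 x)) (at x)"
    and cont11: "continuous_on UNIV v11" and cont12: "continuous_on UNIV v12"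
    and cont21: "continuous_on UNIV v21" and cont22: "continuous_on UNIV v22"
begin

text \<open>
  Derivatives in the direction \<open>unit_dir \<theta>\<close> and in the direction orthogonal
  to it; the suffix 2 marks the second derivatives.
\<close>

definition radial :: "real \<Rightarrow> real^2 \<Rightarrow> real" where
  "radial \<theta> x = cos \<theta> * v1 x + sin \<theta> * v2 x"

definition tangential :: "real \<Rightarrow> real^2 \<Rightarrow> real" where
  "tangential \<theta> x = - sin \<theta> * v1 x + cos \<theta> * v2 x"

definition radial2 :: "real \<Rightarrow> real^2 \<Rightarrow> real" where
  "radial2 \<theta> x = (cos \<theta>)\<^sup>2 * v11 x + cos \<theta> * sin \<theta> * (v12 x + v21 x) + (sin \<theta>)\<^sup>2 * v22 x"

definition tangential2 :: "real \<Rightarrow> real^2 \<Rightarrow> real" where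
  "tangential2 \<theta> x = (sin \<theta>)\<^sup>2 * v11 x - cos \<theta> * sin \<theta> * (v12 x + v21 x) + (cos \<theta>)\<^sup>2 * v22 x"

text \<open>
  The Laplacian is the trace of the second derivative, hence the same in the rotated frame.
\<close>

lemma radial2_add_tangential2: "radial2 \<theta> x + tangential2 \<theta> x = v11 x + v22 x"
proof -
  have "radial2 \<theta> x + tangential2 \<theta> x = ((cos \<theta>)\<^sup>2 + (sin \<theta>)\<^sup>2) * (v11 x + v22 x)"
    unfolding radial2_def tangential2_def by (simp add: algebra_simps del: sin_cos_squared_add sin_cos_squared_add2)
  then show ?thesis by simp
qed

lemma cont1: "continuous_on UNIV v1" and cont2: "continuous_on UNIV v2"
  using deriv1 deriv2 by (auto simp: continuous_on_eq_continuous_at intro: has_derivative_continuous)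

lemmas continuous_gradient [continuous_intros] =
  continuous_on_compose2[OF cont1 _ subset_UNIV] continuous_on_compose2[OF cont2 _ subset_UNIV]
  continuous_on_compose2[OF cont11 _ subset_UNIV] continuous_on_compose2[OF cont12 _ subset_UNIV]
  continuous_on_compose2[OF cont21 _ subset_UNIV] continuous_on_compose2[OF cont22 _ subset_UNIV]

lemma continuous_radial [continuous_intros]:
  fixes a :: "'a::t2_space \<Rightarrow> real"
  assumes "continuous_on S a" "continuous_on S b"
  shows "continuous_on S (\<lambda>x. radial (a x) (b x))" "continuous_on S (\<lambda>x. radial2 (a x) (b x))"
    "continuous_on S (\<lambda>x. tangential2 (a x) (b x))"
  unfolding radial_def radial2_def tangential2_def
  by (intro continuous_intros assms)+

lemma DERIV_gradient_line:
  assumes "(c has_vector_derivative c') (at s within A)"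
  shows "((\<lambda>s. v1 (c s)) has_real_derivative (c' $ 1 * v11 (c s) + c' $ 2 * v12 (c s))) (at s within A)"
    "((\<lambda>s. v2 (c s)) has_real_derivative (c' $ 1 * v21 (c s) + c' $ 2 * v22 (c s))) (at s within A)"
  using has_derivative_path_DERIV[of v1 _ c s UNIV c' A] has_derivative_path_DERIV[of v2 _ c s UNIV c' A]
    deriv1 deriv2 assms by auto

lemma DERIV_radial:
  assumes "(r has_real_derivative r') (at s within A)"
  shows "((\<lambda>s. radial \<theta> (p + r s *\<^sub>R unit_dir \<theta>)) has_real_derivative r' * radial2 \<theta> (p + r s *\<^sub>R unit_dir \<theta>)) (at s within A)"
proof -
  have c: "((\<lambda>s. p + r s *\<^sub>R unit_dir \<theta>) has_vector_derivative r' *\<^sub>R unit_dir \<theta>) (at s within A)"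
    using assms by (auto intro!: derivative_eq_intros simp: has_real_derivative_iff_has_vector_derivative)
  show ?thesis unfolding radial_def[abs_def]
    by (rule derivative_eq_intros DERIV_gradient_line[OF c] refl)+
       (simp add: radial2_def power2_eq_square algebra_simps)
qed

lemma has_vector_derivative_unit_dir:
  "(unit_dir has_vector_derivative vec2 (- sin \<theta>) (cos \<theta>)) (at \<theta> within A)"
proof -
  have "((\<lambda>t. cos t *\<^sub>R vec2 1 0 + sin t *\<^sub>R vec2 0 1) has_vector_derivative
     (- sin \<theta>) *\<^sub>R vec2 1 0 + cos \<theta> *\<^sub>R vec2 0 1) (at \<theta> within A)"
    by (auto intro!: derivative_eq_intros simp: has_vector_derivative_def scaleR_diff_right)
  moreover have "(\<lambda>t. cos t *\<^sub>R vec2 1 0 + sin t *\<^sub>R vec2 0 1) = unit_dir"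
    "(- sin \<theta>) *\<^sub>R vec2 1 0 + cos \<theta> *\<^sub>R vec2 0 1 = vec2 (- sin \<theta>) (cos \<theta>)"
    by (auto simp: fun_eq_iff intro!: vec2_eqI)
  ultimately show ?thesis by simp
qed

lemma DERIV_tangential:
  "((\<lambda>\<theta>. tangential \<theta> (p + r *\<^sub>R unit_dir \<theta>)) has_real_derivative
     (r * tangential2 \<theta> (p + r *\<^sub>R unit_dir \<theta>) - radial \<theta> (p + r *\<^sub>R unit_dir \<theta>))) (at \<theta> within A)"
proof -
  have c: "((\<lambda>\<theta>. p + r *\<^sub>R unit_dir \<theta>) has_vector_derivative r *\<^sub>R vec2 (- sin \<theta>) (cos \<theta>)) (at \<theta> within A)"
    by (auto intro!: derivative_eq_intros has_vector_derivative_unit_dir)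
  show ?thesis unfolding tangential_def[abs_def]
    by (rule derivative_eq_intros DERIV_gradient_line[OF c] refl)+
       (simp add: tangential2_def radial_def power2_eq_square algebra_simps)
qed

text \<open>
  The integrand is the derivative with respect to the angle of the tangential derivative, a
  periodic function. This is how second tangential derivatives are traded for first radial ones.
\<close>

lemma integral_tangential2:
  "((\<lambda>\<theta>. r * tangential2 \<theta> (p + r *\<^sub>R unit_dir \<theta>) - radial \<theta> (p + r *\<^sub>R unit_dir \<theta>)) has_integral 0) {0..2 * pi}"
proof -
  have "unit_dir (2 * pi) = unit_dir 0" by (rule vec2_eqI) auto
  then show ?thesis
    using fundamental_theorem_of_calculus[of 0 "2 * pi" "\<lambda>\<theta>. tangential \<theta> (p + r *\<^sub>R unit_dir \<theta>)"]
      DERIV_tangential[of p r]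
    by (simp add: has_real_derivative_iff_has_vector_derivative tangential_def)
qed

text \<open>
  The identity that makes Kirchhoff's formula work. For a function \<open>v\<close> of the first
  two coordinates, the integral of \<open>2 \<partial>v + s (\<partial>\<^sup>2v -
  \<Delta>v)\<close> over the upper half of the sphere of radius \<open>s\<close> about
  \<open>p\<close> in space vanishes, where \<open>\<partial>\<close> is the radial derivative
  in space. In the coordinates \<open>(\<phi>, \<theta>)\<close>, with surface element
  \<open>sin \<phi> d\<phi> d\<theta>\<close>, the integrand is a divergence: minus
  \<open>\<partial>/\<partial>\<phi> (sin \<phi> cos \<phi> radial)\<close> minus
  \<open>\<partial>/\<partial>\<theta> tangential\<close>.
\<close>

lemma hemisphere_integral_eq_0:
  "integral (cbox (0, 0) (pi / 2, 2 * pi)) (\<lambda>(\<phi>, \<theta>). let x = p + (s * sin \<phi>) *\<^sub>R unit_dir \<theta> in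
      sin \<phi> * (2 * sin \<phi> * radial \<theta> x + s * ((sin \<phi>)\<^sup>2 * radial2 \<theta> x - v11 x - v22 x))) = 0"
proof -
  let ?B = "cbox (0, 0) (pi / 2, 2 * pi) :: (real \<times> real) set"
  let ?x = "\<lambda>z. p + (s * sin (fst z)) *\<^sub>R unit_dir (snd z)"
  \<comment> \<open>\<open>P\<close> is the derivative of \<open>sin \<phi> cos \<phi> radial\<close> in \<open>\<phi>\<close>, and \<open>Q\<close> that of \<open>tangential\<close> in \<open>\<theta>\<close>.\<close>
  define P where "P = (\<lambda>z. cos (2 * fst z) * radial (snd z) (?x z)
     + sin (fst z) * cos (fst z) * (s * cos (fst z) * radial2 (snd z) (?x z)))"
  define Q where "Q = (\<lambda>z. (s * sin (fst z)) * tangential2 (snd z) (?x z) - radial (snd z) (?x z))"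
  have cP: "continuous_on ?B P" and cQ: "continuous_on ?B Q"
    unfolding P_def Q_def by (intro continuous_intros)+
  have "integral ?B Q = 0"
    unfolding integral_prod_continuous[OF cQ]
    by (simp add: Q_def integral_unique[OF integral_tangential2])
  moreover have "integral ?B P = 0"
  proof -
    have "((\<lambda>\<phi>. P (\<phi>, \<theta>)) has_integral 0) {0..pi / 2}" for \<theta>
    proof -
      have "((\<lambda>\<phi>. sin \<phi> * cos \<phi> * radial \<theta> (?x (\<phi>, \<theta>))) has_real_derivative P (\<phi>, \<theta>)) (at \<phi> within A)" for \<phi> A
      proof -
        have 1: "((\<lambda>\<phi>. s * sin \<phi>) has_real_derivative s * cos \<phi>) (at \<phi> within A)"
          by (auto intro!: derivative_eq_intros)
        have 2: "((\<lambda>\<phi>. sin \<phi> * cos \<phi>) has_real_derivative cos (2 * \<phi>)) (at \<phi> within A)"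
          by (auto intro!: derivative_eq_intros simp: cos_double power2_eq_square)
        show ?thesis
          using DERIV_mult[OF 2 DERIV_radial[OF 1, of \<theta> p]] by (simp add: P_def mult_ac add_ac)
      qed
      then show ?thesis
        using fundamental_theorem_of_calculus[of 0 "pi / 2" "\<lambda>\<phi>. sin \<phi> * cos \<phi> * radial \<theta> (?x (\<phi>, \<theta>))" "\<lambda>\<phi>. P (\<phi>, \<theta>)"]
        by (simp add: has_real_derivative_iff_has_vector_derivative)
    qed
    then have "integral (cbox 0 (pi / 2)) (\<lambda>\<phi>. P (\<phi>, \<theta>)) = 0" for \<theta>
      by (simp only: interval_cbox integral_unique)
    then have "integral (cbox 0 (2 * pi)) (\<lambda>\<theta>. integral (cbox 0 (pi / 2)) (\<lambda>\<phi>. P (\<phi>, \<theta>))) = 0"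
      by simp
    moreover have "integral (cbox 0 (pi / 2)) (\<lambda>\<phi>. integral (cbox 0 (2 * pi)) (\<lambda>\<theta>. P (\<phi>, \<theta>)))
       = integral (cbox 0 (2 * pi)) (\<lambda>\<theta>. integral (cbox 0 (pi / 2)) (\<lambda>\<phi>. P (\<phi>, \<theta>)))"
      using integral_swap_continuous[of 0 0 "pi / 2" "2 * pi" "\<lambda>\<phi> \<theta>. P (\<phi>, \<theta>)"] cP by simp
    ultimately show ?thesis unfolding integral_prod_continuous[OF cP] by simp
  qed
  moreover
  have "sin \<phi> * (2 * sin \<phi> * radial \<theta> x + s * ((sin \<phi>)\<^sup>2 * radial2 \<theta> x - v11 x - v22 x))
     = - (P (\<phi>, \<theta>) + Q (\<phi>, \<theta>))" if "x = ?x (\<phi>, \<theta>)" for \<phi> \<theta> x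
  proof -
    have alg: "S * (2 * S * r + s * (S\<^sup>2 * R - a - b)) = - ((C\<^sup>2 - S\<^sup>2) * r + S * C * (s * C * R) + (s * S * t - r))"
      if "S\<^sup>2 + C\<^sup>2 = 1" "a + b = R + t" for S C r R t a b :: real
      using that by algebra
    show ?thesis
      unfolding P_def Q_def fst_conv snd_conv that[symmetric, unfolded fst_conv snd_conv] cos_double
      by (rule alg) (simp_all add: radial2_add_tangential2)
  qed
  then have "(\<lambda>(\<phi>, \<theta>). let x = p + (s * sin \<phi>) *\<^sub>R unit_dir \<theta> in
      sin \<phi> * (2 * sin \<phi> * radial \<theta> x + s * ((sin \<phi>)\<^sup>2 * radial2 \<theta> x - v11 x - v22 x)))
      = (\<lambda>z. - (P z + Q z))"
    by (auto simp: fun_eq_iff Let_def)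
  moreover have "integral ?B (\<lambda>z. - (P z + Q z)) = - (integral ?B P + integral ?B Q)"
    unfolding integral_neg using integral_add[OF integrable_continuous[OF cP] integrable_continuous[OF cQ]] by simp
  ultimately show ?thesis by simp
qed

end

lemma Ck_2_gradient:
  fixes f :: "real^2 \<Rightarrow> real"
  assumes "Ck_on 2 UNIV f"
  obtains f1 f2 f11 f12 f21 f22 where
    "\<And>x. (f has_derivative (\<lambda>h. h $ 1 * f1 x + h $ 2 * f2 x)) (at x)"
    "plane_gradient f1 f2 f11 f12 f21 f22"
proof -
  obtain D DD where
    D: "\<And>x. (f has_derivative (\<lambda>v. D v x)) (at x)"
    and DD: "\<And>v x. (D v has_derivative (\<lambda>w. DD v w x)) (at x)"
    and c: "\<And>v w. continuous_on UNIV (DD v w)"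
    using Ck_on_2_derivatives[OF assms] by auto
  have lin: "l = (\<lambda>h. h $ 1 * l (vec2 1 0) + h $ 2 * l (vec2 0 1))"
    if "(F has_derivative l) (at x)" for F :: "real^2 \<Rightarrow> real" and l x
  proof
    fix h
    interpret bounded_linear l using that by (rule has_derivative_bounded_linear)
    have "l h = l (h $ 1 *\<^sub>R vec2 1 0 + h $ 2 *\<^sub>R vec2 0 1)"
      by (rule arg_cong[of _ _ l], rule vec2_eqI) auto
    then show "l h = h $ 1 * l (vec2 1 0) + h $ 2 * l (vec2 0 1)" by (simp add: add scaleR)
  qed
  have der: "(D v has_derivative (\<lambda>h. h $ 1 * DD v (vec2 1 0) x + h $ 2 * DD v (vec2 0 1) x)) (at x)" for v x
    using DD[of v x] lin[OF DD[of v x]] by simp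
  show ?thesis
  proof (rule that)
    show "(f has_derivative (\<lambda>h. h $ 1 * D (vec2 1 0) x + h $ 2 * D (vec2 0 1) x)) (at x)" for x
      using D[of x] lin[OF D[of x]] by simp
    show "plane_gradient (D (vec2 1 0)) (D (vec2 0 1)) (DD (vec2 1 0) (vec2 1 0)) (DD (vec2 1 0) (vec2 0 1))
        (DD (vec2 0 1) (vec2 1 0)) (DD (vec2 0 1) (vec2 0 1))"
      by unfold_locales (rule der c)+
  qed
qed

section \<open>Kirchhoff's formula for waves in the plane\<close>

text \<open>
  The time derivatives and Laplacians in the definition of a solution agree with the components
  of its second derivative on the half space; at \<open>t = 0\<close> one-sided derivatives are
  still unique.
\<close>

lemma wave_solution_boundary:
  assumes "wave_solution f u"
  obtains D DD where
    "\<And>x t. t \<ge> 0 \<Longrightarrow> ((\<lambda>(x, t). u x t) has_derivative (\<lambda>v. D v (x, t))) (at (x, t) within UNIV \<times> {0..})"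
    "\<And>v x t. t \<ge> 0 \<Longrightarrow> (D v has_derivative (\<lambda>w. DD v w (x, t))) (at (x, t) within UNIV \<times> {0..})"
    "\<And>v w. continuous_on (UNIV \<times> {0..}) (DD v w)"
    "\<And>x t. t > 0 \<Longrightarrow> DD (0, 1) (0, 1) (x, t) = (\<Sum>b\<in>Basis. DD (b, 0) (b, 0) (x, t))"
    "\<And>x. u x 0 = f x" "\<And>x. D (0, 1) (x, 0) = 0"
proof -
  let ?S = "UNIV \<times> {0..} :: ('a \<times> real) set"
  obtain ut utt where w: "Ck_on 2 ?S (\<lambda>(x, t). u x t)"
     "\<And>x t. t \<ge> 0 \<Longrightarrow> (u x has_real_derivative ut x t) (at t within {0..})"
     "\<And>x t. t \<ge> 0 \<Longrightarrow> (ut x has_real_derivative utt x t) (at t within {0..})"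
     "\<And>x t. t \<ge> 0 \<Longrightarrow> \<exists>L. has_laplacian (\<lambda>y. u y t) L x \<and> utt x t - L = 0"
     "\<And>x. u x 0 = f x" "\<And>x. ut x 0 = 0"
    using assms unfolding wave_solution_def by blast
  obtain D DD where
     D: "\<And>z. z \<in> ?S \<Longrightarrow> ((\<lambda>(x, t). u x t) has_derivative (\<lambda>v. D v z)) (at z within ?S)"
    and DD: "\<And>v z. z \<in> ?S \<Longrightarrow> (D v has_derivative (\<lambda>w. DD v w z)) (at z within ?S)"
    and c: "\<And>v w. continuous_on ?S (DD v w)"
    using Ck_on_2_derivatives[OF w(1)] by blast
  have nontriv: "at t within {0::real..} \<noteq> bot" if "t \<ge> 0" for t
  proof
    assume "at t within {0..} = bot"
    moreover have "at_right t \<le> at t within {0..}" using that by (intro at_le) auto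
    ultimately show False using trivial_limit_at_right_real[of t] by (simp add: bot_unique)
  qed
  have tpath: "((\<lambda>s. h (x, s)) has_real_derivative h' (0, 1)) (at t within {0..})"
    if "(h has_derivative h') (at (x, t) within ?S)" for h h' x t
  proof (rule has_derivative_path_DERIV[where c="\<lambda>s. (x, s)", OF that])
    have "((\<lambda>s. (x, s)) has_derivative (\<lambda>h. (0, h))) (at t within {0..})"
      by (intro has_derivative_Pair has_derivative_const has_derivative_ident)
    then show "((\<lambda>s. (x, s)) has_vector_derivative (0, 1)) (at t within {0..})"
      by (simp add: has_vector_derivative_def)
  qed auto
  have xpath: "((\<lambda>r. h (x + r *\<^sub>R b, t)) has_real_derivative h' (b, 0)) (at 0)"
    if "(h has_derivative h') (at (x, t) within ?S)" "t \<ge> 0" for h h' x t b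
  proof (rule has_derivative_path_DERIV[where c="\<lambda>r. (x + r *\<^sub>R b, t)" and s=0 and T="?S"])
    show "((\<lambda>r. (x + r *\<^sub>R b, t)) has_vector_derivative (b, 0)) (at 0)"
      by (auto intro!: derivative_eq_intros simp: has_vector_derivative_def)
  qed (use that in auto)
  have ut: "ut x t = D (0, 1) (x, t)" if "t \<ge> 0" for x t
    using tpath[OF D[of "(x, t)"]] w(2)[OF that, of x] nontriv[OF that] that
    by (auto intro: has_field_derivative_unique)
  have utt: "utt x t = DD (0, 1) (0, 1) (x, t)" if t: "t \<ge> 0" for x t
  proof -
    have "((\<lambda>s. D (0, 1) (x, s)) has_real_derivative utt x t) (at t within {0..})"
      by (rule has_field_derivative_transform_within[OF w(3)[OF t, of x] zero_less_one]) (use t ut in auto)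
    then show ?thesis
      using tpath[OF DD[of "(x, t)"]] nontriv[OF t] t by (auto intro: has_field_derivative_unique)
  qed
  show ?thesis
  proof (rule that[of D DD])
    show "D (0, 1) (x, 0) = 0" for x using ut[of 0 x] w(6) by simp
    show "DD (0, 1) (0, 1) (x, t) = (\<Sum>b\<in>Basis. DD (b, 0) (b, 0) (x, t))" if t: "t > 0" for x t
    proof -
      obtain L where L: "has_laplacian (\<lambda>y. u y t) L x" "utt x t - L = 0" using w(4)[of t x] t by auto
      have "L = (\<Sum>b\<in>Basis. DD (b, 0) (b, 0) (x, t))"
        by (rule has_laplacian_unique[OF _ _ L(1), where D="\<lambda>b y. D (b, 0) (y, t)"])
           (use xpath[OF D] xpath[OF DD] t in auto)
      then show ?thesis using L(2) utt[of t x] t by simp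
    qed
  qed (use D DD c w(5) in auto)
qed

text \<open>
  Angles \<open>(\<phi>, \<theta>)\<close> of the upper half sphere in space; \<open>sin
  \<phi>\<close> is the distance from the axis, so that the horizontal part of a unit vector is
  \<open>sin \<phi> *\<^sub>R unit_dir \<theta>\<close>.
\<close>

definition hemisphere :: "(real \<times> real) set" where
  "hemisphere = cbox (0, 0) (pi / 2, 2 * pi)"

text \<open>
  The function \<open>G s\<close> of the proof is \<open>sin \<phi> (u + s (u\<^sub>t +
  \<partial>u))\<close> at the space-time point \<open>(p + s \<omega>, T - s)\<close>, for a
  unit vector \<open>\<omega>\<close> in space with derivative \<open>\<partial>\<close> in its
  direction. This is the characteristic combination \<open>w\<^sub>t + w\<^sub>r\<close> for the
  product \<open>w\<close> of the radius and the spherical mean, which solves the wave equation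
  in one dimension. The integral of \<open>G s\<close> over the hemisphere does not depend on
  \<open>s\<close>: it is \<open>2 \<pi> u(p, T)\<close> at the vertex \<open>s = 0\<close> and
  involves only \<open>f\<close> at \<open>s = T\<close>, where \<open>u\<^sub>t = 0\<close>.
\<close>

lemma kirchhoff_derivative_form:
  fixes u :: "real^2 \<Rightarrow> real \<Rightarrow> real"
  assumes u: "wave_solution f u" and T: "T > 0"
    and f: "\<And>x. (f has_derivative (\<lambda>h. h $ 1 * f1 x + h $ 2 * f2 x)) (at x)"
  shows "2 * pi * u p T = integral hemisphere (\<lambda>(\<phi>, \<theta>).
     let x = p + (T * sin \<phi>) *\<^sub>R unit_dir \<theta> in
     sin \<phi> * (f x + T * (sin \<phi> * (cos \<theta> * f1 x + sin \<theta> * f2 x))))"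
proof -
  let ?S = "UNIV \<times> {0..} :: ((real^2) \<times> real) set"
  obtain D DD where
    D: "\<And>x t. t \<ge> 0 \<Longrightarrow> ((\<lambda>(x, t). u x t) has_derivative (\<lambda>v. D v (x, t))) (at (x, t) within ?S)"
    and DD: "\<And>v x t. t \<ge> 0 \<Longrightarrow> (D v has_derivative (\<lambda>w. DD v w (x, t))) (at (x, t) within ?S)"
    and cDD: "\<And>v w. continuous_on ?S (DD v w)"
    and wave: "\<And>x t. t > 0 \<Longrightarrow> DD (0, 1) (0, 1) (x, t) = (\<Sum>b\<in>Basis. DD (b, 0) (b, 0) (x, t))"
    and init: "\<And>x. u x 0 = f x" "\<And>x. D (0, 1) (x, 0) = 0"
    using wave_solution_boundary[OF u] by blast
  have DDz: "(D v has_derivative (\<lambda>w. DD v w z)) (at z within ?S)" if "z \<in> ?S" for v z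
    using DD[of "snd z" v "fst z"] that by auto
  define g where "g = (\<lambda>(x, t). u x t)"
  have cg: "continuous_on ?S g"
    unfolding continuous_on_eq_continuous_within g_def using has_derivative_continuous[OF D] by blast
  have cD: "continuous_on ?S (D v)" for v
    unfolding continuous_on_eq_continuous_within using has_derivative_continuous[OF DD] by blast
  define a b c where "a = (vec2 1 0, 0 :: real)" and "b = (vec2 0 1, 0 :: real)" and "c = (0 :: real^2, 1 :: real)"
  have interior: "at (x, t) within ?S = at (x, t)" if "t > 0" for x :: "real^2" and t :: real
  proof (rule at_within_open_subset)
    show "open (UNIV \<times> {0<..} :: ((real^2) \<times> real) set)" by (intro open_Times) auto
  qed (use that in auto)
  have sym: "DD v w (x, t) = DD w v (x, t)" if "t > 0" for v w x t
  proof (rule mixed_partials_commute[of "UNIV \<times> {0<..}" _ "\<lambda>(x, t). u x t" D])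
    show "open (UNIV \<times> {0<..} :: ((real^2) \<times> real) set)" by (intro open_Times) auto
    show "continuous_on (UNIV \<times> {0<..}) (DD v w)" by (rule continuous_on_subset[OF cDD]) auto
    show "((\<lambda>(x, t). u x t) has_derivative (\<lambda>v. D v z)) (at z)" if "z \<in> UNIV \<times> {0<..}" for z
      using that D[of "snd z" "fst z"] interior[of "snd z" "fst z"] by auto
    show "(D v has_derivative (\<lambda>w. DD v w z)) (at z)" if "z \<in> UNIV \<times> {0<..}" for v z
      using that DD[of "snd z" v "fst z"] interior[of "snd z" "fst z"] by auto
  qed (use that in auto)
  have lin: "l (h $ 1 *\<^sub>R vec2 1 0 + h $ 2 *\<^sub>R vec2 0 1, k) = h $ 1 * l a + h $ 2 * l b + k * l c"
    if "(F has_derivative l) (at z within ?S)" for F :: "(real^2) \<times> real \<Rightarrow> real" and l z h k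
  proof -
    interpret bounded_linear l using that by (rule has_derivative_bounded_linear)
    have "(h $ 1 *\<^sub>R vec2 1 0 + h $ 2 *\<^sub>R vec2 0 1, k) = h $ 1 *\<^sub>R a + h $ 2 *\<^sub>R b + k *\<^sub>R c"
      by (simp add: a_def b_def c_def)
    then show ?thesis by (simp add: add scaleR)
  qed
  have lin': "l (h, k) = h $ 1 * l a + h $ 2 * l b + k * l c"
    if "(F has_derivative l) (at z within ?S)" for F :: "(real^2) \<times> real \<Rightarrow> real" and l z h k
  proof -
    have "h = h $ 1 *\<^sub>R vec2 1 0 + h $ 2 *\<^sub>R vec2 0 1" by (rule vec2_eqI) auto
    then show ?thesis using lin[OF that, of h k] by simp
  qed
  let ?path = "\<lambda>s (\<phi>, \<theta>). (p + (s * sin \<phi>) *\<^sub>R unit_dir \<theta>, T - s)"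
  have path: "((\<lambda>s. F (?path s z)) has_real_derivative
      sin (fst z) * (cos (snd z) * l a + sin (snd z) * l b) - l c) (at s within A)"
    if "(F has_derivative l) (at (?path s z) within ?S)" "A \<subseteq> {..T}" for F l s z A
  proof -
    have "((\<lambda>s. F (?path s z)) has_real_derivative l (sin (fst z) *\<^sub>R unit_dir (snd z), - 1)) (at s within A)"
      by (rule has_derivative_path_DERIV[where c="\<lambda>s. ?path s z" and s=s and T="?S" and A=A, OF that(1)])
         (use that(2) in \<open>auto intro!: derivative_eq_intros simp: has_vector_derivative_def split_beta algebra_simps\<close>)
    then show ?thesis
      unfolding lin'[OF that(1)] by (simp add: algebra_simps)
  qed
  define G where "G = (\<lambda>s z. sin (fst z) * (g (?path s z) + s * (D c (?path s z) +
     sin (fst z) * (cos (snd z) * D a (?path s z) + sin (snd z) * D b (?path s z)))))"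
  define G' where "G' = (\<lambda>s z. sin (fst z) * (2 * sin (fst z) * (cos (snd z) * D a (?path s z) + sin (snd z) * D b (?path s z))
     + s * ((sin (fst z))\<^sup>2 * ((cos (snd z))\<^sup>2 * DD a a (?path s z) + cos (snd z) * sin (snd z) * (DD a b (?path s z) + DD b a (?path s z))
        + (sin (snd z))\<^sup>2 * DD b b (?path s z)) - DD a a (?path s z) - DD b b (?path s z))))"
  have contpath: "continuous_on (A \<times> B) (\<lambda>(s, z). ?path s z)" for A B
    unfolding split_beta by (intro continuous_intros)
  have comp: "continuous_on (A \<times> B) (\<lambda>(s, z). F (?path s z))" if "continuous_on ?S F" "A \<subseteq> {..T}" for A B and F :: "_ \<Rightarrow> real"
  proof -
    have "continuous_on (A \<times> B) (\<lambda>x. F ((\<lambda>(s, z). ?path s z) x))"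
      by (rule continuous_on_compose2[OF that(1) contpath]) (use that(2) in auto)
    then show ?thesis by (simp add: split_beta)
  qed
  have cG: "continuous_on ({0..T} \<times> hemisphere) (\<lambda>(s, z). G s z)"
    unfolding G_def split_beta
    by (intro continuous_intros comp[unfolded split_beta] cg cD) auto
  have cG': "continuous_on ({0<..<T} \<times> hemisphere) (\<lambda>(s, z). G' s z)"
    unfolding G'_def split_beta
    by (intro continuous_intros comp[unfolded split_beta] cDD cD) auto
  have dG: "((\<lambda>s. G s z) has_real_derivative G' s z) (at s within {0<..<T})" if s: "s \<in> {0<..<T}" for s z
  proof -
    obtain x \<tau> where x: "?path s z = (x, \<tau>)" and \<tau>: "\<tau> > 0" using s by (auto simp: split_beta)
    have g: "((\<lambda>s. g (?path s z)) has_real_derivative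
        sin (fst z) * (cos (snd z) * D a (x, \<tau>) + sin (snd z) * D b (x, \<tau>)) - D c (x, \<tau>)) (at s within {0<..<T})"
    proof (rule path)
      show "(g has_derivative (\<lambda>v. D v (x, \<tau>))) (at (?path s z) within ?S)"
        unfolding x g_def by (rule D) (use \<tau> in simp)
    qed auto
    have h: "((\<lambda>s. D v (?path s z)) has_real_derivative
        sin (fst z) * (cos (snd z) * DD v a (x, \<tau>) + sin (snd z) * DD v b (x, \<tau>)) - DD v c (x, \<tau>)) (at s within {0<..<T})" for v
    proof (rule path)
      show "(D v has_derivative (\<lambda>w. DD v w (x, \<tau>))) (at (?path s z) within ?S)"
        unfolding x by (rule DD) (use \<tau> in simp)
    qed auto
    have s1: "DD c a (x, \<tau>) = DD a c (x, \<tau>)" "DD c b (x, \<tau>) = DD b c (x, \<tau>)"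
      using sym[OF \<tau>] by auto
    \<comment> \<open>The wave equation enters here.\<close>
    have s2: "DD c c (x, \<tau>) = DD a a (x, \<tau>) + DD b b (x, \<tau>)"
      using wave[OF \<tau>, of x] by (simp add: Basis_real2 vec2_basis_neq a_def b_def c_def)
    show ?thesis
      unfolding G_def G'_def x
      by (rule derivative_eq_intros g h refl)+
         (unfold x s1 s2, simp add: algebra_simps power2_eq_square)
  qed
  have zero: "integral hemisphere (G' s) = 0" if s: "s \<in> {0<..<T}" for s
  proof -
    define \<tau> where "\<tau> = T - s"
    have \<tau>: "\<tau> > 0" using s by (simp add: \<tau>_def)
    have der: "((\<lambda>x. D v (x, \<tau>)) has_derivative (\<lambda>h. h $ 1 * DD v a (x, \<tau>) + h $ 2 * DD v b (x, \<tau>))) (at x)" for v x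
    proof -
      have "((\<lambda>x. D v (x, \<tau>)) has_derivative (\<lambda>h. DD v (h, 0) (x, \<tau>))) (at x)"
        by (rule has_derivative_in_compose2[where t="?S" and s=UNIV and g="D v" and f="\<lambda>x. (x, \<tau>)" and f'="\<lambda>h. (h, 0)" and g'="\<lambda>z w. DD v w z"])
           (use \<tau> DDz in \<open>auto intro!: derivative_eq_intros simp del: split_paired_All\<close>)
      then show ?thesis using lin'[OF DD[of \<tau> v x], of _ 0] \<tau> by simp
    qed
    have cont: "continuous_on UNIV (\<lambda>x. DD v w (x, \<tau>))" for v w
      by (rule continuous_on_compose2[OF cDD]) (use \<tau> in \<open>auto intro!: continuous_intros\<close>)
    interpret plane_gradient "\<lambda>x. D a (x, \<tau>)" "\<lambda>x. D b (x, \<tau>)" "\<lambda>x. DD a a (x, \<tau>)" "\<lambda>x. DD a b (x, \<tau>)"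
      "\<lambda>x. DD b a (x, \<tau>)" "\<lambda>x. DD b b (x, \<tau>)"
      by unfold_locales (rule der cont)+
    show ?thesis
      using hemisphere_integral_eq_0[of p s] unfolding radial_def radial2_def
      by (simp add: G'_def hemisphere_def \<tau>_def case_prod_unfold Let_def)
  qed
  have "integral hemisphere (G T) = integral hemisphere (G 0)"
  proof (rule DERIV_isconst_end[OF T, where f="\<lambda>s. integral hemisphere (G s)"])
    show "continuous_on {0..T} (\<lambda>s. integral hemisphere (G s))"
      using integral_continuous_on_param[of "{0..T}" "(0, 0)" "(pi / 2, 2 * pi)" G] cG by (simp add: hemisphere_def)
    show "((\<lambda>s. integral hemisphere (G s)) has_real_derivative 0) (at s)" if "0 < s" "s < T" for s
    proof -
      have int: "G s integrable_on cbox (0, 0) (pi / 2, 2 * pi)" if "s \<in> {0<..<T}" for s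
      proof (rule integrable_continuous)
        show "continuous_on (cbox (0, 0) (pi / 2, 2 * pi)) (G s)"
        proof -
          have "continuous_on (cbox (0, 0) (pi / 2, 2 * pi)) (\<lambda>z. (\<lambda>(s, z). G s z) (s, z))"
            by (rule continuous_on_compose2[OF cG continuous_on_Pair[OF continuous_on_const continuous_on_id]])
              (use that in \<open>auto simp: hemisphere_def\<close>)
          then show ?thesis by simp
        qed
      qed
      have "((\<lambda>s. integral hemisphere (G s)) has_real_derivative integral hemisphere (G' s)) (at s within {0<..<T})"
        unfolding hemisphere_def
        by (rule leibniz_rule_field_derivative[OF dG int cG'[unfolded hemisphere_def]]) (use that in auto)
      moreover have "at s within {0<..<T} = at s" using that by (intro at_within_open) auto
      ultimately show ?thesis using zero[of s] that by simp
    qed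
  qed
  moreover have "integral hemisphere (G 0) = 2 * pi * u p T"
  proof -
    have G0: "G 0 = (\<lambda>z. sin (fst z) * u p T)" by (auto simp: G_def g_def fun_eq_iff)
    have "(sin has_integral (- cos (pi / 2) - - cos 0)) {0..pi / 2}"
      by (rule fundamental_theorem_of_calculus)
         (auto intro!: derivative_eq_intros simp: has_real_derivative_iff_has_vector_derivative[symmetric])
    then have "integral {0..pi / 2} sin = (1 :: real)" by (simp add: integral_unique)
    then show ?thesis
      unfolding G0 hemisphere_def by (subst integral_prod_continuous) (auto intro!: continuous_intros simp: mult_ac)
  qed
  moreover have "G T = (\<lambda>(\<phi>, \<theta>). let x = p + (T * sin \<phi>) *\<^sub>R unit_dir \<theta> in
     sin \<phi> * (f x + T * (sin \<phi> * (cos \<theta> * f1 x + sin \<theta> * f2 x))))"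
  proof -
    have grad: "D (e, 0) (x, 0) = e $ 1 * f1 x + e $ 2 * f2 x" for e x
    proof (rule DERIV_unique)
      have "((\<lambda>r. (\<lambda>(x, t). u x t) (x + r *\<^sub>R e, 0)) has_real_derivative D (e, 0) (x, 0)) (at 0)"
        by (rule has_derivative_path_DERIV[where T="?S"])
           (use D[of 0 x] in \<open>auto intro!: derivative_eq_intros simp: has_vector_derivative_def\<close>)
      then show "((\<lambda>r. f (x + r *\<^sub>R e)) has_real_derivative D (e, 0) (x, 0)) (at 0)" by (simp add: init)
      show "((\<lambda>r. f (x + r *\<^sub>R e)) has_real_derivative (e $ 1 * f1 x + e $ 2 * f2 x)) (at 0)"
        by (rule has_derivative_path_DERIV[where T=UNIV])
           (use f[of x] in \<open>auto intro!: derivative_eq_intros simp: has_vector_derivative_def\<close>)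
    qed
    show ?thesis
      by (auto simp: G_def g_def a_def b_def c_def init grad fun_eq_iff Let_def)
  qed
  ultimately show ?thesis by simp
qed

lemma wave_solution_continuous:
  assumes "wave_solution f u"
  shows "continuous_on (UNIV \<times> {0..}) (\<lambda>z. u (fst z) (snd z))"
proof -
  have "Ck_on (Suc (Suc 0)) (UNIV \<times> {0..}) (\<lambda>(x, t). u x t)"
    using assms by (simp add: wave_solution_def numeral_2_eq_2)
  then have "continuous_on (UNIV \<times> {0..}) (\<lambda>(x, t). u x t)"
    by (intro differentiable_imp_continuous_on) simp
  then show ?thesis by (simp add: case_prod_unfold)
qed

definition circle_integral :: "(real^2 \<Rightarrow> real) \<Rightarrow> real^2 \<Rightarrow> real \<Rightarrow> real" where
  "circle_integral f p r = integral {0..2 * pi} (\<lambda>\<theta>. f (p + r *\<^sub>R unit_dir \<theta>))"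

lemma continuous_circle_integral:
  assumes "continuous_on UNIV f"
  shows "continuous_on UNIV (circle_integral f p)"
  unfolding circle_integral_def interval_cbox
  by (rule integral_continuous_on_param)
     (auto intro!: continuous_intros continuous_on_compose2[OF assms] simp: split_beta)

text \<open>
  The right-hand side of the preceding formula is the derivative of \<open>t\<close> times the
  integral of \<open>sin \<phi> f\<close> over the hemisphere of radius \<open>t\<close>.
\<close>

lemma kirchhoff:
  fixes u :: "real^2 \<Rightarrow> real \<Rightarrow> real"
  assumes u: "wave_solution f u" and t: "t \<ge> 0"
    and f: "\<And>x. (f has_derivative (\<lambda>h. h $ 1 * f1 x + h $ 2 * f2 x)) (at x)"
    and cont: "continuous_on UNIV f1" "continuous_on UNIV f2"
  shows "2 * pi * integral {0..t} (u p) = t * integral {0..pi / 2} (\<lambda>\<phi>. sin \<phi> * circle_integral f p (t * sin \<phi>))"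
proof -
  let ?x = "\<lambda>s z. p + (s * sin (fst z)) *\<^sub>R unit_dir (snd z)"
  define w where "w = (\<lambda>s z. s * (sin (fst z) * f (?x s z)))"
  define w' where "w' = (\<lambda>s z. sin (fst z) * (f (?x s z) + s * (sin (fst z) * (cos (snd z) * f1 (?x s z) + sin (snd z) * f2 (?x s z)))))"
  have cf: "continuous_on UNIV f"
    using f by (auto simp: continuous_on_eq_continuous_at intro: has_derivative_continuous)
  note comp = continuous_on_compose2[OF cf _ subset_UNIV] continuous_on_compose2[OF cont(1) _ subset_UNIV]
    continuous_on_compose2[OF cont(2) _ subset_UNIV]
  have dw: "((\<lambda>s. w s z) has_real_derivative w' s z) (at s within {0..t})" for s z
  proof -
    have "((\<lambda>s. f (?x s z)) has_real_derivative
        (sin (fst z) *\<^sub>R unit_dir (snd z)) $ 1 * f1 (?x s z) + (sin (fst z) *\<^sub>R unit_dir (snd z)) $ 2 * f2 (?x s z)) (at s within {0..t})"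
      by (rule has_derivative_path_DERIV[where T=UNIV and c="\<lambda>s. ?x s z", OF f])
         (auto intro!: derivative_eq_intros simp: has_vector_derivative_def)
    note this[derivative_intros]
    show ?thesis unfolding w_def w'_def
      by (rule derivative_eq_intros refl)+ (simp add: algebra_simps)
  qed
  have cw: "continuous_on A (w s)" for A s
    unfolding w_def by (intro continuous_intros comp)
  have cw': "continuous_on (A \<times> B) (\<lambda>(s, z). w' s z)" for A B
    unfolding w'_def split_beta by (intro continuous_intros comp)
  have dW: "((\<lambda>s. integral hemisphere (w s)) has_real_derivative integral hemisphere (w' s)) (at s within {0..t})" if "s \<in> {0..t}" for s
    unfolding hemisphere_def
    by (rule leibniz_rule_field_derivative[OF dw integrable_continuous[OF cw] cw' that]) auto
  have "((\<lambda>s. 2 * pi * u p s) has_integral (integral hemisphere (w t) - integral hemisphere (w 0))) {0..t}"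
  proof (rule fundamental_theorem_of_calculus_interior[OF t])
    show "continuous_on {0..t} (\<lambda>s. integral hemisphere (w s))"
      by (rule DERIV_continuous_on[OF dW])
    fix s assume s: "s \<in> {0<..<t}"
    have "integral hemisphere (w' s) = 2 * pi * u p s"
      using kirchhoff_derivative_form[OF u _ f, of s p] s by (simp add: w'_def case_prod_unfold Let_def)
    moreover have "at s within {0..t} = at s" using s by (intro at_within_interior) auto
    ultimately show "((\<lambda>s. integral hemisphere (w s)) has_vector_derivative 2 * pi * u p s) (at s)"
      using dW[of s] s by (simp add: has_real_derivative_iff_has_vector_derivative)
  qed
  from integral_unique[OF this]
  have "integral {0..t} (\<lambda>s. 2 * pi * u p s) = integral hemisphere (w t)"
    by (simp add: w_def)
  also have "\<dots> = integral {0..pi / 2} (\<lambda>\<phi>. integral {0..2 * pi} (\<lambda>\<theta>. t * sin \<phi> * f (?x t (\<phi>, \<theta>))))"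
    unfolding hemisphere_def integral_prod_continuous[OF cw] by (simp add: w_def mult.assoc)
  finally show ?thesis
    by (simp add: circle_integral_def mult.assoc)
qed

section \<open>Abel's equation and the mean value theorem of Asgeirsson\<close>

definition wallis_integral :: "nat \<Rightarrow> real" where
  "wallis_integral n = integral {0..pi / 2} (\<lambda>x. sin x ^ n)"

lemma wallis_recursion: "real (n + 2) * wallis_integral (n + 2) = real (n + 1) * wallis_integral n"
proof -
  have "((\<lambda>x. real (n + 1) * sin x ^ n - real (n + 2) * sin x ^ (n + 2)) has_integral
     sin (pi / 2) ^ (n + 1) * cos (pi / 2) - sin 0 ^ (n + 1) * cos 0) {0..pi / 2}"
  proof (rule fundamental_theorem_of_calculus)
    fix x :: real
    have "((\<lambda>x. sin x ^ (n + 1) * cos x) has_real_derivative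
        real (n + 1) * sin x ^ n * (cos x)\<^sup>2 - sin x ^ (n + 2)) (at x within {0..pi / 2})"
      using DERIV_mult[OF DERIV_power_Suc[OF DERIV_sin[of x], of n] DERIV_cos, THEN has_field_derivative_at_within]
      by (simp add: power2_eq_square algebra_simps)
    moreover have "real (n + 1) * sin x ^ n * (cos x)\<^sup>2 - sin x ^ (n + 2)
        = real (n + 1) * sin x ^ n - real (n + 2) * sin x ^ (n + 2)"
    proof -
      have "m * y * C\<^sup>2 - y * S\<^sup>2 = m * y - (m + 1) * (y * S\<^sup>2)" if "S\<^sup>2 + C\<^sup>2 = 1" for m y C S :: real
        using that by algebra
      from this[OF sin_cos_squared_add[of x], of "real (n + 1)" "sin x ^ n"] show ?thesis
        by (simp add: power_add add_ac power2_eq_square mult_ac)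
    qed
    ultimately show "((\<lambda>x. sin x ^ (n + 1) * cos x) has_vector_derivative
        real (n + 1) * sin x ^ n - real (n + 2) * sin x ^ (n + 2)) (at x within {0..pi / 2})"
      by (simp add: has_real_derivative_iff_has_vector_derivative)
  qed simp
  then have "integral {0..pi / 2} (\<lambda>x. real (n + 1) * sin x ^ n - real (n + 2) * sin x ^ (n + 2)) = 0"
    by (simp add: integral_unique)
  moreover have "integral {0..pi / 2} (\<lambda>x. real (n + 1) * sin x ^ n - real (n + 2) * sin x ^ (n + 2))
     = real (n + 1) * wallis_integral n - real (n + 2) * wallis_integral (n + 2)"
    unfolding wallis_integral_def
    by (subst integral_diff) (auto intro!: integrable_continuous_real continuous_intros simp del: of_nat_add)
  ultimately show ?thesis by simp
qed

text \<open>The recursion shows that the product does not depend on \<open>n\<close>.\<close>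

lemma wallis_product: "real (n + 1) * wallis_integral n * wallis_integral (n + 1) = pi / 2"
proof (induction n)
  case 0
  have "(sin has_integral (- cos (pi / 2) - - cos 0)) {0..pi / 2}"
    by (rule fundamental_theorem_of_calculus)
       (auto intro!: derivative_eq_intros simp: has_real_derivative_iff_has_vector_derivative[symmetric])
  then have "integral {0..pi / 2} sin = (1 :: real)" by (simp add: integral_unique)
  then show ?case by (simp add: wallis_integral_def)
next
  case (Suc n)
  have "real (Suc n + 1) * wallis_integral (Suc n) * wallis_integral (Suc n + 1)
      = (real (n + 2) * wallis_integral (n + 2)) * wallis_integral (n + 1)"
    by (simp add: algebra_simps)
  also have "\<dots> = real (n + 1) * wallis_integral n * wallis_integral (n + 1)"
    by (simp only: wallis_recursion)
  also have "\<dots> = pi / 2" by (rule Suc.IH)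
  finally show ?case .
qed

text \<open>
  Two Abel transforms in succession. It is the integral of \<open>k (T x\<^sub>1)\<close> over
  an octant of the unit sphere, with \<open>x\<^sub>1 = sin \<phi> sin \<psi>\<close>.
\<close>

definition abel_mean :: "real \<Rightarrow> (real \<Rightarrow> real) \<Rightarrow> real" where
  "abel_mean T k = integral (cbox (0, 0) (pi / 2, pi / 2)) (\<lambda>z. sin (fst z) * k (T * sin (fst z) * sin (snd z)))"

lemma octant_range:
  assumes "T \<ge> 0" "z \<in> cbox (0, 0) (pi / 2, pi / 2 :: real)"
  shows "T * sin (fst z) * sin (snd z) \<in> {0..T}" "sin (fst z) \<in> {0..1}"
proof -
  have s: "sin (fst z) \<in> {0..1}" "sin (snd z) \<in> {0..1}"
    using assms(2) by (cases z; auto intro!: sin_ge_zero)+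
  then have "T * (sin (fst z) * sin (snd z)) \<le> T * 1"
    using assms(1) by (intro mult_left_mono mult_le_one) auto
  with s assms(1) show "T * sin (fst z) * sin (snd z) \<in> {0..T}" by (auto simp: mult.assoc)
  show "sin (fst z) \<in> {0..1}" using s by simp
qed

lemma continuous_abel_mean:
  assumes "continuous_on {0..T} k" "T \<ge> 0"
  shows "continuous_on (cbox (0, 0) (pi / 2, pi / 2)) (\<lambda>z. sin (fst z) * k (T * sin (fst z) * sin (snd z)))"
  by (intro continuous_intros continuous_on_compose2[OF assms(1)]) (use octant_range[OF assms(2)] in auto)

text \<open>
  By Archimedes, a coordinate is uniformly distributed on the sphere. For powers the identity is
  Wallis' product; it extends to continuous functions by Weierstrass' theorem, as both sides are
  continuous in the uniform norm.
\<close>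

lemma abel_mean_eq:
  assumes k: "continuous_on {0..T} k" and T: "T \<ge> 0"
  shows "T * abel_mean T k = pi / 2 * integral {0..T} k"
proof -
  let ?Q = "cbox (0, 0) (pi / 2, pi / 2) :: (real \<times> real) set"
  have mono: "T * abel_mean T (\<lambda>x. x ^ n) = pi / 2 * integral {0..T} (\<lambda>x. x ^ n)" for n
  proof -
    have c: "continuous_on ?Q (\<lambda>z. sin (fst z) * (T * sin (fst z) * sin (snd z)) ^ n)"
      by (intro continuous_intros)
    have "abel_mean T (\<lambda>x. x ^ n) = integral {0..pi/2} (\<lambda>\<phi>. integral {0..pi/2} (\<lambda>\<psi>. (T ^ n * sin \<phi> ^ (n + 1)) * sin \<psi> ^ n))"
      unfolding abel_mean_def integral_prod_continuous[OF c] by (simp add: power_mult_distrib mult_ac)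
    also have "\<dots> = T ^ n * wallis_integral (n + 1) * wallis_integral n"
    proof -
      have "integral {0..pi/2} (\<lambda>\<psi>. (T ^ n * sin \<phi> ^ (n + 1)) * sin \<psi> ^ n)
          = (T ^ n * wallis_integral n) * sin \<phi> ^ (n + 1)" for \<phi>
        unfolding integral_mult_right wallis_integral_def by (simp add: mult_ac)
      then show ?thesis
        by (simp only: integral_mult_right wallis_integral_def[of "n + 1"] mult_ac)
    qed
    also have "T * \<dots> = T ^ (n + 1) / real (n + 1) * (pi / 2)"
      unfolding wallis_product[of n, symmetric] by (simp add: field_simps)
    finally have "T * abel_mean T (\<lambda>x. x ^ n) = T ^ (n + 1) / real (n + 1) * (pi / 2)" .
    moreover have "((\<lambda>x. x ^ n) has_integral (T ^ (n + 1) / real (n + 1) - 0 ^ (n + 1) / real (n + 1))) {0..T}"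
    proof (rule fundamental_theorem_of_calculus[OF T])
      fix x :: real
      have frac: "(1 + real n) * y / (1 + real n) = y" for y :: real
        by (simp add: add_nonneg_eq_0_iff)
      have "((\<lambda>x. x ^ (n + 1) / real (n + 1)) has_real_derivative x ^ n) (at x within {0..T})"
        using DERIV_cdivide[OF DERIV_power_Suc[OF DERIV_ident[of "at x within {0..T}"], of n], of "real (Suc n)"]
        by (simp add: frac[of "x ^ n", unfolded distrib_right mult_1])
      then show "((\<lambda>x. x ^ (n + 1) / real (n + 1)) has_vector_derivative x ^ n) (at x within {0..T})"
        by (simp add: has_real_derivative_iff_has_vector_derivative)
    qed
    ultimately show ?thesis by (simp add: integral_unique mult_ac)
  qed
  have poly: "T * abel_mean T (\<lambda>x. \<Sum>i\<le>n. a i * x ^ i) = pi / 2 * integral {0..T} (\<lambda>x. \<Sum>i\<le>n. a i * x ^ i)" for a :: "nat \<Rightarrow> real" and n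
  proof -
    have "abel_mean T (\<lambda>x. \<Sum>i\<le>n. a i * x ^ i) = (\<Sum>i\<le>n. a i * abel_mean T (\<lambda>x. x ^ i))"
      unfolding abel_mean_def sum_distrib_left
      by (subst integral_sum) (auto intro!: integrable_continuous continuous_intros simp: mult_ac sum_distrib_left)
    moreover have "integral {0..T} (\<lambda>x. \<Sum>i\<le>n. a i * x ^ i) = (\<Sum>i\<le>n. a i * integral {0..T} (\<lambda>x. x ^ i))"
      by (subst integral_sum) (auto intro!: integrable_continuous_real continuous_intros)
    moreover have "T * (\<Sum>i\<le>n. a i * abel_mean T (\<lambda>x. x ^ i)) = (\<Sum>i\<le>n. a i * (T * abel_mean T (\<lambda>x. x ^ i)))"
      by (simp add: sum_distrib_left mult.left_commute)
    moreover have "\<dots> = pi / 2 * (\<Sum>i\<le>n. a i * integral {0..T} (\<lambda>x. x ^ i))"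
      unfolding mono by (simp add: sum_distrib_left mult_ac)
    ultimately show ?thesis by metis
  qed
  \<comment> \<open>The summand 1 keeps \<open>C\<close> positive when \<open>T = 0\<close>.\<close>
  define C where "C = T * (pi / 2 * (pi / 2)) + pi / 2 * T + 1"
  have C: "C > 0" using T by (simp add: C_def add_nonneg_pos)
  define E where "E = \<bar>T * abel_mean T k - pi / 2 * integral {0..T} k\<bar>"
  have "E \<le> e" if "e > 0" for e
  proof -
    have "e / C > 0" using that C by simp
    then obtain q where q: "real_polynomial_function q" "\<And>x. x \<in> {0..T} \<Longrightarrow> \<bar>k x - q x\<bar> < e / C"
      using Stone_Weierstrass_real_polynomial_function[OF _ k] by auto
    obtain a n where an: "q = (\<lambda>x. \<Sum>i\<le>n. a i * x ^ i)"
      using q(1) by (auto simp: real_polynomial_function_iff_sum)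
    have cq: "continuous_on {0..T} q" unfolding an by (intro continuous_intros)
    have d1: "abel_mean T k - abel_mean T q = abel_mean T (\<lambda>x. k x - q x)"
      using integral_diff[OF integrable_continuous[OF continuous_abel_mean[OF k T]]
          integrable_continuous[OF continuous_abel_mean[OF cq T]]]
      unfolding abel_mean_def by (simp only: right_diff_distrib)
    have b1: "norm (abel_mean T (\<lambda>x. k x - q x)) \<le> e / C * measure lborel ?Q"
      unfolding abel_mean_def
    proof (rule has_integral_bound[OF _ integrable_integral])
      show "(\<lambda>z. sin (fst z) * (k (T * sin (fst z) * sin (snd z)) - q (T * sin (fst z) * sin (snd z)))) integrable_on ?Q"
        by (intro integrable_continuous continuous_abel_mean[of T "\<lambda>x. k x - q x"] continuous_intros k cq T)
      fix z assume z: "z \<in> ?Q"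
      have "norm (sin (fst z) * (k (T * sin (fst z) * sin (snd z)) - q (T * sin (fst z) * sin (snd z)))) \<le> 1 * (e / C)"
        unfolding norm_mult using octant_range[OF T z] q(2)[OF octant_range(1)[OF T z]]
        by (intro mult_mono) auto
      then show "norm (sin (fst z) * (k (T * sin (fst z) * sin (snd z)) - q (T * sin (fst z) * sin (snd z)))) \<le> e / C" by simp
    qed (use \<open>e / C > 0\<close> in auto)
    have d2: "integral {0..T} k - integral {0..T} q = integral {0..T} (\<lambda>x. k x - q x)"
      by (subst integral_diff) (auto intro!: integrable_continuous_real k cq)
    have b2: "norm (integral {0..T} (\<lambda>x. k x - q x)) \<le> e / C * T"
      using integral_bound[of 0 T "\<lambda>x. k x - q x" "e / C"] T q(2) k cq
      by (auto intro!: continuous_intros simp: less_imp_le)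
    have "T * abel_mean T k - pi / 2 * integral {0..T} k
        = T * abel_mean T (\<lambda>x. k x - q x) - pi / 2 * integral {0..T} (\<lambda>x. k x - q x)"
    proof -
      have "T * abel_mean T q = pi / 2 * integral {0..T} q" unfolding an by (rule poly)
      then show ?thesis unfolding d1[symmetric] d2[symmetric] by (simp add: algebra_simps)
    qed
    then have "E \<le> T * \<bar>abel_mean T (\<lambda>x. k x - q x)\<bar> + pi / 2 * \<bar>integral {0..T} (\<lambda>x. k x - q x)\<bar>"
      unfolding E_def using T abs_triangle_ineq4[of "T * abel_mean T (\<lambda>x. k x - q x)"] by (metis abs_mult abs_of_nonneg pi_half_ge_zero)
    also have "\<dots> \<le> T * (e / C * (pi / 2 * (pi / 2))) + pi / 2 * (e / C * T)"
      using b1 b2 T by (intro add_mono mult_left_mono) (auto simp: content_Pair)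
    also have "\<dots> = e / C * (T * (pi / 2 * (pi / 2)) + pi / 2 * T)" by (simp only: distrib_left mult_ac)
    also have "\<dots> = e / C * (C - 1)" by (simp add: C_def)
    also have "\<dots> \<le> e" using C that by (simp add: field_simps)
    finally show ?thesis .
  qed
  then have "E \<le> 0" by (rule field_le_epsilon[of E 0, simplified])
  then show ?thesis by (simp add: E_def)
qed

text \<open>
  Write \<open>A r\<close> for the integral of \<open>u\<close> over the quarter circle. By
  \<open>abel_mean_eq\<close> for \<open>u p\<close>, the function \<open>4 A\<close> satisfies
  the Abel equation that Kirchhoff's formula states for the circle integrals of
  \<open>f\<close>, so the difference \<open>k\<close> has Abel transform zero. By
  \<open>abel_mean_eq\<close> for \<open>s k(s)\<close>, the integral of \<open>s k(s)\<close>
  over \<open>[0, T]\<close> vanishes for all \<open>T > 0\<close>, and hence \<open>k =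
  0\<close>.
\<close>

lemma wave_asgeirsson:
  fixes u :: "real^2 \<Rightarrow> real \<Rightarrow> real"
  assumes u: "wave_solution f u" and r: "r > 0"
    and f: "\<And>x. (f has_derivative (\<lambda>h. h $ 1 * f1 x + h $ 2 * f2 x)) (at x)"
    and cont: "continuous_on UNIV f1" "continuous_on UNIV f2"
  shows "4 * integral {0..pi / 2} (\<lambda>\<psi>. u p (r * sin \<psi>)) = circle_integral f p r"
proof -
  define A where "A = (\<lambda>r. integral {0..pi / 2} (\<lambda>\<psi>. u p (r * sin \<psi>)))"
  define k where "k = (\<lambda>r. 4 * A r - circle_integral f p r)"
  have cf: "continuous_on UNIV f"
    using f by (auto simp: continuous_on_eq_continuous_at intro: has_derivative_continuous)
  have cu: "continuous_on {0..} (u p)"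
  proof -
    have "continuous_on {0..} (\<lambda>t. u (fst (p, t)) (snd (p, t)))"
      by (rule continuous_on_compose2[OF wave_solution_continuous[OF u] continuous_on_Pair[OF continuous_on_const continuous_on_id]]) auto
    then show ?thesis by simp
  qed
  have cA: "continuous_on {0..} A"
    unfolding A_def interval_cbox
    by (rule integral_continuous_on_param)
       (auto intro!: continuous_intros continuous_on_compose2[OF cu] mult_nonneg_nonneg sin_ge_zero simp: split_beta)
  have cc: "continuous_on S (circle_integral f p)" for S
    by (rule continuous_on_subset[OF continuous_circle_integral[OF cf]]) auto
  have ck: "continuous_on {0..} k"
    unfolding k_def by (intro continuous_intros cA cc)
  have sin01: "t * sin \<phi> \<in> {0..}" if "t \<ge> 0" "\<phi> \<in> {0..pi / 2}" for t \<phi>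
    using that by (auto intro!: mult_nonneg_nonneg sin_ge_zero)
  have zero: "integral {0..pi / 2} (\<lambda>\<phi>. sin \<phi> * k (t * sin \<phi>)) = 0" if t: "t > 0" for t
  proof -
    have ct: "continuous_on {0..t} (u p)" by (rule continuous_on_subset[OF cu]) auto
    have "abel_mean t (u p) = integral {0..pi / 2} (\<lambda>\<phi>. sin \<phi> * A (t * sin \<phi>))"
      unfolding abel_mean_def integral_prod_continuous[OF continuous_abel_mean[OF ct less_imp_le[OF t]]]
      by (simp add: A_def)
    then have "t * integral {0..pi / 2} (\<lambda>\<phi>. sin \<phi> * A (t * sin \<phi>)) = pi / 2 * integral {0..t} (u p)"
      using abel_mean_eq[OF ct] t by simp
    moreover have "2 * pi * integral {0..t} (u p) = t * integral {0..pi / 2} (\<lambda>\<phi>. sin \<phi> * circle_integral f p (t * sin \<phi>))"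
      by (rule kirchhoff[OF u _ f cont]) (use t in auto)
    ultimately have "t * (4 * integral {0..pi / 2} (\<lambda>\<phi>. sin \<phi> * A (t * sin \<phi>))) =
        t * integral {0..pi / 2} (\<lambda>\<phi>. sin \<phi> * circle_integral f p (t * sin \<phi>))" by linarith
    then have "4 * integral {0..pi / 2} (\<lambda>\<phi>. sin \<phi> * A (t * sin \<phi>)) =
        integral {0..pi / 2} (\<lambda>\<phi>. sin \<phi> * circle_integral f p (t * sin \<phi>))" using t by simp
    moreover have "integral {0..pi / 2} (\<lambda>\<phi>. 4 * (sin \<phi> * A (t * sin \<phi>)) - sin \<phi> * circle_integral f p (t * sin \<phi>))
        = 4 * integral {0..pi / 2} (\<lambda>\<phi>. sin \<phi> * A (t * sin \<phi>)) -
          integral {0..pi / 2} (\<lambda>\<phi>. sin \<phi> * circle_integral f p (t * sin \<phi>))"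
      unfolding integral_mult_right[symmetric]
      by (rule integral_diff)
         (auto intro!: integrable_continuous_real continuous_intros continuous_on_compose2[OF cA]
            continuous_on_compose2[OF cc[of UNIV]] sin01[unfolded atLeast_iff] less_imp_le[OF t])
    ultimately show ?thesis by (simp add: k_def algebra_simps)
  qed
  have int0: "integral {0..T} (\<lambda>s. s * k s) = 0" if T: "T > 0" for T
  proof -
    have c: "continuous_on {0..T} (\<lambda>s. s * k s)"
      by (intro continuous_intros continuous_on_subset[OF ck]) auto
    have "integral {0..pi / 2} (\<lambda>\<psi>. sin \<phi> * (T * sin \<phi> * sin \<psi> * k (T * sin \<phi> * sin \<psi>))) = 0"
      if \<phi>: "\<phi> \<in> {0..pi / 2}" for \<phi>
    proof -
      have "integral {0..pi / 2} (\<lambda>\<psi>. sin \<phi> * (T * sin \<phi> * sin \<psi> * k (T * sin \<phi> * sin \<psi>)))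
         = (T * (sin \<phi>)\<^sup>2) * integral {0..pi / 2} (\<lambda>\<psi>. sin \<psi> * k ((T * sin \<phi>) * sin \<psi>))"
        unfolding integral_mult_right[symmetric] by (simp add: power2_eq_square mult_ac)
      also have "\<dots> = 0"
      proof (cases "sin \<phi> = 0")
        case False
        then have "T * sin \<phi> > 0" using T \<phi> sin_ge_zero[of \<phi>] by (auto simp: zero_less_mult_iff)
        then show ?thesis using zero by simp
      qed simp
      finally show ?thesis .
    qed
    then have "abel_mean T (\<lambda>s. s * k s) = integral {0..pi / 2} (\<lambda>\<phi>. 0)"
      unfolding abel_mean_def integral_prod_continuous[OF continuous_abel_mean[OF c less_imp_le[OF T]]]
      by (simp only: interval_cbox[symmetric] fst_conv snd_conv) (rule integral_cong, simp)
    then show ?thesis using abel_mean_eq[OF c] T by simp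
  qed
  have "((\<lambda>T. integral {0..T} (\<lambda>s. s * k s)) has_real_derivative r * k r) (at r within {0..r + 1})"
    by (rule integral_has_real_derivative)
       (use r in \<open>auto intro!: continuous_intros continuous_on_subset[OF ck]\<close>)
  then have d: "((\<lambda>T. integral {0..T} (\<lambda>s. s * k s)) has_real_derivative r * k r) (at r)"
    using r at_within_interior[of r "{0..r + 1}"] by auto
  have "((\<lambda>T. 0) has_real_derivative r * k r) (at r)"
    by (rule has_field_derivative_transform_within[OF d r]) (use int0 in \<open>auto simp: dist_real_def\<close>)
  then have "r * k r = 0" using DERIV_const DERIV_unique by blast
  then show ?thesis using r by (simp add: k_def A_def)
qed

section \<open>The Laplacian of the logarithmic potential\<close>

lemma has_laplacian_real2I:
  fixes h :: "real^2 \<Rightarrow> real"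
  assumes r: "r > 0"
    and D: "\<And>y b. y \<in> ball x r \<Longrightarrow> b \<in> Basis \<Longrightarrow> ((\<lambda>s. h (y + s *\<^sub>R b)) has_real_derivative D b y) (at 0)"
    and DD: "\<And>b. b \<in> Basis \<Longrightarrow> ((\<lambda>s. D b (x + s *\<^sub>R b)) has_real_derivative DD b) (at 0)"
    and L: "L = (\<Sum>b\<in>Basis. DD b)"
  shows "has_laplacian h L x"
proof -
  have "\<forall>\<^sub>F s in nhds 0. ((\<lambda>r. h (x + r *\<^sub>R b)) has_real_derivative D b (x + s *\<^sub>R b)) (at s)"
    if b: "b \<in> Basis" for b
  proof -
    have "\<forall>\<^sub>F s in nhds 0. \<bar>s\<bar> < r"
      using r by (auto simp: eventually_nhds_metric dist_real_def)
    then show ?thesis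
    proof eventually_elim
      case (elim s)
      then have "x + s *\<^sub>R b \<in> ball x r" using b by (simp add: dist_norm)
      then have "((\<lambda>t. h (x + s *\<^sub>R b + (t + - s) *\<^sub>R b)) has_real_derivative D b (x + s *\<^sub>R b)) (at s)"
        using DERIV_shift[of "\<lambda>t. h (x + s *\<^sub>R b + t *\<^sub>R b)" _ s "- s"] D[OF _ b, of "x + s *\<^sub>R b"] by simp
      then show ?case by (simp add: algebra_simps)
    qed
  qed
  then show ?thesis
    unfolding has_laplacian_def using DD L
    by (intro exI[of _ "\<lambda>b s. D b (x + s *\<^sub>R b)"] exI[of _ DD]) blast
qed

text \<open>
  The logarithmic potential \<open>\<integral> f(y) ln (R \<bar>y - z\<bar>) dy\<close> in polar
  coordinates about \<open>z\<close>, for densities that vanish at distance more than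
  \<open>P\<close> from \<open>z\<close>. In this form the singularity is absorbed by the
  Jacobian and the variable \<open>z\<close> appears only in the smooth factor, so that
  differentiation under the integral sign is immediate.
\<close>

definition polar_potential :: "real \<Rightarrow> real \<Rightarrow> (real^2 \<Rightarrow> real) \<Rightarrow> real^2 \<Rightarrow> real" where
  "polar_potential R P f z = integral (cbox (0, 0) (P, 2 * pi))
     (\<lambda>w. fst w * ln (R * fst w) * f (z + fst w *\<^sub>R unit_dir (snd w)))"

lemma continuous_log_weight:
  assumes "R \<noteq> 0"
  shows "continuous_on S (\<lambda>x. x * ln (R * x :: real))"
proof -
  have "continuous_on S (\<lambda>x. R * x * ln (R * x) / R)"
    by (rule continuous_on_divide[OF continuous_on_mult_ln]) (use assms in \<open>auto intro!: continuous_intros\<close>)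
  then show ?thesis using assms by simp
qed

lemma polar_potential_directional_derivative:
  assumes R: "R \<noteq> 0" 
    and f: "\<And>x. (f has_derivative (\<lambda>h. h $ 1 * f1 x + h $ 2 * f2 x)) (at x)"
    and cont: "continuous_on UNIV f1" "continuous_on UNIV f2"
  shows "((\<lambda>s. polar_potential R P f (z + s *\<^sub>R b)) has_real_derivative
     polar_potential R P (\<lambda>x. b $ 1 * f1 x + b $ 2 * f2 x) z) (at 0)"
proof -
  let ?B = "cbox (0, 0) (P, 2 * pi) :: (real \<times> real) set"
  let ?d = "\<lambda>x. b $ 1 * f1 x + b $ 2 * f2 x"
  have cf: "continuous_on UNIV f"
    using f by (auto simp: continuous_on_eq_continuous_at intro: has_derivative_continuous)
  have cd: "continuous_on UNIV ?d" by (intro continuous_intros cont)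
  have "((\<lambda>s. integral ?B (\<lambda>w. fst w * ln (R * fst w) * f (z + s *\<^sub>R b + fst w *\<^sub>R unit_dir (snd w)))) has_real_derivative
     integral ?B (\<lambda>w. fst w * ln (R * fst w) * ?d (z + 0 *\<^sub>R b + fst w *\<^sub>R unit_dir (snd w)))) (at 0 within UNIV)"
  proof (rule leibniz_rule_field_derivative)
    fix s w
    have "((\<lambda>s. f (z + s *\<^sub>R b + fst w *\<^sub>R unit_dir (snd w))) has_real_derivative
        ?d (z + s *\<^sub>R b + fst w *\<^sub>R unit_dir (snd w))) (at s within UNIV)"
      by (rule has_derivative_path_DERIV[where T=UNIV and c="\<lambda>s. z + s *\<^sub>R b + fst w *\<^sub>R unit_dir (snd w)", OF f])
         (auto intro!: derivative_eq_intros simp: has_vector_derivative_def)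
    then show "((\<lambda>s. fst w * ln (R * fst w) * f (z + s *\<^sub>R b + fst w *\<^sub>R unit_dir (snd w))) has_real_derivative
      fst w * ln (R * fst w) * ?d (z + s *\<^sub>R b + fst w *\<^sub>R unit_dir (snd w))) (at s within UNIV)"
      by (rule DERIV_cmult)
  next
    fix s
    show "(\<lambda>w. fst w * ln (R * fst w) * f (z + s *\<^sub>R b + fst w *\<^sub>R unit_dir (snd w))) integrable_on ?B"
      by (intro integrable_continuous continuous_intros continuous_on_compose2[OF continuous_log_weight[OF R, of UNIV]]
           continuous_on_compose2[OF cf]) auto
  next
    show "continuous_on (UNIV \<times> ?B) (\<lambda>(s, w). fst w * ln (R * fst w) * ?d (z + s *\<^sub>R b + fst w *\<^sub>R unit_dir (snd w)))"
      unfolding split_beta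
      by (intro continuous_intros continuous_on_compose2[OF continuous_log_weight[OF R, of UNIV]]
           continuous_on_compose2[OF cont(1)] continuous_on_compose2[OF cont(2)]) auto
  qed auto
  then show ?thesis by (simp add: polar_potential_def)
qed

text \<open>
  In polar coordinates the integral over the angle of \<open>\<rho> \<Delta>f\<close> equals
  that of \<open>\<rho> radial2 + radial\<close>, and \<open>ln (R \<rho>) (\<rho> radial2 +
  radial)\<close> is the derivative with respect to \<open>\<rho>\<close> of \<open>\<rho> ln (R
  \<rho>) radial - f\<close>. At \<open>\<rho> = P\<close> that function vanishes, and at
  \<open>\<rho> = 0\<close> only \<open>- f z\<close> is left.
\<close>

lemma polar_potential_laplacian:
  assumes R: "R > 0" and P: "P > 0"
    and f: "\<And>x. (f has_derivative (\<lambda>h. h $ 1 * f1 x + h $ 2 * f2 x)) (at x)"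
    and g: "plane_gradient f1 f2 f11 f12 f21 f22"
    and far: "\<And>\<theta>. f (z + P *\<^sub>R unit_dir \<theta>) = 0"
      "\<And>\<theta>. f1 (z + P *\<^sub>R unit_dir \<theta>) = 0" "\<And>\<theta>. f2 (z + P *\<^sub>R unit_dir \<theta>) = 0"
  shows "has_laplacian (polar_potential R P f) (2 * pi * f z) z"
proof -
  interpret plane_gradient f1 f2 f11 f12 f21 f22 by (rule g)
  have R0: "R \<noteq> 0" using R by simp
  have cf: "continuous_on UNIV f"
    using f by (auto simp: continuous_on_eq_continuous_at intro: has_derivative_continuous)
  define lap where "lap = (\<lambda>x. f11 x + f22 x)"
  have clap: "continuous_on UNIV lap" unfolding lap_def by (intro continuous_intros)
  have clw: "continuous_on (cbox (0, 0) (P, 2 * pi)) (\<lambda>w. fst w * ln (R * fst w) * h (z + fst w *\<^sub>R unit_dir (snd w)))"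
    if "continuous_on UNIV h" for h
    by (intro continuous_intros continuous_on_compose2[OF continuous_log_weight[OF R0, of UNIV]]
           continuous_on_compose2[OF that]) auto
  \<comment> \<open>The antiderivative in the radius of the angular integral of the Laplacian, weighted by \<open>r ln (R r)\<close>.\<close>
  define G where "G = (\<lambda>r. integral {0..2 * pi} (\<lambda>\<theta>. r * ln (R * r) * radial \<theta> (z + r *\<^sub>R unit_dir \<theta>) - f (z + r *\<^sub>R unit_dir \<theta>)))"
  have cG: "continuous_on {0..P} G"
    unfolding G_def interval_cbox
    by (rule integral_continuous_on_param)
       (auto simp: split_beta intro!: continuous_intros continuous_on_compose2[OF continuous_log_weight[OF R0, of UNIV]]
           continuous_on_compose2[OF cf])
  have dG: "(G has_real_derivative integral {0..2 * pi} (\<lambda>\<theta>. r * ln (R * r) * lap (z + r *\<^sub>R unit_dir \<theta>))) (at r)"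
    if r: "r > 0" for r
  proof -
    have "(G has_real_derivative integral (cbox 0 (2 * pi)) (\<lambda>\<theta>. ln (R * r) * (r * radial2 \<theta> (z + r *\<^sub>R unit_dir \<theta>) + radial \<theta> (z + r *\<^sub>R unit_dir \<theta>)))) (at r within {0<..})"
      unfolding G_def interval_cbox
    proof (rule leibniz_rule_field_derivative)
      fix s \<theta> :: real assume s: "s \<in> {0<..}"
      have 1: "((\<lambda>s. f (z + s *\<^sub>R unit_dir \<theta>)) has_real_derivative radial \<theta> (z + s *\<^sub>R unit_dir \<theta>)) (at s within {0<..})"
      proof -
        have "((\<lambda>s. z + s *\<^sub>R unit_dir \<theta>) has_vector_derivative unit_dir \<theta>) (at s within {0<..})"
          by (auto intro!: derivative_eq_intros simp: has_vector_derivative_def)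
        from has_derivative_path_DERIV[OF f this] show ?thesis by (simp add: radial_def)
      qed
      have 2: "((\<lambda>s. radial \<theta> (z + s *\<^sub>R unit_dir \<theta>)) has_real_derivative radial2 \<theta> (z + s *\<^sub>R unit_dir \<theta>)) (at s within {0<..})"
        using DERIV_radial[OF DERIV_ident, of \<theta> z s "{0<..}"] by simp
      have 3: "((\<lambda>s. s * ln (R * s)) has_real_derivative ln (R * s) + 1) (at s within {0<..})"
        using s R by (auto intro!: derivative_eq_intros)
      show "((\<lambda>s. s * ln (R * s) * radial \<theta> (z + s *\<^sub>R unit_dir \<theta>) - f (z + s *\<^sub>R unit_dir \<theta>)) has_real_derivative
         ln (R * s) * (s * radial2 \<theta> (z + s *\<^sub>R unit_dir \<theta>) + radial \<theta> (z + s *\<^sub>R unit_dir \<theta>))) (at s within {0<..})"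
        using DERIV_diff[OF DERIV_mult[OF 3 2] 1] by (simp add: algebra_simps)
    next
      fix s :: real
      show "(\<lambda>\<theta>. s * ln (R * s) * radial \<theta> (z + s *\<^sub>R unit_dir \<theta>) - f (z + s *\<^sub>R unit_dir \<theta>)) integrable_on cbox 0 (2 * pi)"
        by (intro integrable_continuous continuous_intros continuous_on_compose2[OF cf]) auto
    next
      show "continuous_on ({0<..} \<times> cbox 0 (2 * pi)) (\<lambda>(s, \<theta>). ln (R * s) * (s * radial2 \<theta> (z + s *\<^sub>R unit_dir \<theta>) + radial \<theta> (z + s *\<^sub>R unit_dir \<theta>)))"
        unfolding split_beta using R by (intro continuous_intros) auto
    qed (use r in auto)
    moreover have "at r within {0<..} = at r" using r by (intro at_within_open) auto
    moreover have "integral (cbox 0 (2 * pi)) (\<lambda>\<theta>. ln (R * r) * (r * radial2 \<theta> (z + r *\<^sub>R unit_dir \<theta>) + radial \<theta> (z + r *\<^sub>R unit_dir \<theta>)))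
        = integral {0..2 * pi} (\<lambda>\<theta>. r * ln (R * r) * lap (z + r *\<^sub>R unit_dir \<theta>))"
    proof -
      have "((\<lambda>\<theta>. r * ln (R * r) * lap (z + r *\<^sub>R unit_dir \<theta>)) has_integral
          integral {0..2 * pi} (\<lambda>\<theta>. r * ln (R * r) * lap (z + r *\<^sub>R unit_dir \<theta>))) {0..2 * pi}"
        by (intro integrable_integral integrable_continuous_real continuous_intros continuous_on_compose2[OF clap]) auto
      from has_integral_diff[OF this has_integral_mult_right[OF integral_tangential2[of r z], of "ln (R * r)"]]
      have "((\<lambda>\<theta>. r * ln (R * r) * lap (z + r *\<^sub>R unit_dir \<theta>) - ln (R * r) *
           (r * tangential2 \<theta> (z + r *\<^sub>R unit_dir \<theta>) - radial \<theta> (z + r *\<^sub>R unit_dir \<theta>))) has_integral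
          integral {0..2 * pi} (\<lambda>\<theta>. r * ln (R * r) * lap (z + r *\<^sub>R unit_dir \<theta>))) {0..2 * pi}" by simp
      moreover have "r * ln (R * r) * lap x - ln (R * r) * (r * tangential2 \<theta> x - radial \<theta> x)
          = ln (R * r) * (r * radial2 \<theta> x + radial \<theta> x)" for x \<theta>
        unfolding lap_def radial2_add_tangential2[of \<theta> x, symmetric] by (simp add: algebra_simps)
      ultimately have "((\<lambda>\<theta>. ln (R * r) * (r * radial2 \<theta> (z + r *\<^sub>R unit_dir \<theta>) + radial \<theta> (z + r *\<^sub>R unit_dir \<theta>))) has_integral
          integral {0..2 * pi} (\<lambda>\<theta>. r * ln (R * r) * lap (z + r *\<^sub>R unit_dir \<theta>))) {0..2 * pi}"
        by (simp only:)
      then show ?thesis unfolding interval_cbox by (rule integral_unique)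
    qed
    ultimately show ?thesis by (simp only:)
  qed
  have "polar_potential R P lap z = integral {0..P} (\<lambda>r. integral {0..2 * pi} (\<lambda>\<theta>. r * ln (R * r) * lap (z + r *\<^sub>R unit_dir \<theta>)))"
    unfolding polar_potential_def integral_prod_continuous[OF clw[OF clap]] by simp
  also have "\<dots> = G P - G 0"
    by (intro integral_unique fundamental_theorem_of_calculus_interior cG)
       (use P dG in \<open>auto simp: has_real_derivative_iff_has_vector_derivative[symmetric]\<close>)
  also have "\<dots> = 2 * pi * f z" by (simp add: G_def far radial_def)
  finally have lap_eq: "polar_potential R P lap z = 2 * pi * f z" .
  let ?D = "\<lambda>(b :: real^2) x. b $ 1 * f1 x + b $ 2 * f2 x"
  let ?D1 = "\<lambda>(b :: real^2) x. b $ 1 * f11 x + b $ 2 * f21 x" and ?D2 = "\<lambda>(b :: real^2) x. b $ 1 * f12 x + b $ 2 * f22 x"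
  show ?thesis
  proof (rule has_laplacian_real2I[OF zero_less_one])
    show "((\<lambda>s. polar_potential R P f (y + s *\<^sub>R b)) has_real_derivative polar_potential R P (?D b) y) (at 0)" for y b
      by (rule polar_potential_directional_derivative[OF R0 f cont1 cont2])
    show "((\<lambda>s. polar_potential R P (?D b) (z + s *\<^sub>R b)) has_real_derivative
       polar_potential R P (\<lambda>x. b $ 1 * ?D1 b x + b $ 2 * ?D2 b x) z) (at 0)" for b
    proof (rule polar_potential_directional_derivative[OF R0])
      show "(?D b has_derivative (\<lambda>h. h $ 1 * ?D1 b x + h $ 2 * ?D2 b x)) (at x)" for x
        using has_derivative_add[OF has_derivative_mult_right[OF deriv1[of x], of "b $ 1"] has_derivative_mult_right[OF deriv2[of x], of "b $ 2"]]
        by (simp add: algebra_simps)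
    qed (intro continuous_intros)+
    show "2 * pi * f z = (\<Sum>b\<in>Basis. polar_potential R P (\<lambda>x. b $ 1 * ?D1 b x + b $ 2 * ?D2 b x) z)"
    proof -
      have "polar_potential R P f11 z + polar_potential R P f22 z = polar_potential R P lap z"
        unfolding polar_potential_def lap_def distrib_left
        by (rule integral_add[symmetric]) (intro integrable_continuous clw cont11 cont22)+
      then show ?thesis by (simp add: Basis_real2 vec2_basis_neq lap_eq)
    qed
  qed
qed

section \<open>The inversion kernel\<close>

definition inversion_kernel :: "real \<Rightarrow> real \<Rightarrow> real \<Rightarrow> real" where
  "inversion_kernel R t r = sqrt (4 * R\<^sup>2 - t\<^sup>2) * (- 2 + ln \<bar>4 * R\<^sup>2 - r\<^sup>2\<bar>) + Gamma_kernel R t r"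

lemma borel_measurable_inversion_kernel [measurable]:
  assumes [measurable]: "f \<in> borel_measurable M" "g \<in> borel_measurable M"
  shows "(\<lambda>x. inversion_kernel R (f x) (g x)) \<in> borel_measurable M"
  unfolding inversion_kernel_def Gamma_kernel_def by measurable

text \<open>
  The definition of \<open>Gamma_kernel\<close> at \<open>t = r\<close> gives 0, which is the
  value that this identity requires there.
\<close>

lemma inversion_kernel_has_integral:
  assumes t: "0 \<le> t" "t \<le> 2 * R" and r: "0 \<le> r" "r < 2 * R"
  shows "((\<lambda>v. ln (v\<^sup>2 + t\<^sup>2 - r\<^sup>2)) has_integral inversion_kernel R t r) {0..sqrt (4 * R\<^sup>2 - t\<^sup>2)}"
proof -
  define A where "A = sqrt (4 * R\<^sup>2 - t\<^sup>2)"
  have "t\<^sup>2 \<le> (2 * R)\<^sup>2" "r\<^sup>2 < (2 * R)\<^sup>2"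
    using power_mono[OF t(2,1), of 2] power_strict_mono[OF r(2,1), of 2] by simp_all
  then have sq: "t\<^sup>2 \<le> 4 * R\<^sup>2" "r\<^sup>2 < 4 * R\<^sup>2" by (simp_all add: power_mult_distrib)
  have A2: "A\<^sup>2 = 4 * R\<^sup>2 - t\<^sup>2" and A0: "A \<ge> 0" using sq by (simp_all add: A_def)
  show ?thesis
  proof (cases "r < t")
    case True
    define c where "c = sqrt (t\<^sup>2 - r\<^sup>2)"
    have "r\<^sup>2 < t\<^sup>2" using True r by (intro power_strict_mono) auto
    then have c: "c > 0" "c\<^sup>2 = t\<^sup>2 - r\<^sup>2" by (simp_all add: c_def)
    have s: "A\<^sup>2 + c\<^sup>2 = 4 * R\<^sup>2 - r\<^sup>2" by (simp add: A2 c(2))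
    have g: "Gamma_kernel R t r = 2 * c * arctan (A / c)"
      using True by (simp add: Gamma_kernel_def A_def c_def real_sqrt_divide)
    have e: "A * ln (A\<^sup>2 + c\<^sup>2) - 2 * A + 2 * c * arctan (A / c) = inversion_kernel R t r"
      unfolding inversion_kernel_def g s ln_abs A_def[symmetric] by (simp add: algebra_simps)
    show ?thesis unfolding A_def[symmetric]
      by (rule has_integral_eq[OF _ has_integral_ln_square_add[OF c(1) A0, unfolded e]]) (simp add: c(2) algebra_simps)
  next
    case False
    define b where "b = sqrt (r\<^sup>2 - t\<^sup>2)"
    have "t\<^sup>2 \<le> r\<^sup>2" using False t by (intro power_mono) auto
    then have b: "b \<ge> 0" "b\<^sup>2 = r\<^sup>2 - t\<^sup>2" by (simp_all add: b_def)
    have "b\<^sup>2 < A\<^sup>2" unfolding b A2 using sq by simp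
    then have bA: "b < A" using A0 by (rule power2_less_imp_less)
    have s: "A\<^sup>2 - b\<^sup>2 = 4 * R\<^sup>2 - r\<^sup>2" by (simp add: A2 b(2))
    have g: "Gamma_kernel R t r = b * ln ((A + b) / (A - b))"
      using False by (cases "t = r") (simp_all add: Gamma_kernel_def A_def b_def)
    have e: "A * ln (A\<^sup>2 - b\<^sup>2) - 2 * A + b * ln ((A + b) / (A - b)) = inversion_kernel R t r"
      unfolding inversion_kernel_def g s ln_abs A_def[symmetric] by (simp add: algebra_simps)
    show ?thesis unfolding A_def[symmetric]
      by (rule has_integral_eq[OF _ has_integral_ln_square_diff[OF b(1) bA, unfolded e]]) (simp add: b(2) algebra_simps)
  qed
qed

text \<open>
  As for \<open>abs_integrable_ln_diff\<close>: a logarithm is unbounded only from below.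
\<close>

lemma absolutely_integrable_ln:
  fixes q :: "real \<Rightarrow> real"
  assumes "(\<lambda>x. ln (q x)) integrable_on {a..b}" "continuous_on {a..b} q"
  shows "(\<lambda>x. ln (q x)) absolutely_integrable_on {a..b}"
proof (rule absolutely_integrable_absolutely_integrable_ubound[OF assms(1)])
  show "(\<lambda>x. \<bar>q x\<bar>) absolutely_integrable_on {a..b}"
    by (intro absolutely_integrable_continuous_real continuous_intros assms(2))
qed (rule ln_le_abs)

lemma absolutely_integrable_log_weight:
  fixes M P r :: real
  assumes "M \<ge> 0"
  shows "(\<lambda>\<rho>. \<rho> * (M * \<bar>ln (\<rho>\<^sup>2 - r\<^sup>2)\<bar>)) absolutely_integrable_on {0..P}"
proof (rule measurable_bounded_by_integrable_imp_absolutely_integrable)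
  show "(\<lambda>\<rho>. \<rho> * (M * \<bar>ln (\<rho>\<^sup>2 - r\<^sup>2)\<bar>)) \<in> borel_measurable (lebesgue_on {0..P})"
    by (intro measurable_restrict_space1 measurable_completion) measurable
  have "(\<lambda>\<rho>. \<bar>ln (\<rho> - a)\<bar>) integrable_on {0..P}" for a
    using absolutely_integrable_abs[OF abs_integrable_ln_diff[where a=a and c=0 and d=P]]
    by (intro set_lebesgue_integral_eq_integral(1)) simp
  then show "(\<lambda>\<rho>. (P * M) * (\<bar>ln (\<rho> - - r)\<bar> + \<bar>ln (\<rho> - r)\<bar>)) integrable_on {0..P}"
    by (intro integrable_on_mult_right integrable_add)
  show "{0..P} \<in> sets lebesgue" by simp
  fix \<rho> assume \<rho>: "\<rho> \<in> {0..P}"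
  have f: "\<rho>\<^sup>2 - r\<^sup>2 = (\<rho> - - r) * (\<rho> - r)" by (simp add: power2_eq_square algebra_simps)
  have "\<bar>ln (\<rho>\<^sup>2 - r\<^sup>2)\<bar> \<le> \<bar>ln (\<rho> - - r)\<bar> + \<bar>ln (\<rho> - r)\<bar>"
    unfolding f ln_mult by auto
  then have "(\<rho> * M) * \<bar>ln (\<rho>\<^sup>2 - r\<^sup>2)\<bar> \<le> (P * M) * (\<bar>ln (\<rho> - - r)\<bar> + \<bar>ln (\<rho> - r)\<bar>)"
    using \<rho> assms by (intro mult_mono mult_right_mono) auto
  then show "norm (\<rho> * (M * \<bar>ln (\<rho>\<^sup>2 - r\<^sup>2)\<bar>)) \<le> (P * M) * (\<bar>ln (\<rho> - - r)\<bar> + \<bar>ln (\<rho> - r)\<bar>)"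
    using \<rho> assms by (simp add: abs_mult mult_ac)
qed

lemma lborel_translate:
  fixes g :: "'a::euclidean_space \<Rightarrow> real"
  assumes [measurable]: "g \<in> borel_measurable borel"
  shows "integrable lborel (\<lambda>y. g (p + y)) \<longleftrightarrow> integrable lborel g"
    and "(\<integral>y. g (p + y) \<partial>lborel) = (\<integral>y. g y \<partial>lborel)"
proof -
  have m: "(+) p \<in> measurable lborel borel" by simp
  show "integrable lborel (\<lambda>y. g (p + y)) \<longleftrightarrow> integrable lborel g"
    using integrable_distr_eq[OF m assms] by (simp add: lborel_distr_plus)
  show "(\<integral>y. g (p + y) \<partial>lborel) = (\<integral>y. g y \<partial>lborel)"
    using integral_distr[OF m assms] by (simp add: lborel_distr_plus)
qed

lemma quadrant_angle:
  assumes "\<theta> \<in> {0<..<2 * pi}"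
  shows "cos \<theta> > 0 \<and> sin \<theta> > 0 \<longleftrightarrow> \<theta> \<in> {0<..<pi / 2}"
proof
  assume cs: "cos \<theta> > 0 \<and> sin \<theta> > 0"
  have "\<not> \<theta> > pi" using sin_lt_zero[of \<theta>] assms cs by auto
  moreover have "\<not> (\<theta> \<ge> pi / 2 \<and> \<theta> \<le> pi)"
    using cos_monotone_0_pi_le[of "pi / 2" \<theta>] cs by auto
  ultimately show "\<theta> \<in> {0<..<pi / 2}" using assms by auto
qed (auto intro!: cos_gt_zero sin_gt_zero)

lemma circle_integral_lborel:
  assumes "continuous_on UNIV f"
  shows "(\<integral>\<theta>. indicator {0<..<2 * pi} \<theta> * f (p + r *\<^sub>R unit_dir \<theta>) \<partial>lborel) = circle_integral f p r"
proof -
  have c: "continuous_on UNIV (\<lambda>\<theta>. f (p + r *\<^sub>R unit_dir \<theta>))"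
    by (intro continuous_intros continuous_on_compose2[OF assms]) auto
  show ?thesis unfolding circle_integral_def
    by (rule lborel_integral_between(2))
       (auto intro: absolutely_integrable_continuous_real continuous_on_subset[OF c] borel_measurable_continuous_onI[OF c])
qed

text \<open>
  Both integrals run over radii up to \<open>2R\<close> with the same radial factor \<open>ln
  \<bar>\<rho>\<^sup>2 - r\<^sup>2\<bar>\<close>: one over a quarter disc in the \<open>(v,
  t)\<close> plane, the other over the disc about \<open>p\<close>, which contains the support
  of \<open>f\<close>. In polar coordinates they differ only by the angular integrals, which
  \<open>wave_asgeirsson\<close> compares.
\<close>

lemma inversion_kernel_integral_eq_plane_integral:
  fixes u :: "real^2 \<Rightarrow> real \<Rightarrow> real"
  assumes R: "R > 0" and u: "wave_solution f u"
    and f: "\<And>x. (f has_derivative (\<lambda>h. h $ 1 * f1 x + h $ 2 * f2 x)) (at x)"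
    and cont: "continuous_on UNIV f1" "continuous_on UNIV f2"
    and supp: "\<And>y. norm y > R \<Longrightarrow> f y = 0"
    and p: "norm p = R" and r: "0 \<le> r" "r < 2 * R"
  shows "set_integrable lborel {0..2 * R} (\<lambda>t. u p t * inversion_kernel R t r)" (is ?I)
    and "integrable lborel (\<lambda>y. f y * ln ((norm (y - p))\<^sup>2 - r\<^sup>2))" (is ?J)
    and "(LINT t:{0..2 * R}|lborel. u p t * inversion_kernel R t r) = 1 / 4 * (\<integral>y. f y * ln ((norm (y - p))\<^sup>2 - r\<^sup>2) \<partial>lborel)" (is ?K)
proof -
  have cf: "continuous_on UNIV f"
    using f by (auto simp: continuous_on_eq_continuous_at intro: has_derivative_continuous)
  have cu: "continuous_on {0..} (u p)"
  proof -
    have "continuous_on {0..} (\<lambda>t. u (fst (p, t)) (snd (p, t)))"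
      by (rule continuous_on_compose2[OF wave_solution_continuous[OF u] continuous_on_Pair[OF continuous_on_const continuous_on_id]]) auto
    then show ?thesis by simp
  qed
  \<comment> \<open>\<open>u\<close> is continuous only for \<open>t \<ge> 0\<close>; truncation makes the integrand measurable on the whole line.\<close>
  define U where "U t = u p (max 0 t)" for t
  have cU: "continuous_on UNIV U"
    unfolding U_def by (intro continuous_on_compose2[OF cu] continuous_intros) auto
  have mU [measurable]: "U \<in> borel_measurable borel" by (rule borel_measurable_continuous_onI[OF cU])
  have mf [measurable]: "f \<in> borel_measurable borel" by (rule borel_measurable_continuous_onI[OF cf])
  have mnth: "(\<lambda>y::real^2. y $ i) \<in> borel_measurable borel" for i
    by (intro borel_measurable_continuous_onI continuous_intros)
  have "bounded (U ` {0..2 * R})" "bounded (f ` cball 0 R)"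
    by (intro compact_imp_bounded compact_continuous_image continuous_on_subset[OF cU] continuous_on_subset[OF cf]; simp)+
  then obtain MU Mf where "\<forall>y\<in>U ` {0..2 * R}. norm y \<le> MU" "\<forall>y\<in>f ` cball 0 R. norm y \<le> Mf"
    unfolding bounded_iff by blast
  then have MU: "\<And>t. t \<in> {0..2 * R} \<Longrightarrow> \<bar>U t\<bar> \<le> MU" and Mf: "\<And>y. y \<in> cball 0 R \<Longrightarrow> \<bar>f y\<bar> \<le> Mf"
    by auto
  have MU0: "MU \<ge> 0" using MU[of 0] R by auto
  have Mf0: "Mf \<ge> 0" using Mf[of 0] R by auto
  have fb: "\<bar>f y\<bar> \<le> Mf" for y
    using Mf[of y] supp[of y] Mf0 by (cases "norm y \<le> R") auto

  define h1 where "h1 = (\<lambda>y. f (p + y) * ln ((norm y)\<^sup>2 - r\<^sup>2))"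
  have mh1: "h1 \<in> borel_measurable borel" unfolding h1_def by measurable
  have 1: "integrable lborel h1"
    "(\<integral>y. h1 y \<partial>lborel) = (\<integral>\<rho>. indicator {0<..2 * R} \<rho> * (\<rho> * (\<integral>\<theta>. indicator {0<..<2 * pi} \<theta> * h1 (\<rho> *\<^sub>R unit_dir \<theta>) \<partial>lborel)) \<partial>lborel)"
  proof (atomize (full), intro conjI polar_integral[where G="\<lambda>\<rho>. Mf * \<bar>ln (\<rho>\<^sup>2 - r\<^sup>2)\<bar>"] mh1 absolutely_integrable_log_weight Mf0)
    show "\<bar>h1 y\<bar> \<le> Mf * \<bar>ln ((norm y)\<^sup>2 - r\<^sup>2)\<bar>" for y
      unfolding h1_def abs_mult by (intro mult_right_mono fb) auto
    then show "\<bar>h1 y\<bar> \<le> Mf * \<bar>ln ((norm y)\<^sup>2 - r\<^sup>2)\<bar>" for y .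
    show "h1 y = 0" if "norm y > 2 * R" for y
      using supp[of "p + y"] norm_triangle_ineq2[of y "- p"] that p by (auto simp: h1_def add.commute)
    then show "h1 y = 0" if "norm y > 2 * R" for y using that .
  qed measurable

  define Q where "Q = {y :: real^2. 0 < y $ 1} \<inter> {y. 0 < y $ 2} \<inter> cball 0 (2 * R)"
  define h2 where "h2 = (\<lambda>y. indicator Q y * (U (y $ 2) * ln ((norm y)\<^sup>2 - r\<^sup>2)))"
  have "open {y :: real^2. 0 < y $ i}" for i by (intro open_Collect_less continuous_intros)
  then have mQ: "Q \<in> sets borel" unfolding Q_def by (intro sets.Int) auto
  have mh2: "h2 \<in> borel_measurable borel"
    unfolding h2_def by (intro borel_measurable_times borel_measurable_indicator mQ measurable_compose[OF mnth mU]) measurable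
  have 2: "integrable lborel h2"
    "(\<integral>y. h2 y \<partial>lborel) = (\<integral>\<rho>. indicator {0<..2 * R} \<rho> * (\<rho> * (\<integral>\<theta>. indicator {0<..<2 * pi} \<theta> * h2 (\<rho> *\<^sub>R unit_dir \<theta>) \<partial>lborel)) \<partial>lborel)"
  proof (atomize (full), intro conjI polar_integral[where G="\<lambda>\<rho>. MU * \<bar>ln (\<rho>\<^sup>2 - r\<^sup>2)\<bar>"] mh2 absolutely_integrable_log_weight MU0)
    show b: "\<bar>h2 y\<bar> \<le> MU * \<bar>ln ((norm y)\<^sup>2 - r\<^sup>2)\<bar>" for y
    proof (cases "y \<in> Q")
      case True
      have "\<bar>y $ 2\<bar> \<le> norm y" by (rule component_le_norm_cart)
      then have "\<bar>U (y $ 2)\<bar> \<le> MU" using True by (intro MU) (auto simp: Q_def)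
      then show ?thesis using True by (simp add: h2_def abs_mult mult_right_mono)
    qed (simp add: h2_def MU0)
    then show "\<bar>h2 y\<bar> \<le> MU * \<bar>ln ((norm y)\<^sup>2 - r\<^sup>2)\<bar>" for y .
    show "h2 y = 0" if "norm y > 2 * R" for y using that by (simp add: h2_def Q_def)
    then show "h2 y = 0" if "norm y > 2 * R" for y using that .
  qed measurable

  have "(\<integral>\<theta>. indicator {0<..<2 * pi} \<theta> * h1 (\<rho> *\<^sub>R unit_dir \<theta>) \<partial>lborel) =
      4 * (\<integral>\<theta>. indicator {0<..<2 * pi} \<theta> * h2 (\<rho> *\<^sub>R unit_dir \<theta>) \<partial>lborel)"
    if \<rho>: "\<rho> \<in> {0<..2 * R}" for \<rho>
  proof -
    have "(\<integral>\<theta>. indicator {0<..<2 * pi} \<theta> * h1 (\<rho> *\<^sub>R unit_dir \<theta>) \<partial>lborel) =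
        (\<integral>\<theta>. (indicator {0<..<2 * pi} \<theta> * f (p + \<rho> *\<^sub>R unit_dir \<theta>)) * ln (\<rho>\<^sup>2 - r\<^sup>2) \<partial>lborel)"
      by (simp add: h1_def mult.assoc)
    also have "\<dots> = circle_integral f p \<rho> * ln (\<rho>\<^sup>2 - r\<^sup>2)"
      by (simp add: circle_integral_lborel[OF cf] integral_mult_left_zero)
    also have "\<dots> = 4 * (integral {0..pi / 2} (\<lambda>\<theta>. u p (\<rho> * sin \<theta>)) * ln (\<rho>\<^sup>2 - r\<^sup>2))"
      using wave_asgeirsson[OF u _ f cont, of \<rho> p] \<rho> by simp
    also have "integral {0..pi / 2} (\<lambda>\<theta>. u p (\<rho> * sin \<theta>)) = integral {0..pi / 2} (\<lambda>\<theta>. U (\<rho> * sin \<theta>))"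
    proof (rule Henstock_Kurzweil_Integration.integral_cong)
      fix \<theta> assume "\<theta> \<in> {0..pi / 2}"
      then have "\<rho> * sin \<theta> \<ge> 0" using \<rho> by (auto intro!: mult_nonneg_nonneg sin_ge_zero)
      then show "u p (\<rho> * sin \<theta>) = U (\<rho> * sin \<theta>)" by (simp add: U_def)
    qed
    also have "\<dots> = (\<integral>\<theta>. indicator {0<..<pi / 2} \<theta> * U (\<rho> * sin \<theta>) \<partial>lborel)"
    proof -
      have c: "continuous_on UNIV (\<lambda>\<theta>. U (\<rho> * sin \<theta>))"
        by (intro continuous_intros continuous_on_compose2[OF cU]) auto
      show ?thesis
        by (rule lborel_integral_between(2)[symmetric])
           (auto intro: absolutely_integrable_continuous_real continuous_on_subset[OF c] borel_measurable_continuous_onI[OF c])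
    qed
    also have "\<dots> * ln (\<rho>\<^sup>2 - r\<^sup>2) = (\<integral>\<theta>. (indicator {0<..<pi / 2} \<theta> * U (\<rho> * sin \<theta>)) * ln (\<rho>\<^sup>2 - r\<^sup>2) \<partial>lborel)"
      by (simp add: integral_mult_left_zero)
    also have "\<dots> = (\<integral>\<theta>. indicator {0<..<2 * pi} \<theta> * h2 (\<rho> *\<^sub>R unit_dir \<theta>) \<partial>lborel)"
    proof (rule Bochner_Integration.integral_cong[OF refl])
      fix \<theta> :: real
      have "indicator {0<..<2 * pi} \<theta> * indicator Q (\<rho> *\<^sub>R unit_dir \<theta>) = (indicator {0<..<pi / 2} \<theta> :: real)"
        using quadrant_angle[of \<theta>] \<rho> by (auto simp: Q_def indicator_def zero_less_mult_iff)
      then show "(indicator {0<..<pi / 2} \<theta> * U (\<rho> * sin \<theta>)) * ln (\<rho>\<^sup>2 - r\<^sup>2)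
          = indicator {0<..<2 * pi} \<theta> * h2 (\<rho> *\<^sub>R unit_dir \<theta>)"
        using \<rho> by (simp add: h2_def mult.assoc[symmetric])
    qed
    finally show ?thesis by simp
  qed
  then have "(\<integral>y. h1 y \<partial>lborel) = (\<integral>\<rho>. 4 * (indicator {0<..2 * R} \<rho> * (\<rho> * (\<integral>\<theta>. indicator {0<..<2 * pi} \<theta> * h2 (\<rho> *\<^sub>R unit_dir \<theta>) \<partial>lborel))) \<partial>lborel)"
    unfolding 1(2) by (intro Bochner_Integration.integral_cong refl) (simp add: indicator_def)
  then have h12: "(\<integral>y. h1 y \<partial>lborel) = 4 * (\<integral>y. h2 y \<partial>lborel)"
    unfolding 2(2) by (simp only: integral_mult_right_zero)

  have mv: "(\<lambda>x. vec2 (fst x) (snd x)) \<in> measurable (lborel \<Otimes>\<^sub>M lborel) borel"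
    by (simp add: lborel_prod)
  \<comment> \<open>The quarter disc integral again, now by slices of constant \<open>t\<close>.\<close>
  have i2: "integrable (lborel \<Otimes>\<^sub>M lborel) (\<lambda>(v, t). h2 (vec2 v t))"
    using 2(1) unfolding lborel_real2 by (subst (asm) integrable_distr_eq[OF mv mh2]) (simp add: case_prod_unfold)
  have "(\<integral>y. h2 y \<partial>lborel) = (\<integral>x. h2 (vec2 (fst x) (snd x)) \<partial>(lborel \<Otimes>\<^sub>M lborel))"
    unfolding lborel_real2 by (rule integral_distr[OF mv mh2])
  then have e2: "(\<integral>y. h2 y \<partial>lborel) = (\<integral>t. (\<integral>v. h2 (vec2 v t) \<partial>lborel) \<partial>lborel)"
    using lborel_pair.integral_snd[OF i2] by (simp add: case_prod_unfold)
  have sec: "(\<integral>v. h2 (vec2 v t) \<partial>lborel) = indicator {0<..2 * R} t * (u p t * inversion_kernel R t r)" for t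
  proof (cases "t \<in> {0<..2 * R}")
    case True
    define A where "A = sqrt (4 * R\<^sup>2 - t\<^sup>2)"
    have "t\<^sup>2 \<le> (2 * R)\<^sup>2" using True by (intro power_mono) auto
    then have A: "A \<ge> 0" "A\<^sup>2 = 4 * R\<^sup>2 - t\<^sup>2" by (simp_all add: A_def power_mult_distrib)
    have hi: "((\<lambda>v. ln (v\<^sup>2 + t\<^sup>2 - r\<^sup>2)) has_integral inversion_kernel R t r) {0..A}"
      unfolding A_def using True r by (intro inversion_kernel_has_integral) auto
    have Q_iff: "vec2 v t \<in> Q \<longleftrightarrow> v \<in> {0<..A}" for v
    proof -
      have "norm (vec2 v t) \<le> 2 * R \<longleftrightarrow> v\<^sup>2 + t\<^sup>2 \<le> (2 * R)\<^sup>2"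
        unfolding norm_real2 using R by (simp add: real_sqrt_le_iff' )
      also have "\<dots> \<longleftrightarrow> v\<^sup>2 \<le> A\<^sup>2" unfolding A(2) by (auto simp: power_mult_distrib)
      also have "\<dots> \<longleftrightarrow> \<bar>v\<bar> \<le> A" using A(1) abs_le_square_iff[of v A] by simp
      finally show ?thesis using True by (auto simp: Q_def)
    qed
    have "h2 (vec2 v t) = u p t * (indicator {0<..A} v * ln (v\<^sup>2 + t\<^sup>2 - r\<^sup>2))" for v
      using True Q_iff[of v] by (simp add: h2_def norm_real2 U_def indicator_def)
    then have "(\<integral>v. h2 (vec2 v t) \<partial>lborel) = u p t * (\<integral>v. indicator {0<..A} v * ln (v\<^sup>2 + t\<^sup>2 - r\<^sup>2) \<partial>lborel)"
      by (simp only: integral_mult_right_zero)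
    also have "(\<integral>v. indicator {0<..A} v * ln (v\<^sup>2 + t\<^sup>2 - r\<^sup>2) \<partial>lborel) = integral {0..A} (\<lambda>v. ln (v\<^sup>2 + t\<^sup>2 - r\<^sup>2))"
    proof (rule lborel_integral_between(2))
      show "(\<lambda>v. ln (v\<^sup>2 + t\<^sup>2 - r\<^sup>2)) absolutely_integrable_on {0..A}"
        by (rule absolutely_integrable_ln) (use hi in \<open>auto intro!: continuous_intros\<close>)
      show "(\<lambda>v. ln (v\<^sup>2 + t\<^sup>2 - r\<^sup>2)) \<in> borel_measurable borel" by measurable
    qed auto
    also have "\<dots> = inversion_kernel R t r" using hi by (rule integral_unique)
    finally show ?thesis using True by simp
  next
    case False
    have "\<bar>t\<bar> \<le> norm (vec2 v t)" for v using component_le_norm_cart[of "vec2 v t" 2] by simp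
    then have "vec2 v t \<notin> Q" for v using False R order_trans by (fastforce simp: Q_def)
    then have "h2 (vec2 v t) = 0" for v by (simp add: h2_def)
    then show ?thesis using False by simp
  qed
  have isec: "integrable lborel (\<lambda>t. indicator {0<..2 * R} t * (u p t * inversion_kernel R t r))"
    using lborel_pair.integrable_snd[OF i2] unfolding sec .
  have ae: "AE t in lborel. indicator {0<..2 * R} t * (u p t * inversion_kernel R t r) = indicator {0..2 * R} t * (u p t * inversion_kernel R t r)"
    using AE_lborel_singleton[of 0] by eventually_elim (auto simp: indicator_def)
  have m0: "(\<lambda>t. indicator {0..2 * R} t * (u p t * inversion_kernel R t r)) \<in> borel_measurable lborel"
  proof -
    have "(\<lambda>t. indicator {0..2 * R} t * (u p t * inversion_kernel R t r)) = (\<lambda>t. indicator {0..2 * R} t * (U t * inversion_kernel R t r))"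
      by (auto simp: U_def indicator_def)
    then show ?thesis by simp
  qed
  show ?I unfolding set_integrable_def real_scaleR_def
    by (rule iffD1[OF integrable_cong_AE[OF borel_measurable_integrable[OF isec] m0 ae] isec])
  have "(LINT t:{0..2 * R}|lborel. u p t * inversion_kernel R t r) = (\<integral>t. indicator {0<..2 * R} t * (u p t * inversion_kernel R t r) \<partial>lborel)"
    unfolding set_lebesgue_integral_def real_scaleR_def
    by (rule integral_cong_AE[OF borel_measurable_integrable[OF isec] m0 ae, symmetric])
  also have "\<dots> = (\<integral>y. h2 y \<partial>lborel)" by (simp only: e2 sec)
  also have "\<dots> = 1 / 4 * (\<integral>y. h1 y \<partial>lborel)" by (simp add: h12)
  finally have K: "(LINT t:{0..2 * R}|lborel. u p t * inversion_kernel R t r) = 1 / 4 * (\<integral>y. h1 y \<partial>lborel)" .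
  define g where "g = (\<lambda>y. f y * ln ((norm (y - p))\<^sup>2 - r\<^sup>2))"
  have mg: "g \<in> borel_measurable borel" unfolding g_def by measurable
  have h1g: "h1 = (\<lambda>y. g (p + y))" by (simp add: h1_def g_def)
  show ?J using 1(1) lborel_translate(1)[OF mg, of p] by (simp add: h1g g_def)
  show ?K using K lborel_translate(2)[OF mg, of p] by (simp add: h1g g_def)
qed

section \<open>Averaging over the circle\<close>

definition circle_point :: "real \<Rightarrow> real \<Rightarrow> real^2" where
  "circle_point R s = R *\<^sub>R unit_dir (s / R)"

lemma norm_circle_point [simp]: "norm (circle_point R s) = \<bar>R\<bar>"
  by (simp add: circle_point_def)

lemma continuous_on_circle_point [continuous_intros]:
  fixes f :: "'a::t2_space \<Rightarrow> real"
  assumes "continuous_on S f" "R \<noteq> 0"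
  shows "continuous_on S (\<lambda>x. circle_point R (f x))"
  unfolding circle_point_def using assms by (intro continuous_intros) auto

lemma inner_unit_dir: "unit_dir a \<bullet> unit_dir b = cos (a - b)"
  by (simp add: inner_real2 cos_diff)

text \<open>
  The quadratic terms in the point of the circle cancel, and \<open>\<bar>c\<bar> < 1\<close>
  follows from \<open>\<bar>\<bar>z\<bar> - \<bar>y\<bar>\<bar> \<le> \<bar>z - y\<bar>\<close>
  and \<open>\<bar>z\<bar> + \<bar>y\<bar> < 2R\<close>.
\<close>

lemma circle_log_integral:
  assumes R: "R > 0" and z: "norm z < R" and y: "norm y \<le> R" and yz: "y \<noteq> z"
  defines "L \<equiv> \<lambda>s. ln ((norm (y - circle_point R s))\<^sup>2 - (norm (z - circle_point R s))\<^sup>2)"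
  shows "(L has_integral (2 * pi * R * ln (R * norm (y - z)))) {0..2 * pi * R}"
    and "L absolutely_integrable_on {0..2 * pi * R}"
proof -
  define d where "d = norm (y - z)"
  have d: "d > 0" using yz by (simp add: d_def)
  obtain b where b: "y - z = d *\<^sub>R unit_dir b"
    using ex_unit_dir[of "y - z"] yz unfolding d_def by auto
  define c where "c = ((norm z)\<^sup>2 - (norm y)\<^sup>2) / (2 * R * d)"
  define m where "m = - 2 * R * d"
  have m: "m \<noteq> 0" using R d by (simp add: m_def)
  have "\<bar>(norm z)\<^sup>2 - (norm y)\<^sup>2\<bar> = \<bar>norm z - norm y\<bar> * (norm z + norm y)"
    by (simp add: power2_eq_square square_diff_square_factored abs_mult mult.commute)
  also have "\<dots> \<le> d * (norm z + norm y)"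
    using norm_triangle_ineq3[of y z] by (intro mult_right_mono) (auto simp: d_def abs_minus_commute)
  also have "\<dots> < d * (2 * R)" using z y d by (intro mult_strict_left_mono) auto
  finally have c: "\<bar>c\<bar> < 1" using R d by (simp add: c_def abs_divide abs_mult field_simps)
  have id: "(norm (y - circle_point R s))\<^sup>2 - (norm (z - circle_point R s))\<^sup>2 = m * (cos (1 / R * s + 0 - b) + c)" for s
  proof -
    have "(norm (y - circle_point R s))\<^sup>2 - (norm (z - circle_point R s))\<^sup>2 =
       (norm y)\<^sup>2 - (norm z)\<^sup>2 - 2 * (circle_point R s \<bullet> (y - z))"
      by (simp add: power2_norm_eq_inner inner_diff_left inner_diff_right inner_commute algebra_simps)
    also have "circle_point R s \<bullet> (y - z) = R * d * cos (s / R - b)"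
      by (simp add: b circle_point_def inner_unit_dir)
    also have "(norm y)\<^sup>2 - (norm z)\<^sup>2 - 2 * (R * d * cos (s / R - b)) = m * (cos (1 / R * s + 0 - b) + c)"
      using R d by (simp add: m_def c_def field_simps)
    finally show ?thesis .
  qed
  have "((\<lambda>s. ln (m * (cos (1 / R * s + 0 - b) + c))) has_integral (2 * pi * ln (m / 2) / (1 / R))) {0..2 * pi * R}"
    by (rule has_integral_affine_real) (use has_integral_ln_cos_add(1)[OF c m, of b] R in simp_all)
  moreover have "ln (m / 2) = ln (R * d)"
    using ln_minus[of "R * d"] by (simp add: m_def)
  ultimately show hi: "(L has_integral (2 * pi * R * ln (R * norm (y - z)))) {0..2 * pi * R}"
    unfolding L_def id d_def by (simp add: mult_ac)
  show "L absolutely_integrable_on {0..2 * pi * R}"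
    unfolding L_def
    by (rule absolutely_integrable_ln) (use hi R in \<open>auto simp: L_def intro!: continuous_intros\<close>)
qed

text \<open>
  Since \<open>L\<close> is bounded above, its absolute value is at most a constant minus
  \<open>L\<close>, whose integral is known. This bound justifies the exchange of the integrals
  over the circle and over the plane.
\<close>

lemma circle_log_abs_integral_le:
  assumes R: "R > 0" and z: "norm z < R" and y: "norm y \<le> R" and yz: "y \<noteq> z"
  defines "L \<equiv> \<lambda>s. ln ((norm (y - circle_point R s))\<^sup>2 - (norm (z - circle_point R s))\<^sup>2)"
  shows "integral {0..2 * pi * R} (\<lambda>s. \<bar>L s\<bar>) \<le> 16 * pi * R ^ 3 + 2 * pi * R * \<bar>ln (R * norm (y - z))\<bar>"
proof -
  note hi = circle_log_integral[OF R z y yz, folded L_def]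
  have bnd: "\<bar>L s\<bar> \<le> 8 * R\<^sup>2 - L s" for s
  proof -
    have "norm (y - circle_point R s) \<le> 2 * R" "norm (z - circle_point R s) \<le> 2 * R"
      using norm_triangle_ineq4[of y "circle_point R s"] norm_triangle_ineq4[of z "circle_point R s"] y z R by auto
    then have "(norm (y - circle_point R s))\<^sup>2 \<le> (2 * R)\<^sup>2" "(norm (z - circle_point R s))\<^sup>2 \<le> (2 * R)\<^sup>2"
      by (intro power_mono; simp)+
    moreover have "(norm (y - circle_point R s))\<^sup>2 \<ge> 0" "(norm (z - circle_point R s))\<^sup>2 \<ge> 0" by auto
    ultimately have "\<bar>(norm (y - circle_point R s))\<^sup>2 - (norm (z - circle_point R s))\<^sup>2\<bar> \<le> (2 * R)\<^sup>2" by linarith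
    then have "L s \<le> (2 * R)\<^sup>2" unfolding L_def by (rule order_trans[OF ln_le_abs])
    then have "L s \<le> 4 * R\<^sup>2" by (simp add: power_mult_distrib)
    then show ?thesis using zero_le_power2[of R] by linarith
  qed
  have "integral {0..2 * pi * R} (\<lambda>s. \<bar>L s\<bar>) \<le> integral {0..2 * pi * R} (\<lambda>s. 8 * R\<^sup>2 - L s)"
  proof (rule integral_le)
    show "(\<lambda>s. \<bar>L s\<bar>) integrable_on {0..2 * pi * R}"
      using absolutely_integrable_abs[OF hi(2)] by (intro set_lebesgue_integral_eq_integral(1)) simp
    show "(\<lambda>s. 8 * R\<^sup>2 - L s) integrable_on {0..2 * pi * R}"
      using hi(1) by (intro integrable_diff) auto
  qed (rule bnd)
  also have "\<dots> = 2 * pi * R * (8 * R\<^sup>2) - 2 * pi * R * ln (R * norm (y - z))"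
  proof -
    have "measure lborel {0..2 * pi * R} = 2 * pi * R" using R by simp
    then show ?thesis
      using integral_unique[OF has_integral_diff[OF has_integral_const_real[of "8 * R\<^sup>2" 0 "2 * pi * R"] hi(1)]]
      by (simp only: real_scaleR_def)
  qed
  also have "\<dots> \<le> 2 * pi * R * (8 * R\<^sup>2) + 2 * pi * R * \<bar>ln (R * norm (y - z))\<bar>"
  proof -
    have "2 * pi * R * (- ln (R * norm (y - z))) \<le> 2 * pi * R * \<bar>ln (R * norm (y - z))\<bar>"
      using R by (intro mult_left_mono) auto
    from add_left_mono[OF this, of "2 * pi * R * (8 * R\<^sup>2)"] show ?thesis
      by (simp only: mult_minus_right diff_conv_add_uminus)
  qed
  also have "2 * pi * R * (8 * R\<^sup>2) = 16 * pi * R ^ 3"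
    by (simp add: power2_eq_square power3_eq_cube)
  finally show ?thesis .
qed

lemma log_potential_integral:
  assumes R: "R > 0" and z: "norm z < R"
    and cf: "continuous_on UNIV f" and supp: "\<And>y. norm y > R \<Longrightarrow> f y = 0"
  shows "integrable lborel (\<lambda>y. \<bar>f y\<bar> * (a + b * \<bar>ln (R * norm (y - z))\<bar>))"
    and "(\<integral>y. f y * ln (R * norm (y - z)) \<partial>lborel) = polar_potential R (2 * R) f z"
proof -
  have mf [measurable]: "f \<in> borel_measurable borel" by (rule borel_measurable_continuous_onI[OF cf])
  have "bounded (f ` cball 0 R)"
    by (intro compact_imp_bounded compact_continuous_image continuous_on_subset[OF cf]) auto
  then obtain M where "\<forall>y\<in>f ` cball 0 R. norm y \<le> M" unfolding bounded_iff by blast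
  then have M: "\<And>y. norm y \<le> R \<Longrightarrow> \<bar>f y\<bar> \<le> M" by auto
  have M0: "M \<ge> 0" using M[of 0] R by auto
  have fb: "\<bar>f y\<bar> \<le> M" for y
    using M[of y] supp[of y] M0 by (cases "norm y \<le> R") auto
  \<comment> \<open>Points of the support of \<open>f\<close> are within \<open>2R\<close> of every \<open>z\<close> in the disc.\<close>
  have far: "f (z + w) = 0" if "norm w > 2 * R" for w
    using norm_triangle_ineq2[of w "- z"] that z by (intro supp) (simp add: add.commute)
  have R0: "R \<noteq> 0" using R by simp
  have G: "(\<lambda>r. r * (M * (a + b * \<bar>ln (R * r)\<bar>))) absolutely_integrable_on {0..2 * R}" for a b
  proof (rule absolutely_integrable_continuous_real)
    have "continuous_on {0..2 * R} (\<lambda>r. M * (a * r + b * \<bar>r * ln (R * r)\<bar>))"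
      by (intro continuous_intros continuous_log_weight[OF R0])
    then show "continuous_on {0..2 * R} (\<lambda>r. r * (M * (a + b * \<bar>ln (R * r)\<bar>)))"
      by (rule continuous_on_eq) (auto simp: abs_mult algebra_simps)
  qed
  have "integrable lborel (\<lambda>y. \<bar>f (z + y)\<bar> * (\<bar>a\<bar> + \<bar>b\<bar> * \<bar>ln (R * norm y)\<bar>))"
  proof (rule polar_integral(1)[OF _ _ G[of "\<bar>a\<bar>" "\<bar>b\<bar>"]])
    show "\<bar>\<bar>f (z + y)\<bar> * (\<bar>a\<bar> + \<bar>b\<bar> * \<bar>ln (R * norm y)\<bar>)\<bar> \<le> M * (\<bar>a\<bar> + \<bar>b\<bar> * \<bar>ln (R * norm y)\<bar>)" for y
      by (simp add: abs_mult mult_right_mono fb)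
  qed (auto simp: far)
  then have "integrable lborel (\<lambda>y. \<bar>f y\<bar> * (\<bar>a\<bar> + \<bar>b\<bar> * \<bar>ln (R * norm (y - z))\<bar>))"
    using lborel_translate(1)[of "\<lambda>y. \<bar>f y\<bar> * (\<bar>a\<bar> + \<bar>b\<bar> * \<bar>ln (R * norm (y - z))\<bar>)" z] by simp
  then show "integrable lborel (\<lambda>y. \<bar>f y\<bar> * (a + b * \<bar>ln (R * norm (y - z))\<bar>))"
  proof (rule Bochner_Integration.integrable_bound)
    show "AE y in lborel. norm (\<bar>f y\<bar> * (a + b * \<bar>ln (R * norm (y - z))\<bar>)) \<le> norm (\<bar>f y\<bar> * (\<bar>a\<bar> + \<bar>b\<bar> * \<bar>ln (R * norm (y - z))\<bar>))"
    proof (intro always_eventually allI)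
      fix y
      have "\<bar>a + b * \<bar>ln (R * norm (y - z))\<bar>\<bar> \<le> \<bar>a\<bar> + \<bar>b\<bar> * \<bar>ln (R * norm (y - z))\<bar>"
        by (rule order_trans[OF abs_triangle_ineq]) (simp add: abs_mult)
      then show "norm (\<bar>f y\<bar> * (a + b * \<bar>ln (R * norm (y - z))\<bar>)) \<le> norm (\<bar>f y\<bar> * (\<bar>a\<bar> + \<bar>b\<bar> * \<bar>ln (R * norm (y - z))\<bar>))"
        by (simp add: abs_mult mult_left_mono)
    qed
  qed measurable
  have "(\<integral>y. f y * ln (R * norm (y - z)) \<partial>lborel) = (\<integral>y. f (z + y) * ln (R * norm y) \<partial>lborel)"
    using lborel_translate(2)[of "\<lambda>y. f y * ln (R * norm (y - z))" z] by simp
  also have "\<dots> = (\<integral>r. indicator {0<..2 * R} r * (r * (\<integral>\<theta>. indicator {0<..<2 * pi} \<theta> * (f (z + r *\<^sub>R unit_dir \<theta>) * ln (R * norm (r *\<^sub>R unit_dir \<theta>))) \<partial>lborel)) \<partial>lborel)"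
  proof (rule polar_integral(2)[OF _ _ G[of 0 1]])
    show "\<bar>f (z + y) * ln (R * norm y)\<bar> \<le> M * (0 + 1 * \<bar>ln (R * norm y)\<bar>)" for y
      by (simp add: abs_mult mult_right_mono fb)
  qed (auto simp: far)
  also have "\<dots> = (\<integral>r. indicator {0<..2 * R} r * (r * ln (R * r) * circle_integral f z r) \<partial>lborel)"
  proof (rule Bochner_Integration.integral_cong[OF refl])
    fix r :: real
    show "indicator {0<..2 * R} r * (r * (\<integral>\<theta>. indicator {0<..<2 * pi} \<theta> * (f (z + r *\<^sub>R unit_dir \<theta>) * ln (R * norm (r *\<^sub>R unit_dir \<theta>))) \<partial>lborel))
       = indicator {0<..2 * R} r * (r * ln (R * r) * circle_integral f z r)"
    proof (cases "r \<in> {0<..2 * R}")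
      case True
      then have "(\<integral>\<theta>. indicator {0<..<2 * pi} \<theta> * (f (z + r *\<^sub>R unit_dir \<theta>) * ln (R * norm (r *\<^sub>R unit_dir \<theta>))) \<partial>lborel)
         = (\<integral>\<theta>. ln (R * r) * (indicator {0<..<2 * pi} \<theta> * f (z + r *\<^sub>R unit_dir \<theta>)) \<partial>lborel)"
        by (simp add: mult_ac)
      also have "\<dots> = ln (R * r) * circle_integral f z r"
        by (simp only: integral_mult_right_zero circle_integral_lborel[OF cf])
      finally show ?thesis by simp
    qed simp
  qed
  also have "\<dots> = integral {0..2 * R} (\<lambda>r. r * ln (R * r) * circle_integral f z r)"
  proof -
    have c: "continuous_on UNIV (\<lambda>r. r * ln (R * r) * circle_integral f z r)"
      by (intro continuous_intros continuous_log_weight[OF R0] continuous_circle_integral[OF cf])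
    show ?thesis
      by (rule lborel_integral_between(2))
         (auto intro: absolutely_integrable_continuous_real continuous_on_subset[OF c] borel_measurable_continuous_onI[OF c])
  qed
  also have "\<dots> = polar_potential R (2 * R) f z"
  proof -
    have c: "continuous_on (cbox (0, 0) (2 * R, 2 * pi)) (\<lambda>w. fst w * ln (R * fst w) * f (z + fst w *\<^sub>R unit_dir (snd w)))"
      by (intro continuous_intros continuous_on_compose2[OF continuous_log_weight[OF R0, of UNIV]]
           continuous_on_compose2[OF cf]) auto
    show ?thesis
      unfolding polar_potential_def integral_prod_continuous[OF c] circle_integral_def by simp
  qed
  finally show "(\<integral>y. f y * ln (R * norm (y - z)) \<partial>lborel) = polar_potential R (2 * R) f z" .
qed

text \<open>
  Fubini's theorem reduces the average to \<open>circle_log_integral\<close>; the exceptional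
  point \<open>y = z\<close> is a null set.
\<close>

lemma circle_average_of_log_integrals:
  assumes R: "R > 0" and z: "norm z < R"
    and cf: "continuous_on UNIV f" and supp: "\<And>y. norm y > R \<Longrightarrow> f y = 0"
  defines "L \<equiv> \<lambda>y s. ln ((norm (y - circle_point R s))\<^sup>2 - (norm (z - circle_point R s))\<^sup>2)"
  shows "(\<integral>s. indicator {0..<2 * pi * R} s * (\<integral>y. f y * L y s \<partial>lborel) \<partial>lborel)
     = 2 * pi * R * polar_potential R (2 * R) f z" (is ?E)
    and "integrable lborel (\<lambda>s. indicator {0..<2 * pi * R} s * (\<integral>y. f y * L y s \<partial>lborel))" (is ?I)
proof -
  have mf [measurable]: "f \<in> borel_measurable borel" by (rule borel_measurable_continuous_onI[OF cf])
  have R0: "R \<noteq> 0" using R by simp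
  let ?J = "{0..<2 * pi * R}"
  define H where "H = (\<lambda>y s. f y * (indicator ?J s * L y s))"
  have mL: "(\<lambda>x. L (fst x) (snd x)) \<in> borel_measurable (lborel \<Otimes>\<^sub>M lborel)"
  proof -
    have "(\<lambda>x. (norm (fst x - circle_point R (snd x)))\<^sup>2 - (norm (z - circle_point R (snd x)))\<^sup>2) \<in> borel_measurable (borel :: ((real^2) \<times> real) measure)"
      by (intro borel_measurable_continuous_onI continuous_intros R0)
    then show ?thesis unfolding L_def lborel_prod by measurable
  qed
  have mH: "(\<lambda>(y, s). H y s) \<in> borel_measurable (lborel \<Otimes>\<^sub>M lborel)"
    unfolding H_def case_prod_unfold
    by (intro borel_measurable_times measurable_compose[OF measurable_fst mf[unfolded measurable_lborel2[symmetric]]]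
        measurable_compose[OF measurable_snd borel_measurable_indicator] mL) auto
  have L1: "integrable lborel (\<lambda>s. indicator ?J s * L y s)"
       "(\<integral>s. indicator ?J s * L y s \<partial>lborel) = 2 * pi * R * ln (R * norm (y - z))"
       "(\<integral>s. indicator ?J s * \<bar>L y s\<bar> \<partial>lborel) \<le> 16 * pi * R ^ 3 + 2 * pi * R * \<bar>ln (R * norm (y - z))\<bar>"
    if y: "norm y \<le> R" "y \<noteq> z" for y
  proof -
    have m: "L y \<in> borel_measurable borel"
    proof -
      have "(\<lambda>s. (norm (y - circle_point R s))\<^sup>2 - (norm (z - circle_point R s))\<^sup>2) \<in> borel_measurable borel"
        by (intro borel_measurable_continuous_onI continuous_intros R0)
      then show ?thesis unfolding L_def by measurable
    qed
    have hi2: "L y absolutely_integrable_on {0..2 * pi * R}"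
      using circle_log_integral(2)[OF R z y] unfolding L_def .
    have hi1: "integral {0..2 * pi * R} (L y) = 2 * pi * R * ln (R * norm (y - z))"
      using circle_log_integral(1)[OF R z y] unfolding L_def by (rule integral_unique)
    show "integrable lborel (\<lambda>s. indicator ?J s * L y s)"
      by (rule lborel_integral_between(1)[OF hi2 m]) auto
    show "(\<integral>s. indicator ?J s * L y s \<partial>lborel) = 2 * pi * R * ln (R * norm (y - z))"
      unfolding hi1[symmetric] by (rule lborel_integral_between(2)[OF hi2 m]) auto
    have "(\<lambda>s. \<bar>L y s\<bar>) absolutely_integrable_on {0..2 * pi * R}"
      using absolutely_integrable_abs[OF hi2] by simp
    then have "(\<integral>s. indicator ?J s * \<bar>L y s\<bar> \<partial>lborel) = integral {0..2 * pi * R} (\<lambda>s. \<bar>L y s\<bar>)"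
      by (rule lborel_integral_between(2)) (use m in auto)
    also have "\<dots> \<le> 16 * pi * R ^ 3 + 2 * pi * R * \<bar>ln (R * norm (y - z))\<bar>"
      using circle_log_abs_integral_le[OF R z y] unfolding L_def .
    finally show "(\<integral>s. indicator ?J s * \<bar>L y s\<bar> \<partial>lborel) \<le> 16 * pi * R ^ 3 + 2 * pi * R * \<bar>ln (R * norm (y - z))\<bar>" .
  qed
  have ne: "AE y in lborel. y \<noteq> z" by (rule AE_lborel_singleton)
  have intH: "integrable (lborel \<Otimes>\<^sub>M lborel) (\<lambda>(y, s). H y s)"
  proof (rule lborel_pair.Fubini_integrable[OF mH])
    have mI: "(\<lambda>y. \<integral>s. norm (H y s) \<partial>lborel) \<in> borel_measurable lborel"
      by (rule lborel.borel_measurable_lebesgue_integral)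
         (use measurable_compose[OF mH borel_measurable_norm] in \<open>simp add: case_prod_unfold\<close>)
    show "integrable lborel (\<lambda>y. \<integral>s. norm (case (y, s) of (y, s) \<Rightarrow> H y s) \<partial>lborel)"
      unfolding prod.case
    proof (rule Bochner_Integration.integrable_bound[OF log_potential_integral(1)[OF R z cf supp, of "16 * pi * R ^ 3" "2 * pi * R"] mI])
      show "AE y in lborel. norm (\<integral>s. norm (H y s) \<partial>lborel) \<le> norm (\<bar>f y\<bar> * (16 * pi * R ^ 3 + 2 * pi * R * \<bar>ln (R * norm (y - z))\<bar>))"
        using ne
      proof eventually_elim
        case (elim y)
        show ?case
        proof (cases "norm y \<le> R")
          case True
          have "(\<integral>s. norm (H y s) \<partial>lborel) = \<bar>f y\<bar> * (\<integral>s. indicator ?J s * \<bar>L y s\<bar> \<partial>lborel)"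
            by (simp add: H_def abs_mult integral_mult_right_zero)
          also have "\<dots> \<le> \<bar>f y\<bar> * (16 * pi * R ^ 3 + 2 * pi * R * \<bar>ln (R * norm (y - z))\<bar>)"
            by (intro mult_left_mono L1(3) True elim) simp
          finally show ?thesis by (simp add: Bochner_Integration.integral_nonneg)
        next
          case False
          then show ?thesis using supp[of y] by (simp add: H_def)
        qed
      qed
    qed auto
    show "AE y in lborel. integrable lborel (\<lambda>s. case (y, s) of (y, s) \<Rightarrow> H y s)"
      using ne
    proof eventually_elim
      case (elim y)
      then show ?case using L1(1)[of y] supp[of y] by (cases "norm y \<le> R") (auto simp: H_def)
    qed
  qed
  have inner: "(\<integral>y. H y s \<partial>lborel) = indicator ?J s * (\<integral>y. f y * L y s \<partial>lborel)" for s
    by (cases "s \<in> ?J") (simp_all add: H_def)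
  show ?I using lborel_pair.integrable_snd[OF intH] unfolding inner .
  have "(\<integral>s. indicator ?J s * (\<integral>y. f y * L y s \<partial>lborel) \<partial>lborel) = (\<integral>y. (\<integral>s. H y s \<partial>lborel) \<partial>lborel)"
    unfolding inner[symmetric] by (rule lborel_pair.Fubini_integral[OF intH])
  also have "\<dots> = (\<integral>y. 2 * pi * R * (f y * ln (R * norm (y - z))) \<partial>lborel)"
  proof (rule integral_cong_AE)
    show "(\<lambda>y. \<integral>s. H y s \<partial>lborel) \<in> borel_measurable lborel"
      by (rule lborel.borel_measurable_lebesgue_integral[OF mH])
    show "AE y in lborel. (\<integral>s. H y s \<partial>lborel) = 2 * pi * R * (f y * ln (R * norm (y - z)))"
      using ne
    proof eventually_elim
      case (elim y)
      show ?case
      proof (cases "norm y \<le> R")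
        case True
        then show ?thesis using L1(2)[of y] elim by (simp add: H_def integral_mult_right_zero)
      qed (use supp[of y] in \<open>simp add: H_def\<close>)
    qed
  qed measurable
  also have "\<dots> = 2 * pi * R * polar_potential R (2 * R) f z"
  proof -
    have "(\<integral>y. f y * ln (R * norm (y - z)) \<partial>lborel) = polar_potential R (2 * R) f z"
      by (rule log_potential_integral(2)[OF R z cf supp])
    then show ?thesis by (simp only: integral_mult_right_zero)
  qed
  finally show ?E .
qed

section \<open>The inversion formula\<close>

text \<open>
  The potential formula is available only on the open disc, so the Laplacian has to be
  transported from a function that agrees locally.
\<close>

lemma has_laplacian_cmult_near:
  assumes G: "has_laplacian G L x" and r: "r > 0"
    and eq: "\<And>y. y \<in> ball x r \<Longrightarrow> F y = c * G y"
  shows "has_laplacian F (c * L) x"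
proof -
  obtain g' g'' where g: "\<And>b. b \<in> Basis \<Longrightarrow> \<forall>\<^sub>F s in nhds 0. ((\<lambda>r. G (x + r *\<^sub>R b)) has_real_derivative g' b s) (at s)"
     "\<And>b. b \<in> Basis \<Longrightarrow> (g' b has_real_derivative g'' b) (at 0)" "L = (\<Sum>b\<in>Basis. g'' b)"
    using G unfolding has_laplacian_def by blast
  show ?thesis unfolding has_laplacian_def
  proof (intro exI conjI ballI)
    fix b :: 'a assume b: "b \<in> Basis"
    have "\<forall>\<^sub>F s in nhds (0 :: real). \<bar>s\<bar> < r"
      using r by (auto simp: eventually_nhds_metric dist_real_def)
    then show "\<forall>\<^sub>F s in nhds 0. ((\<lambda>r. F (x + r *\<^sub>R b)) has_real_derivative c * g' b s) (at s)"
      using g(1)[OF b]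
    proof eventually_elim
      case (elim s)
      show ?case
      proof (rule has_field_derivative_transform_within_open[OF DERIV_cmult[OF elim(2)], of "{s. \<bar>s\<bar> < r}"])
        show "open {s :: real. \<bar>s\<bar> < r}" by (intro open_Collect_less continuous_intros)
        show "c * G (x + t *\<^sub>R b) = F (x + t *\<^sub>R b)" if "t \<in> {s. \<bar>s\<bar> < r}" for t
          using eq[of "x + t *\<^sub>R b"] that b by (simp add: dist_norm)
      qed (use elim in simp)
    qed
    show "((\<lambda>s. c * g' b s) has_real_derivative c * g'' b) (at 0)"
      by (rule DERIV_cmult[OF g(2)[OF b]])
  next
    show "c * L = (\<Sum>b\<in>Basis. c * g'' b)" by (simp add: g(3) sum_distrib_left)
  qed
qed

lemma circle_point_vector: "vector [R * cos (s / R), R * sin (s / R)] = circle_point R s"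
  by (rule vec2_eqI) (simp_all add: circle_point_def)

lemma circle_arclength_integral:
  fixes g :: "real^2 \<Rightarrow> real"
  assumes R: "R > 0" and g: "(\<lambda>p. indicator (sphere 0 R) p * g p) \<in> borel_measurable borel"
  shows "set_integrable (circle_arclength R) (sphere 0 R) g \<longleftrightarrow>
      integrable lborel (\<lambda>s. indicator {0..<2 * pi * R} s * g (circle_point R s))"
    and "(LINT p:sphere 0 R|circle_arclength R. g p) = (\<integral>s. indicator {0..<2 * pi * R} s * g (circle_point R s) \<partial>lborel)"
proof -
  let ?M = "restrict_space lborel {0..<2 * pi * R}"
  have mc: "circle_point R \<in> measurable ?M borel"
  proof -
    have "circle_point R \<in> borel_measurable borel"
      using R by (intro borel_measurable_continuous_onI continuous_intros) auto
    then show ?thesis by (intro measurable_restrict_space1) simp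
  qed
  have c: "circle_arclength R = distr ?M borel (circle_point R)"
    unfolding circle_arclength_def circle_point_vector ..
  have ind: "indicator (sphere 0 R) (circle_point R s) = (1 :: real)" for s
    using R by simp
  show "set_integrable (circle_arclength R) (sphere 0 R) g \<longleftrightarrow>
      integrable lborel (\<lambda>s. indicator {0..<2 * pi * R} s * g (circle_point R s))"
    unfolding set_integrable_def c real_scaleR_def
    by (subst integrable_distr_eq[OF mc g]) (simp add: ind integrable_restrict_space)
  show "(LINT p:sphere 0 R|circle_arclength R. g p) = (\<integral>s. indicator {0..<2 * pi * R} s * g (circle_point R s) \<partial>lborel)"
    unfolding set_lebesgue_integral_def c real_scaleR_def
    by (subst integral_distr[OF mc g]) (simp add: ind integral_restrict_space)
qed

text \<open>
  The values of \<open>u\<close> at negative times are arbitrary, hence the truncation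
  \<open>max 0 t\<close> to obtain a jointly continuous function.
\<close>

lemma measurable_inner_integral:
  fixes u :: "real^2 \<Rightarrow> real \<Rightarrow> real"
  assumes u: "wave_solution f u"
  shows "(\<lambda>p. LINT t:{0..a}|lborel. u p t * inversion_kernel R t (norm (z - p))) \<in> borel_measurable borel"
proof -
  have cp: "continuous_on UNIV (\<lambda>x :: (real^2) \<times> real. (fst x, max 0 (snd x)))"
    by (intro continuous_on_Pair continuous_on_max continuous_intros)
  have "continuous_on UNIV (\<lambda>x. (\<lambda>z. u (fst z) (snd z)) (fst x, max 0 (snd x)))"
    by (rule continuous_on_compose2[OF wave_solution_continuous[OF u] cp]) auto
  then have cu: "continuous_on UNIV (\<lambda>x. u (fst x) (max 0 (snd x)))" by simp
  have mu: "(\<lambda>x. u (fst x) (max 0 (snd x))) \<in> borel_measurable (borel \<Otimes>\<^sub>M lborel)"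
  proof -
    have "sets (borel \<Otimes>\<^sub>M lborel :: ((real^2) \<times> real) measure) = sets (borel :: ((real^2) \<times> real) measure)"
      unfolding borel_prod[symmetric] by (rule sets_pair_measure_cong) simp_all
    then show ?thesis
      using borel_measurable_continuous_onI[OF cu] measurable_cong_sets[OF _ refl] by blast
  qed
  have mi: "(\<lambda>x. indicator {0..a} (snd x) :: real) \<in> borel_measurable (borel \<Otimes>\<^sub>M lborel)" by measurable
  have mk: "(\<lambda>x. inversion_kernel R (snd x) (norm (z - fst x))) \<in> borel_measurable (borel \<Otimes>\<^sub>M lborel)" by measurable
  have "(\<lambda>(p, t). indicator {0..a} t * (u p (max 0 t) * inversion_kernel R t (norm (z - p)))) \<in> borel_measurable (borel \<Otimes>\<^sub>M lborel)"
    unfolding case_prod_unfold by (intro borel_measurable_times mu mi mk)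
  then have "(\<lambda>p. \<integral>t. indicator {0..a} t * (u p (max 0 t) * inversion_kernel R t (norm (z - p))) \<partial>lborel) \<in> borel_measurable borel"
    by (rule lborel.borel_measurable_lebesgue_integral)
  moreover have "(LINT t:{0..a}|lborel. u p t * inversion_kernel R t (norm (z - p)))
     = (\<integral>t. indicator {0..a} t * (u p (max 0 t) * inversion_kernel R t (norm (z - p))) \<partial>lborel)" for p
    unfolding set_lebesgue_integral_def real_scaleR_def
    by (intro Bochner_Integration.integral_cong refl) (auto simp: indicator_def)
  ultimately show ?thesis by simp
qed

lemma vanishing_gradient:
  fixes f :: "real^2 \<Rightarrow> real"
  assumes f: "\<And>x. (f has_derivative (\<lambda>h. h $ 1 * f1 x + h $ 2 * f2 x)) (at x)"
    and supp: "\<And>y. norm y > R \<Longrightarrow> f y = 0" and x: "norm x > R"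
  shows "f1 x = 0" "f2 x = 0"
proof -
  have "open {y :: real^2. R < norm y}" by (intro open_Collect_less continuous_intros)
  then have "((\<lambda>y. 0) has_derivative (\<lambda>h. h $ 1 * f1 x + h $ 2 * f2 x)) (at x)"
    by (rule has_derivative_transform_within_open[OF f]) (use x supp in auto)
  then have z: "(\<lambda>h :: real^2. h $ 1 * f1 x + h $ 2 * f2 x) = (\<lambda>h. 0)"
    by (rule has_derivative_unique[OF _ has_derivative_const])
  show "f1 x = 0" using fun_cong[OF z, of "vec2 1 0"] by simp
  show "f2 x = 0" using fun_cong[OF z, of "vec2 0 1"] by simp
qed

theorem theorem3:
  fixes R0 :: real
  assumes "R0 > 0"
  shows "\<exists>K :: real \<Rightarrow> real \<Rightarrow> real.
    (\<forall>t r. 0 \<le> t \<and> t \<le> 2 * R0 \<and> 0 \<le> r \<and> r < 2 * R0 \<and> t \<noteq> r \<longrightarrow>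
       K t r = sqrt (4 * R0\<^sup>2 - t\<^sup>2) * (- 2 + ln \<bar>4 * R0\<^sup>2 - r\<^sup>2\<bar>) + Gamma_kernel R0 t r) \<and>
    (\<forall>(f :: real^2 \<Rightarrow> real) u.
       smooth f \<and> closure {y. f y \<noteq> 0} \<subseteq> cball 0 R0 \<and> wave_solution f u \<longrightarrow>
       (\<forall>x\<in>ball 0 R0.
          (\<forall>p\<in>sphere 0 R0. set_integrable lborel {0..2 * R0} (\<lambda>t. u p t * K t (norm (x - p)))) \<and>
          set_integrable (circle_arclength R0) (sphere 0 R0)
            (\<lambda>p. LINT t:{0..2 * R0}|lborel. u p t * K t (norm (x - p))) \<and>
          (\<exists>L. has_laplacian
                 (\<lambda>z. LINT p:sphere 0 R0|circle_arclength R0.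
                        LINT t:{0..2 * R0}|lborel. u p t * K t (norm (z - p))) L x \<and>
               f x = 1 / (R0 * pi\<^sup>2) * L)))"
proof (intro exI[of _ "inversion_kernel R0"] conjI allI impI ballI)
  fix t r :: real
  show "inversion_kernel R0 t r = sqrt (4 * R0\<^sup>2 - t\<^sup>2) * (- 2 + ln \<bar>4 * R0\<^sup>2 - r\<^sup>2\<bar>) + Gamma_kernel R0 t r"
    by (rule inversion_kernel_def)
next
  fix f :: "real^2 \<Rightarrow> real" and u :: "real^2 \<Rightarrow> real \<Rightarrow> real" and x :: "real^2"
  assume A: "smooth f \<and> closure {y. f y \<noteq> 0} \<subseteq> cball 0 R0 \<and> wave_solution f u" and "x \<in> ball 0 R0"
  then have x: "norm x < R0" and u: "wave_solution f u" by auto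
  note R = \<open>R0 > 0\<close>
  have supp: "f y = 0" if "norm y > R0" for y
    using A closure_subset[of "{y. f y \<noteq> 0}"] that by force
  obtain f1 f2 f11 f12 f21 f22 where
    f: "\<And>x. (f has_derivative (\<lambda>h. h $ 1 * f1 x + h $ 2 * f2 x)) (at x)"
    and pg: "plane_gradient f1 f2 f11 f12 f21 f22"
    using Ck_2_gradient[of f] A unfolding smooth_def by blast
  note cont = plane_gradient.cont1[OF pg] plane_gradient.cont2[OF pg]
  have cf: "continuous_on UNIV f"
    using f by (auto simp: continuous_on_eq_continuous_at intro: has_derivative_continuous)
  let ?I = "\<lambda>z p. LINT t:{0..2 * R0}|lborel. u p t * inversion_kernel R0 t (norm (z - p))"
  have dist: "0 \<le> norm (z - p)" "norm (z - p) < 2 * R0" if "norm z < R0" "norm p = R0" for z p :: "real^2"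
    using norm_triangle_ineq4[of z p] that by auto
  note plane = inversion_kernel_integral_eq_plane_integral[OF R u f cont supp _ dist]
  have ms: "(\<lambda>p. indicator (sphere 0 R0) p * ?I z p) \<in> borel_measurable borel" for z
    by (intro borel_measurable_times borel_measurable_indicator measurable_inner_integral[OF u]) auto
  have I_eq: "?I z (circle_point R0 s) = 1 / 4 * (\<integral>y. f y * ln ((norm (y - circle_point R0 s))\<^sup>2 - (norm (z - circle_point R0 s))\<^sup>2) \<partial>lborel)"
    if "norm z < R0" for z s
    by (rule plane(3)) (use that R in auto)
  note avg = circle_average_of_log_integrals[OF R _ cf supp]
  have F_eq: "(LINT p:sphere 0 R0|circle_arclength R0. ?I z p) = (pi * R0 / 2) * polar_potential R0 (2 * R0) f z"
    if z: "norm z < R0" for z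
  proof -
    have "(LINT p:sphere 0 R0|circle_arclength R0. ?I z p) = (\<integral>s. 1 / 4 * (indicator {0..<2 * pi * R0} s *
        (\<integral>y. f y * ln ((norm (y - circle_point R0 s))\<^sup>2 - (norm (z - circle_point R0 s))\<^sup>2) \<partial>lborel)) \<partial>lborel)"
      unfolding circle_arclength_integral(2)[OF R ms] I_eq[OF z] by (simp add: mult_ac)
    also have "\<dots> = 1 / 4 * (2 * pi * R0 * polar_potential R0 (2 * R0) f z)"
      unfolding integral_mult_right_zero using avg(1)[OF z] by simp
    finally show ?thesis by simp
  qed
  show "set_integrable lborel {0..2 * R0} (\<lambda>t. u p t * inversion_kernel R0 t (norm (x - p)))" if "p \<in> sphere 0 R0" for p
    by (rule plane(1)) (use that x in auto)
  show "set_integrable (circle_arclength R0) (sphere 0 R0) (?I x)"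
    unfolding circle_arclength_integral(1)[OF R ms] I_eq[OF x]
    using integrable_mult_right[OF avg(2)[OF x], of "1 / 4"] by (simp add: mult_ac)
  have far: "norm (x + (2 * R0) *\<^sub>R unit_dir \<theta>) > R0" for \<theta>
    using norm_triangle_ineq2[of "(2 * R0) *\<^sub>R unit_dir \<theta>" "- x"] x R by (simp add: add.commute)
  have "has_laplacian (polar_potential R0 (2 * R0) f) (2 * pi * f x) x"
    by (rule polar_potential_laplacian[OF R _ f pg])
       (use R far supp vanishing_gradient[OF f supp] in auto)
  then have "has_laplacian (\<lambda>z. LINT p:sphere 0 R0|circle_arclength R0. ?I z p) ((pi * R0 / 2) * (2 * pi * f x)) x"
  proof (rule has_laplacian_cmult_near)
    show "R0 - norm x > 0" using x by simp
    fix y assume "y \<in> ball x (R0 - norm x)"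
    then have "norm y < R0" using norm_triangle_ineq2[of y x] by (simp add: dist_norm norm_minus_commute)
    then show "(LINT p:sphere 0 R0|circle_arclength R0. ?I y p) = (pi * R0 / 2) * polar_potential R0 (2 * R0) f y"
      by (rule F_eq)
  qed
  moreover have "f x = 1 / (R0 * pi\<^sup>2) * ((pi * R0 / 2) * (2 * pi * f x))"
    using R by (simp add: power2_eq_square)
  ultimately show "\<exists>L. has_laplacian (\<lambda>z. LINT p:sphere 0 R0|circle_arclength R0. ?I z p) L x \<and> f x = 1 / (R0 * pi\<^sup>2) * L"
    by blast
qed

end
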